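(* Let $(M,g)$ be an $n$-dimensional ($n>3$) conformally harmonic weakly $Z$ symmetric manifold $(WZS)_n$, i.e. $\nabla_mC_{jkl}{}^m=0$. Let $\omega_k=A_k-B_k$ and let $\zeta$ be the eigenvalue of the $Z$ tensor belonging to its eigenvector $\omega$, $Z_{kl}\omega^l=\zeta\omega_k$. Then: 1) $M$ is a quasi Einstein manifold; 2) if the $Z$ tensor is non singular and if $\omega_j\nabla_k\phi-\omega_k\nabla_j\phi=0$, then $$(\omega_j\nabla_k-\omega_k\nabla_j)\left[\frac{n\zeta-Z}{n-1}\right]=0,$$ and $M$ admits a proper concircular vector.
   Context: $(M,g)$ is an $n$-dimensional Riemannian manifold with Levi-Civita connection $\nabla$; index notation with summation over repeated indices; $R_{jkl}{}^m$ is the Riemann tensor, $R_{kl}=-R_{mkl}{}^m$ the Ricci tensor, $R=g^{ij}R_{ij}$ the scalar curvature. Generalized $Z$ tensor: $Z_{kl}=R_{kl}+\phi\,g_{kl}$, where $\phi$ is an arbitrary scalar function; $Z=g^{kl}Z_{kl}=R+n\phi$ is the $Z$ scalar. The manifold is weakly $Z$ symmetric, $(WZS)_n$, if for some $\phi$ there are covectors $A_k,B_k,D_k$ with $$\nabla_kZ_{jl}=A_kZ_{jl}+B_jZ_{kl}+D_lZ_{kj}.$$ The $Z$ tensor is non singular if there is a $(2,0)$ tensor $Z^{-1}$ with $(Z^{-1})^{kh}Z_{kl}=\delta^h{}_l$. In a conformally harmonic $(WZS)_n$ the 1-form $\omega$ is an eigenvector of the $Z$ tensor. Conformal curvature tensor: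 $$C_{jkl}{}^m=R_{jkl}{}^m+\tfrac{1}{n-2}(\delta_j{}^mR_{kl}-\delta_k{}^mR_{jl}+R_j{}^mg_{kl}-R_k{}^mg_{jl})-\tfrac{R}{(n-1)(n-2)}(\delta_j{}^mg_{kl}-\delta_k{}^mg_{jl}).$$ Quasi Einstein manifold: the Ricci tensor has the form $R_{kl}=\alpha g_{kl}+\beta T_kT_l$ with scalar functions $\alpha,\beta$ and a unit covector $T_k$. A (non zero) covector $X_l$ is concircular if $\nabla_jX_l=\mu_jX_l+\rho\,g_{jl}$ for some covector $\mu_j$ and scalar function $\rho$; it is proper concircular if moreover $\mu_j$ is a closed 1-form ($\nabla_i\mu_j=\nabla_j\mu_i$). For a unit covector $T_l$ this means $\nabla_jT_l=f(T_jT_l-g_{jl})$ for a scalar function $f$ with $fT_k$ closed.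
   Formalization: For the existence of a proper concircular vector it is additionally assumed that nζ−Z vanishes identically on no nonempty open set (no open piece is Einstein); without this the claim fails, e.g. for Ricci-flat Riemannian Schwarzschild with φ=e^r, A=dr, B=D=0. *)

theory Defs
  imports "HOL-Analysis.Analysis"
begin

text \<open>
  Smooth manifolds are given by atlases on a Hausdorff second countable space, and tensor fields
  by their components in every chart of the atlas, subject to the classical transformation law.
  The index type \<open>'n\<close> is the set of coordinate indices, so the dimension is \<open>CARD('n)\<close>.
  A chart is a pair of its domain and its coordinate map; the values of the coordinate map and
  of tensor components outside the domain are irrelevant.
\<close>

type_synonym ('m, 'n) chart = "'m set \<times> ('m \<Rightarrow> real ^ 'n)"
type_synonym ('m, 'n) tensor1 = "('m, 'n) chart \<Rightarrow> 'm \<Rightarrow> 'n \<Rightarrow> real"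
type_synonym ('m, 'n) tensor2 = "('m, 'n) chart \<Rightarrow> 'm \<Rightarrow> 'n \<Rightarrow> 'n \<Rightarrow> real"
type_synonym ('m, 'n) tensor4 =
  "('m, 'n) chart \<Rightarrow> 'm \<Rightarrow> 'n \<Rightarrow> 'n \<Rightarrow> 'n \<Rightarrow> 'n \<Rightarrow> real"

section \<open>Smooth manifolds\<close>

definition partial_deriv :: "'n \<Rightarrow> (real ^ 'n \<Rightarrow> real) \<Rightarrow> real ^ 'n::finite \<Rightarrow> real" where
  "partial_deriv k f x = frechet_derivative f (at x) (axis k 1)"

text \<open>The set \<open>S\<close> is always open in what follows.\<close>

fun Ck_on :: "nat \<Rightarrow> (real ^ 'n::finite) set \<Rightarrow> (real ^ 'n \<Rightarrow> real) \<Rightarrow> bool" where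
  "Ck_on 0 S f \<longleftrightarrow> continuous_on S f"
| "Ck_on (Suc r) S f \<longleftrightarrow>
     (\<forall>x\<in>S. f differentiable (at x)) \<and> (\<forall>k. Ck_on r S (partial_deriv k f))"

definition smooth_on :: "(real ^ 'n::finite) set \<Rightarrow> (real ^ 'n \<Rightarrow> real) \<Rightarrow> bool" where
  "smooth_on S f \<longleftrightarrow> (\<forall>r. Ck_on r S f)"

definition is_chart :: "('m::topological_space, 'n::finite) chart \<Rightarrow> bool" where
  "is_chart c \<longleftrightarrow> open (fst c) \<and> open (snd c ` fst c) \<and>
     homeomorphism (fst c) (snd c ` fst c) (snd c) (inv_into (fst c) (snd c))"

text \<open>A function on the manifold, read in the coordinates of the chart \<open>c\<close>.\<close>

definition in_coords ::
    "('m, 'n::finite) chart \<Rightarrow> ('m \<Rightarrow> real) \<Rightarrow> real ^ 'n \<Rightarrow> real" where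
  "in_coords c f = f \<circ> inv_into (fst c) (snd c)"

definition smooth_atlas :: "('m::topological_space, 'n::finite) chart set \<Rightarrow> bool" where
  "smooth_atlas \<A> \<longleftrightarrow> (\<forall>c\<in>\<A>. is_chart c) \<and>
     (\<forall>c\<in>\<A>. \<forall>c'\<in>\<A>. \<forall>a.
        smooth_on (snd c' ` (fst c \<inter> fst c')) (in_coords c' (\<lambda>q. snd c q $ a)))"

definition points :: "('m, 'n) chart set \<Rightarrow> 'm set" where
  "points \<A> = (\<Union>c\<in>\<A>. fst c)"

text \<open>The coordinate derivative $\partial f/\partial x^k$ at \<open>p\<close> in the chart \<open>c\<close>.\<close>

definition coord_deriv ::
    "('m, 'n::finite) chart \<Rightarrow> 'n \<Rightarrow> ('m \<Rightarrow> real) \<Rightarrow> 'm \<Rightarrow> real" where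
  "coord_deriv c k f p = partial_deriv k (in_coords c f) (snd c p)"

text \<open>\<open>jacobian c c' p a k\<close> is $\partial x^a/\partial x'^k$ at \<open>p\<close>, with $x$, $x'$ the
  coordinates of \<open>c\<close>, \<open>c'\<close>.\<close>

definition jacobian ::
    "('m, 'n::finite) chart \<Rightarrow> ('m, 'n) chart \<Rightarrow> 'm \<Rightarrow> 'n \<Rightarrow> 'n \<Rightarrow> real" where
  "jacobian c c' p a k = coord_deriv c' k (\<lambda>q. snd c q $ a) p"

section \<open>Tensor fields\<close>

definition smooth_in_chart :: "('m, 'n::finite) chart \<Rightarrow> ('m \<Rightarrow> real) \<Rightarrow> bool" where
  "smooth_in_chart c f \<longleftrightarrow> smooth_on (snd c ` fst c) (in_coords c f)"

definition scalar_field :: "('m, 'n::finite) chart set \<Rightarrow> ('m \<Rightarrow> real) \<Rightarrow> bool" where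
  "scalar_field \<A> f \<longleftrightarrow> (\<forall>c\<in>\<A>. smooth_in_chart c f)"

definition covector_field ::
    "('m, 'n::finite) chart set \<Rightarrow> ('m, 'n) tensor1 \<Rightarrow> bool" where
  "covector_field \<A> X \<longleftrightarrow>
     (\<forall>c\<in>\<A>. \<forall>k. smooth_in_chart c (\<lambda>p. X c p k)) \<and>
     (\<forall>c\<in>\<A>. \<forall>c'\<in>\<A>. \<forall>p\<in>fst c \<inter> fst c'. \<forall>k.
        X c' p k = (\<Sum>a\<in>UNIV. jacobian c c' p a k * X c p a))"

definition tensor_field_02 ::
    "('m, 'n::finite) chart set \<Rightarrow> ('m, 'n) tensor2 \<Rightarrow> bool" where
  "tensor_field_02 \<A> S \<longleftrightarrow>
     (\<forall>c\<in>\<A>. \<forall>k l. smooth_in_chart c (\<lambda>p. S c p k l)) \<and>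
     (\<forall>c\<in>\<A>. \<forall>c'\<in>\<A>. \<forall>p\<in>fst c \<inter> fst c'. \<forall>k l.
        S c' p k l =
          (\<Sum>a\<in>UNIV. \<Sum>b\<in>UNIV. jacobian c c' p a k * jacobian c c' p b l * S c p a b))"

definition tensor_field_20 ::
    "('m, 'n::finite) chart set \<Rightarrow> ('m, 'n) tensor2 \<Rightarrow> bool" where
  "tensor_field_20 \<A> W \<longleftrightarrow>
     (\<forall>c\<in>\<A>. \<forall>k l. smooth_in_chart c (\<lambda>p. W c p k l)) \<and>
     (\<forall>c\<in>\<A>. \<forall>c'\<in>\<A>. \<forall>p\<in>fst c \<inter> fst c'. \<forall>k l.
        W c' p k l =
          (\<Sum>a\<in>UNIV. \<Sum>b\<in>UNIV. jacobian c' c p k a * jacobian c' c p l b * W c p a b))"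

section \<open>Riemannian metrics, Levi-Civita connection and curvature\<close>

definition riemannian_manifold ::
    "('m::{t2_space, second_countable_topology}, 'n::finite) chart set \<Rightarrow>
     ('m, 'n) tensor2 \<Rightarrow> bool" where
  "riemannian_manifold \<A> g \<longleftrightarrow> smooth_atlas \<A> \<and> tensor_field_02 \<A> g \<and>
     (\<forall>c\<in>\<A>. \<forall>p\<in>fst c.
        (\<forall>i j. g c p i j = g c p j i) \<and>
        (\<forall>v::real^'n. v \<noteq> 0 \<longrightarrow>
           (\<Sum>i\<in>UNIV. \<Sum>j\<in>UNIV. g c p i j * v $ i * v $ j) > 0))"

text \<open>$g^{ij}$\<close>

definition metric_inv :: "('m, 'n::finite) tensor2 \<Rightarrow> ('m, 'n) tensor2" where
  "metric_inv g c p i j = matrix_inv (\<chi> a b. g c p a b) $ i $ j"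

text \<open>\<open>christoffel g c p m j k\<close> is
  $\Gamma^m_{jk} = \frac12 g^{mh}(\partial_j g_{hk} + \partial_k g_{hj} - \partial_h g_{jk})$.\<close>

definition christoffel ::
    "('m, 'n::finite) tensor2 \<Rightarrow> ('m, 'n) chart \<Rightarrow> 'm \<Rightarrow> 'n \<Rightarrow> 'n \<Rightarrow> 'n \<Rightarrow> real" where
  "christoffel g c p m j k = 1/2 * (\<Sum>h\<in>UNIV. metric_inv g c p m h *
     (coord_deriv c j (\<lambda>q. g c q h k) p + coord_deriv c k (\<lambda>q. g c q h j) p
      - coord_deriv c h (\<lambda>q. g c q j k) p))"

text \<open>In the covariant derivatives, the index of the derivative comes first:
  $\nabla_k X_l$, $\nabla_k S_{jl}$, $\nabla_i C_{jkl}{}^m$.\<close>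

definition nabla_01 ::
    "('m, 'n::finite) tensor2 \<Rightarrow> ('m, 'n) tensor1 \<Rightarrow> ('m, 'n) tensor2" where
  "nabla_01 g X c p k l =
     coord_deriv c k (\<lambda>q. X c q l) p - (\<Sum>a\<in>UNIV. christoffel g c p a k l * X c p a)"

definition nabla_02 ::
    "('m, 'n::finite) tensor2 \<Rightarrow> ('m, 'n) tensor2 \<Rightarrow>
     ('m, 'n) chart \<Rightarrow> 'm \<Rightarrow> 'n \<Rightarrow> 'n \<Rightarrow> 'n \<Rightarrow> real" where
  "nabla_02 g S c p k j l =
     coord_deriv c k (\<lambda>q. S c q j l) p
     - (\<Sum>a\<in>UNIV. christoffel g c p a k j * S c p a l)
     - (\<Sum>a\<in>UNIV. christoffel g c p a k l * S c p j a)"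

definition nabla_13 ::
    "('m, 'n::finite) tensor2 \<Rightarrow> ('m, 'n) tensor4 \<Rightarrow>
     ('m, 'n) chart \<Rightarrow> 'm \<Rightarrow> 'n \<Rightarrow> 'n \<Rightarrow> 'n \<Rightarrow> 'n \<Rightarrow> 'n \<Rightarrow> real" where
  "nabla_13 g C c p i j k l m =
     coord_deriv c i (\<lambda>q. C c q j k l m) p
     - (\<Sum>a\<in>UNIV. christoffel g c p a i j * C c p a k l m)
     - (\<Sum>a\<in>UNIV. christoffel g c p a i k * C c p j a l m)
     - (\<Sum>a\<in>UNIV. christoffel g c p a i l * C c p j k a m)
     + (\<Sum>a\<in>UNIV. christoffel g c p m i a * C c p j k l a)"

text \<open>\<open>riemann g c p j k l m\<close> is $R_{jkl}{}^m$, with the sign fixed by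
  $(\nabla_j\nabla_k - \nabla_k\nabla_j) X_l = R_{jkl}{}^m X_m$. Together with
  $R_{kl} = -R_{mkl}{}^m$ this makes the Ricci tensor of round spheres positive.\<close>

definition riemann :: "('m, 'n::finite) tensor2 \<Rightarrow> ('m, 'n) tensor4" where
  "riemann g c p j k l m =
     coord_deriv c k (\<lambda>q. christoffel g c q m j l) p
     - coord_deriv c j (\<lambda>q. christoffel g c q m k l) p
     + (\<Sum>a\<in>UNIV. christoffel g c p a j l * christoffel g c p m k a)
     - (\<Sum>a\<in>UNIV. christoffel g c p a k l * christoffel g c p m j a)"

definition ricci :: "('m, 'n::finite) tensor2 \<Rightarrow> ('m, 'n) tensor2" where
  "ricci g c p k l = - (\<Sum>m\<in>UNIV. riemann g c p m k l m)"

text \<open>$R_j{}^m$\<close>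

definition ricci_mixed :: "('m, 'n::finite) tensor2 \<Rightarrow> ('m, 'n) tensor2" where
  "ricci_mixed g c p j m = (\<Sum>a\<in>UNIV. ricci g c p j a * metric_inv g c p a m)"

text \<open>The trace $g^{kl}S_{kl}$, computed in the chart \<open>c\<close>; for tensor fields its value does
  not depend on \<open>c\<close>.\<close>

definition trace_g ::
    "('m, 'n::finite) tensor2 \<Rightarrow> ('m, 'n) tensor2 \<Rightarrow> ('m, 'n) chart \<Rightarrow> 'm \<Rightarrow> real" where
  "trace_g g S c p = (\<Sum>k\<in>UNIV. \<Sum>l\<in>UNIV. metric_inv g c p k l * S c p k l)"

definition scalar_curvature ::
    "('m, 'n::finite) tensor2 \<Rightarrow> ('m, 'n) chart \<Rightarrow> 'm \<Rightarrow> real" where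
  "scalar_curvature g = trace_g g (ricci g)"

definition kdelta :: "'n \<Rightarrow> 'n \<Rightarrow> real" where
  "kdelta i j = (if i = j then 1 else 0)"

definition conformal_curvature :: "('m, 'n::finite) tensor2 \<Rightarrow> ('m, 'n) tensor4" where
  "conformal_curvature g c p j k l m =
     riemann g c p j k l m
     + 1 / (real CARD('n) - 2) *
         (kdelta j m * ricci g c p k l - kdelta k m * ricci g c p j l
          + ricci_mixed g c p j m * g c p k l - ricci_mixed g c p k m * g c p j l)
     - scalar_curvature g c p / ((real CARD('n) - 1) * (real CARD('n) - 2)) *
         (kdelta j m * g c p k l - kdelta k m * g c p j l)"

definition conformally_harmonic ::
    "('m, 'n::finite) chart set \<Rightarrow> ('m, 'n) tensor2 \<Rightarrow> bool" where
  "conformally_harmonic \<A> g \<longleftrightarrow>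
     (\<forall>c\<in>\<A>. \<forall>p\<in>fst c. \<forall>j k l.
        (\<Sum>m\<in>UNIV. nabla_13 g (conformal_curvature g) c p m j k l m) = 0)"

text \<open>$g^{kl}X_kY_l$\<close>

definition inner_g ::
    "('m, 'n::finite) tensor2 \<Rightarrow> ('m, 'n) tensor1 \<Rightarrow> ('m, 'n) tensor1 \<Rightarrow>
     ('m, 'n) chart \<Rightarrow> 'm \<Rightarrow> real" where
  "inner_g g X Y c p = (\<Sum>k\<in>UNIV. \<Sum>l\<in>UNIV. metric_inv g c p k l * X c p k * Y c p l)"

text \<open>$X^l = g^{lm}X_m$\<close>

definition raise_index ::
    "('m, 'n::finite) tensor2 \<Rightarrow> ('m, 'n) tensor1 \<Rightarrow> ('m, 'n) tensor1" where
  "raise_index g X c p l = (\<Sum>m\<in>UNIV. metric_inv g c p l m * X c p m)"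

section \<open>Weakly Z symmetric, quasi Einstein, concircular\<close>

definition Z_tensor ::
    "('m, 'n::finite) tensor2 \<Rightarrow> ('m \<Rightarrow> real) \<Rightarrow> ('m, 'n) tensor2" where
  "Z_tensor g \<phi> c p k l = ricci g c p k l + \<phi> p * g c p k l"

definition Z_scalar ::
    "('m, 'n::finite) tensor2 \<Rightarrow> ('m \<Rightarrow> real) \<Rightarrow> ('m, 'n) chart \<Rightarrow> 'm \<Rightarrow> real" where
  "Z_scalar g \<phi> = trace_g g (Z_tensor g \<phi>)"

definition weakly_Z_symmetric_with ::
    "('m, 'n::finite) chart set \<Rightarrow> ('m, 'n) tensor2 \<Rightarrow> ('m \<Rightarrow> real) \<Rightarrow>
     ('m, 'n) tensor1 \<Rightarrow> ('m, 'n) tensor1 \<Rightarrow> ('m, 'n) tensor1 \<Rightarrow> bool" where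
  "weakly_Z_symmetric_with \<A> g \<phi> A B D \<longleftrightarrow>
     scalar_field \<A> \<phi> \<and> covector_field \<A> A \<and> covector_field \<A> B \<and> covector_field \<A> D \<and>
     (\<forall>c\<in>\<A>. \<forall>p\<in>fst c. \<forall>j k l.
        nabla_02 g (Z_tensor g \<phi>) c p k j l =
          A c p k * Z_tensor g \<phi> c p j l + B c p j * Z_tensor g \<phi> c p k l
          + D c p l * Z_tensor g \<phi> c p k j)"

definition nonsingular ::
    "('m, 'n::finite) chart set \<Rightarrow> ('m, 'n) tensor2 \<Rightarrow> bool" where
  "nonsingular \<A> S \<longleftrightarrow> (\<exists>W. tensor_field_20 \<A> W \<and>
     (\<forall>c\<in>\<A>. \<forall>p\<in>fst c. \<forall>h l.
        (\<Sum>k\<in>UNIV. W c p k h * S c p k l) = kdelta h l))"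

definition nowhere_zero ::
    "('m, 'n::finite) chart set \<Rightarrow> ('m, 'n) tensor1 \<Rightarrow> bool" where
  "nowhere_zero \<A> X \<longleftrightarrow> (\<forall>c\<in>\<A>. \<forall>p\<in>fst c. \<exists>k. X c p k \<noteq> 0)"

text \<open>As usual for eigenvectors, \<open>X\<close> has to be nonzero (at every point).\<close>

definition eigenvector ::
    "('m, 'n::finite) chart set \<Rightarrow> ('m, 'n) tensor2 \<Rightarrow> ('m, 'n) tensor2 \<Rightarrow>
     ('m, 'n) tensor1 \<Rightarrow> ('m \<Rightarrow> real) \<Rightarrow> bool" where
  "eigenvector \<A> g S X \<zeta> \<longleftrightarrow> nowhere_zero \<A> X \<and>
     (\<forall>c\<in>\<A>. \<forall>p\<in>fst c. \<forall>k.
        (\<Sum>l\<in>UNIV. S c p k l * raise_index g X c p l) = \<zeta> p * X c p k)"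

definition quasi_einstein ::
    "('m, 'n::finite) chart set \<Rightarrow> ('m, 'n) tensor2 \<Rightarrow> bool" where
  "quasi_einstein \<A> g \<longleftrightarrow> (\<exists>\<alpha> \<beta> T.
     scalar_field \<A> \<alpha> \<and> scalar_field \<A> \<beta> \<and> covector_field \<A> T \<and>
     (\<forall>c\<in>\<A>. \<forall>p\<in>fst c. inner_g g T T c p = 1 \<and>
        (\<forall>k l. ricci g c p k l = \<alpha> p * g c p k l + \<beta> p * T c p k * T c p l)))"

definition closed_form ::
    "('m, 'n::finite) chart set \<Rightarrow> ('m, 'n) tensor2 \<Rightarrow> ('m, 'n) tensor1 \<Rightarrow> bool" where
  "closed_form \<A> g \<mu> \<longleftrightarrow>
     (\<forall>c\<in>\<A>. \<forall>p\<in>fst c. \<forall>i j. nabla_01 g \<mu> c p i j = nabla_01 g \<mu> c p j i)"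

definition proper_concircular ::
    "('m, 'n::finite) chart set \<Rightarrow> ('m, 'n) tensor2 \<Rightarrow> ('m, 'n) tensor1 \<Rightarrow> bool" where
  "proper_concircular \<A> g X \<longleftrightarrow>
     covector_field \<A> X \<and> nowhere_zero \<A> X \<and>
     (\<exists>\<mu> \<rho>. covector_field \<A> \<mu> \<and> scalar_field \<A> \<rho> \<and> closed_form \<A> g \<mu> \<and>
        (\<forall>c\<in>\<A>. \<forall>p\<in>fst c. \<forall>j l.
           nabla_01 g X c p j l = \<mu> c p j * X c p l + \<rho> p * g c p j l))"

text \<open>\<open>\<zeta>\<close> is not the \<open>n\<close>-fold eigenvalue $Z/n$ of the \<open>Z\<close> tensor identically on any nonempty open
  set. By the form of the \<open>Z\<close> tensor in a conformally harmonic weakly \<open>Z\<close> symmetric manifold,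
  $Z_{kl} = \frac{Z-\zeta}{n-1}g_{kl} + \frac{n\zeta-Z}{n-1}T_kT_l$ with $T = \omega/|\omega|$, this
  says that no nonempty open piece of the manifold is Einstein. On an Einstein manifold
  the equation of weak \<open>Z\<close> symmetry holds, e.g. for any smooth positive \<open>f\<close> with nowhere vanishing
  differential, \<open>\<phi> = f - R/n\<close>, $A = d \ln f$ and \<open>B = D = 0\<close>, so that
  it gives no information about the geometry; there need not be a concircular vector.\<close>

definition nowhere_locally_degenerate ::
    "('m::topological_space, 'n::finite) chart set \<Rightarrow> ('m, 'n) tensor2 \<Rightarrow>
     ('m \<Rightarrow> real) \<Rightarrow> ('m \<Rightarrow> real) \<Rightarrow> bool" where
  "nowhere_locally_degenerate \<A> g \<phi> \<zeta> \<longleftrightarrow>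
     (\<forall>U. open U \<and> U \<noteq> {} \<and> U \<subseteq> points \<A> \<longrightarrow>
        (\<exists>c\<in>\<A>. \<exists>p\<in>fst c \<inter> U. real CARD('n) * \<zeta> p - Z_scalar g \<phi> c p \<noteq> 0))"

end

theory Submission
  imports Defs
begin

text \<open>
  Contracting the second Bianchi identity turns the vanishing divergence of the conformal tensor
  into $\nabla_k R_{jl} - \nabla_j R_{kl} = (g_{jl}\nabla_k R - g_{kl}\nabla_j R)/(2(n-1))$.
  Antisymmetrizing the equation of weak \<open>Z\<close> symmetry eliminates \<open>D\<close>, since the Ricci tensor is
  symmetric, and leaves
  $\omega_k Z_{jl} - \omega_j Z_{kl} = \psi_k g_{jl} - \psi_j g_{kl}$. Contractions with
  $\omega$ give $\psi \parallel \omega$ and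
  $Z_{kl} = \sigma g_{kl} + \nu T_kT_l$ with $T = \omega/|\omega|$, $\nu = \zeta - \sigma$.

  If \<open>Z\<close> is non singular, then $B = D$, and inserting this form of \<open>Z\<close> into the equation of weak \<open>Z\<close> symmetry gives,
  by pure algebra, that \<open>A\<close>, \<open>B\<close>, $d\sigma$ and $d\zeta$ are multiples of \<open>T\<close> and that
  $\nu\nabla_kT_j = b\sigma(g_{kj} - T_kT_j)$ where $B = bT$. With $f = -\mathrm{div}\,T/(n-1)$,
  which is smooth, this becomes $\nabla_kT_j = f(T_kT_j - g_{kj})$ on the dense set $\nu \neq 0$ and
  hence everywhere. Finally $d^2\sigma = d^2\zeta = 0$ forces $db \parallel T$, so that
  $df \parallel T$ and $fT$ is closed.
\<close>

section \<open>Smooth functions of several variables\<close>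

text \<open>With A = a T and B = b T the algebra yields d\<sigma> = a \<sigma> T and d\<zeta> = (a +
  2 b) \<zeta> T. A non singular Z has no eigenvalue zero, so \<sigma> and \<zeta> can be cancelled:
  once T is closed, second exterior derivatives show that da and d(a + 2 b) are multiples of T,
  hence so is db. The relation f \<nu> = - b \<sigma> passes this on to df wherever \<nu> is
  nonzero. The obstacle is that \<nu> may vanish on a set without interior points, where - b
  \<sigma> / \<nu> makes no sense; every identity for f is therefore first proved after
  multiplication by \<nu>. A second obstacle is that tensors are families of components. The scalars
  \<sigma>, \<nu> and f are computed chart by chart and become functions on the manifold only
  because the transformation laws of the connection and of the curvature make the charts agree. The
  bound n > 3 enters through a factor n - 3 in front of the antisymmetrized derivative of the Ricci
  tensor; in dimension three the conformal tensor vanishes and its divergence says nothing.\<close>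

lemma partial_deriv_cong:
  assumes "open S" "x \<in> S" "\<And>y. y \<in> S \<Longrightarrow> f y = h y"
  shows "partial_deriv k f x = partial_deriv k h x"
proof (cases "f differentiable (at x)")
  case True
  then show ?thesis unfolding partial_deriv_def
    using frechet_derivative_transform_within_open[OF True assms] by simp
next
  case False
  have "\<not> h differentiable (at x)"
  proof
    assume "h differentiable (at x)"
    then obtain h' where "(h has_derivative h') (at x)" by (auto simp: differentiable_def)
    then have "(f has_derivative h') (at x)"
      using has_derivative_transform_within_open assms by metis
    with False show False by (auto simp: differentiable_def)
  qed
  \<comment> \<open>\<open>frechet_derivative\<close> is a choice, and without differentiability
    both choices are made from the same empty predicate. This lets \<open>Ck_on_cong\<close> descend
    through all derivatives without regularity assumptions.\<close>
  have "(\<lambda>f'. (f has_derivative f') (at x)) = (\<lambda>f'. (h has_derivative f') (at x))"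
    using False \<open>\<not> h differentiable (at x)\<close> by (auto simp: differentiable_def)
  then show ?thesis by (simp add: partial_deriv_def frechet_derivative_def)
qed

lemma Ck_on_cong:
  assumes "open S" "\<And>y. y \<in> S \<Longrightarrow> f y = h y"
  shows "Ck_on r S f \<longleftrightarrow> Ck_on r S h"
  using assms(2)
proof (induction r arbitrary: f h)
  case 0
  then show ?case by (simp cong: continuous_on_cong)
next
  case (Suc r)
  have 1: "f differentiable (at x) \<longleftrightarrow> h differentiable (at x)" if "x \<in> S" for x
    using has_derivative_transform_within_open[OF _ assms(1) that] Suc.prems
    unfolding differentiable_def by metis
  have 2: "Ck_on r S (partial_deriv k f) \<longleftrightarrow> Ck_on r S (partial_deriv k h)" for k
    by (rule Suc.IH) (rule partial_deriv_cong[OF assms(1)], auto simp: Suc.prems)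
  show ?case using 1 2 by simp
qed

lemma Ck_on_subset: "Ck_on r S f \<Longrightarrow> T \<subseteq> S \<Longrightarrow> Ck_on r T f"
  by (induction r arbitrary: f) (auto intro: continuous_on_subset)

lemma Ck_on_SucD: "Ck_on (Suc r) S f \<Longrightarrow> Ck_on r S f"
proof (induction r arbitrary: f)
  case 0
  then show ?case
    by (auto intro!: continuous_at_imp_continuous_on differentiable_imp_continuous_within)
next
  case (Suc r)
  show ?case unfolding Ck_on.simps(2)[of r]
    using Suc.prems Suc.IH unfolding Ck_on.simps(2)[of "Suc r"] by blast
qed

lemma has_partial_derivs:
  assumes "f differentiable (at x)"
  shows "(f has_derivative (\<lambda>v. \<Sum>k\<in>UNIV. v $ k * partial_deriv k f x)) (at x)"
proof -
  have d: "(f has_derivative frechet_derivative f (at x)) (at x)"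
    using assms by (simp add: frechet_derivative_works)
  interpret linear "frechet_derivative f (at x)"
    using assms by (rule linear_frechet_derivative)
  have "frechet_derivative f (at x) v = (\<Sum>k\<in>UNIV. v $ k * partial_deriv k f x)" for v
  proof -
    have "frechet_derivative f (at x) v = frechet_derivative f (at x) (\<Sum>k\<in>UNIV. v $ k *s axis k 1)"
      by (simp add: basis_expansion)
    also have "\<dots> = (\<Sum>k\<in>UNIV. v $ k * partial_deriv k f x)"
      by (simp add: sum partial_deriv_def scalar_mult_eq_scaleR scale)
    finally show ?thesis .
  qed
  then show ?thesis using d by (metis (no_types, lifting) ext)
qed

lemma partial_derivI:
  assumes "(f has_derivative f') (at x)"
  shows "partial_deriv k f x = f' (axis k 1)"
  using frechet_derivative_at[OF assms] by (simp add: partial_deriv_def)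

lemma has_derivative_frechet:
  "f differentiable (at x) \<Longrightarrow> (f has_derivative frechet_derivative f (at x)) (at x)"
  by (simp add: frechet_derivative_works)

lemma partial_deriv_const [simp]: "partial_deriv k (\<lambda>x. a) = (\<lambda>x. 0)"
  by (simp add: partial_deriv_def fun_eq_iff)

lemma partial_deriv_add:
  assumes "f differentiable (at x)" "h differentiable (at x)"
  shows "partial_deriv k (\<lambda>y. f y + h y) x = partial_deriv k f x + partial_deriv k h x"
  unfolding partial_derivI[OF has_derivative_add[OF assms[THEN has_derivative_frechet]]]
  by (simp add: partial_deriv_def)

lemma partial_deriv_mult:
  assumes "f differentiable (at x)" "h differentiable (at x)"
  shows "partial_deriv k (\<lambda>y. f y * h y) x = f x * partial_deriv k h x + partial_deriv k f x * h x"
  unfolding partial_derivI[OF has_derivative_mult[OF assms[THEN has_derivative_frechet]]]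
  by (simp add: partial_deriv_def)

lemma partial_deriv_compose:
  fixes u :: "real \<Rightarrow> real"
  assumes "f differentiable (at x)" "(u has_real_derivative u') (at (f x))"
  shows "partial_deriv k (\<lambda>y. u (f y)) x = u' * partial_deriv k f x"
proof -
  have "((\<lambda>y. u (f y)) has_derivative (\<lambda>v. u' * frechet_derivative f (at x) v)) (at x)"
    using has_derivative_compose[OF has_derivative_frechet[OF assms(1)]
        assms(2)[unfolded has_field_derivative_def]] .
  from partial_derivI[OF this] show ?thesis by (simp add: partial_deriv_def)
qed

lemma differentiable_compose_real:
  fixes u :: "real \<Rightarrow> real"
  assumes "f differentiable (at x)" "(u has_real_derivative u') (at (f x))"
  shows "(\<lambda>y. u (f y)) differentiable (at x)"
  using has_derivative_compose[OF has_derivative_frechet[OF assms(1)]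
        assms(2)[unfolded has_field_derivative_def]] by (auto simp: differentiable_def)

lemma Ck_on_const [simp]: "Ck_on r S (\<lambda>x. a)"
  by (induction r arbitrary: a) auto

lemma Ck_on_add:
  assumes "open S"
  shows "Ck_on r S f \<Longrightarrow> Ck_on r S h \<Longrightarrow> Ck_on r S (\<lambda>x. f x + h x)"
proof (induction r arbitrary: f h)
  case (Suc r)
  have "Ck_on r S (partial_deriv k (\<lambda>x. f x + h x))" for k
    using Suc.prems by (subst Ck_on_cong[OF assms partial_deriv_add]) (auto intro!: Suc.IH)
  with Suc.prems show ?case by auto
qed (auto intro: continuous_intros)

lemma Ck_on_mult:
  assumes "open S"
  shows "Ck_on r S f \<Longrightarrow> Ck_on r S h \<Longrightarrow> Ck_on r S (\<lambda>x. f x * h x)"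
proof (induction r arbitrary: f h)
  case (Suc r)
  have "Ck_on r S f" "Ck_on r S h" using Suc.prems Ck_on_SucD by blast+
  then have "Ck_on r S (partial_deriv k (\<lambda>x. f x * h x))" for k
    using Suc.prems
    by (subst Ck_on_cong[OF assms partial_deriv_mult]) (auto intro!: Suc.IH Ck_on_add[OF assms])
  with Suc.prems show ?case by auto
qed (auto intro: continuous_intros)

lemma smooth_on_const [simp]: "smooth_on S (\<lambda>x. a)"
  by (simp add: smooth_on_def)

lemma smooth_on_add: "open S \<Longrightarrow> smooth_on S f \<Longrightarrow> smooth_on S h \<Longrightarrow> smooth_on S (\<lambda>x. f x + h x)"
  by (simp add: smooth_on_def Ck_on_add)

lemma smooth_on_mult: "open S \<Longrightarrow> smooth_on S f \<Longrightarrow> smooth_on S h \<Longrightarrow> smooth_on S (\<lambda>x. f x * h x)"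
  by (simp add: smooth_on_def Ck_on_mult)

lemma smooth_on_cong:
  "open S \<Longrightarrow> (\<And>y. y \<in> S \<Longrightarrow> f y = h y) \<Longrightarrow> smooth_on S f \<longleftrightarrow> smooth_on S h"
  using Ck_on_cong unfolding smooth_on_def by blast

lemma smooth_on_subset: "smooth_on S f \<Longrightarrow> T \<subseteq> S \<Longrightarrow> smooth_on T f"
  using Ck_on_subset unfolding smooth_on_def by blast

lemma smooth_on_differentiable: "smooth_on S f \<Longrightarrow> x \<in> S \<Longrightarrow> f differentiable (at x)"
  unfolding smooth_on_def by (metis Ck_on.simps(2))

lemma smooth_on_continuous_on: "smooth_on S f \<Longrightarrow> continuous_on S f"
  unfolding smooth_on_def by (metis Ck_on.simps(1))

lemma smooth_on_partial_deriv: "smooth_on S f \<Longrightarrow> smooth_on S (partial_deriv k f)"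
  unfolding smooth_on_def by (metis Ck_on.simps(2))

text \<open>The hypothesis expresses the derivative through \<open>f\<close> itself, so that
  regularity can be bootstrapped.\<close>

lemma Ck_on_bootstrap:
  assumes S: "open S" and f: "smooth_on S f" and c: "continuous_on S (\<lambda>x. u (f x))"
    and d: "\<And>x. x \<in> S \<Longrightarrow> (u has_real_derivative v x) (at (f x))"
    and step: "\<And>r. Ck_on r S (\<lambda>x. u (f x)) \<Longrightarrow> Ck_on r S v"
  shows "smooth_on S (\<lambda>x. u (f x))"
proof -
  have "Ck_on r S (\<lambda>x. u (f x))" for r
  proof (induction r)
    case (Suc r)
    have "Ck_on r S (partial_deriv k f)" for k
      using smooth_on_partial_deriv[OF f] by (simp add: smooth_on_def)
    then have "Ck_on r S (partial_deriv k (\<lambda>x. u (f x)))" for k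
      by (subst Ck_on_cong[OF S partial_deriv_compose[OF smooth_on_differentiable[OF f] d]])
        (auto intro!: Ck_on_mult[OF S] step Suc.IH)
    moreover have "(\<lambda>x. u (f x)) differentiable (at x)" if "x \<in> S" for x
      using differentiable_compose_real[OF smooth_on_differentiable[OF f that] d[OF that]] .
    ultimately show ?case by simp
  qed (simp add: c)
  then show ?thesis by (simp add: smooth_on_def)
qed

text \<open>The derivative of the reciprocal is minus its square, hence a polynomial in the function
  whose regularity is in question, as the bootstrap requires.\<close>

lemma smooth_on_inverse:
  assumes S: "open S" and f: "smooth_on S f" and nz: "\<And>x. x \<in> S \<Longrightarrow> f x \<noteq> 0"
  shows "smooth_on S (\<lambda>x. inverse (f x))"
proof (rule Ck_on_bootstrap[OF S f])
  show "continuous_on S (\<lambda>x. inverse (f x))"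
    using smooth_on_continuous_on[OF f] nz by (auto intro: continuous_on_inverse)
  show "(inverse has_real_derivative (-1) * (inverse (f x) * inverse (f x))) (at (f x))" if "x \<in> S" for x
    using DERIV_inverse[OF nz[OF that]] by (simp add: power2_eq_square)
  show "Ck_on r S (\<lambda>x. (-1) * (inverse (f x) * inverse (f x)))"
    if "Ck_on r S (\<lambda>x. inverse (f x))" for r
    by (intro Ck_on_mult[OF S] that Ck_on_const)
qed

lemma smooth_on_sqrt:
  assumes S: "open S" and f: "smooth_on S f" and pos: "\<And>x. x \<in> S \<Longrightarrow> f x > 0"
  shows "smooth_on S (\<lambda>x. sqrt (f x))"
proof (rule Ck_on_bootstrap[OF S f])
  show "continuous_on S (\<lambda>x. sqrt (f x))"
    using smooth_on_continuous_on[OF f] by (rule continuous_on_real_sqrt)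
  \<comment> \<open>The derivative 1 / (2 sqrt y) is written as sqrt y times 1 / (2 y): the root
    itself then appears only as a factor, and the other factor is smooth by
    \<open>smooth_on_inverse\<close>.\<close>
  show "(sqrt has_real_derivative sqrt (f x) * (1/2 * inverse (f x))) (at (f x))" if "x \<in> S" for x
  proof -
    have "sqrt (f x) * (1/2 * inverse (f x)) = inverse (sqrt (f x)) / 2"
      using pos[OF that] by (simp add: field_simps)
    then show ?thesis using DERIV_real_sqrt[OF pos[OF that]] by simp
  qed
  have "Ck_on r S (\<lambda>x. inverse (f x))" for r
    using smooth_on_inverse[OF S f] pos by (force simp: smooth_on_def)
  then show "Ck_on r S (\<lambda>x. sqrt (f x) * (1/2 * inverse (f x)))"
    if "Ck_on r S (\<lambda>x. sqrt (f x))" for r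
    by (intro Ck_on_mult[OF S] that Ck_on_const)
qed

section \<open>Symmetry of second partial derivatives\<close>

lemma mvt_partial_deriv:
  fixes f :: "real ^ 'n \<Rightarrow> real"
  assumes "h > 0" "\<And>s. 0 \<le> s \<Longrightarrow> s \<le> h \<Longrightarrow> f differentiable (at (x + s *\<^sub>R axis k 1))"
  obtains s where "0 < s" "s < h"
    "f (x + h *\<^sub>R axis k 1) - f x = h * partial_deriv k f (x + s *\<^sub>R axis k 1)"
proof -
  have d: "((\<lambda>s. f (x + s *\<^sub>R axis k 1)) has_real_derivative
       partial_deriv k f (x + s *\<^sub>R axis k 1)) (at s)" if "0 \<le> s" "s \<le> h" for s
  proof -
    let ?F = "frechet_derivative f (at (x + s *\<^sub>R axis k 1))"
    have 1: "((\<lambda>s. x + s *\<^sub>R axis k 1) has_derivative (\<lambda>t. t *\<^sub>R axis k 1)) (at s)"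
      by (auto intro!: derivative_eq_intros)
    have 2: "(f has_derivative ?F) (at (x + s *\<^sub>R axis k 1))"
      using assms(2)[OF that] by (rule has_derivative_frechet)
    have "linear ?F" using assms(2)[OF that] by (rule linear_frechet_derivative)
    then have "(\<lambda>t. ?F (t *\<^sub>R axis k 1)) = (*) (partial_deriv k f (x + s *\<^sub>R axis k 1))"
      by (simp add: fun_eq_iff partial_deriv_def linear_scale)
    with has_derivative_compose[OF 1 2] show ?thesis by (simp add: has_field_derivative_def)
  qed
  from MVT2[OF assms(1) d] show thesis using that by auto
qed

text \<open>The second difference is symmetric in \<open>i\<close> and \<open>j\<close>, while the
  mean value theorem, applied along \<open>i\<close> and then along \<open>j\<close>, turns it into
  an iterated derivative of one particular order. Used in both orders, this compares the two mixed
  derivatives. The bound \<open>2 * h < e\<close> keeps the whole parallelogram in the ball.\<close>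

lemma mixed_difference_quotient:
  fixes f :: "real ^ 'n \<Rightarrow> real"
  assumes f: "smooth_on (ball x e) f" and h: "0 < h" "2 * h < e"
  obtains y where "dist y x < 2 * h"
    "f (x + h *\<^sub>R axis i 1 + h *\<^sub>R axis j 1) - f (x + h *\<^sub>R axis i 1) - f (x + h *\<^sub>R axis j 1) + f x
      = h * h * partial_deriv j (partial_deriv i f) y"
proof -
  have n: "norm (s *\<^sub>R axis i 1 + t *\<^sub>R axis j 1 :: real ^ 'n) \<le> s + t" if "0 \<le> s" "0 \<le> t" for s t
    using norm_triangle_ineq[of "s *\<^sub>R axis i 1 :: real ^ 'n" "t *\<^sub>R axis j 1"] that by simp
  have b: "x + s *\<^sub>R axis i 1 + t *\<^sub>R axis j 1 \<in> ball x e"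
    if "0 \<le> s" "0 \<le> t" "s \<le> h" "t \<le> h" for s t
  proof -
    have "dist x (x + s *\<^sub>R axis i 1 + t *\<^sub>R axis j 1) = norm (s *\<^sub>R axis i 1 + t *\<^sub>R axis j 1 :: real ^ 'n)"
      unfolding dist_commute[of x] by (simp add: dist_norm add.assoc)
    also have "\<dots> < e" using n[of s t] that h by linarith
    finally show ?thesis by simp
  qed
  define \<Phi> where "\<Phi> y = f (y + h *\<^sub>R axis j 1) + (-1) * f y" for y
  have sh: "((\<lambda>y. f (y + v)) has_derivative frechet_derivative f (at (y + v))) (at y)"
    if "y + v \<in> ball x e" for y v
    using has_derivative_compose[of "\<lambda>y. y + v" "\<lambda>d. d" y UNIV f]
      has_derivative_frechet[OF smooth_on_differentiable[OF f that]]
    by (auto intro!: derivative_eq_intros simp: has_derivative_add_const)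
  have shd: "(\<lambda>y. f (y + v)) differentiable (at y)" if "y + v \<in> ball x e" for y v
    using sh[OF that] by (auto simp: differentiable_def)
  have shp: "partial_deriv i (\<lambda>y. f (y + v)) y = partial_deriv i f (y + v)"
    if "y + v \<in> ball x e" for y v
    using partial_derivI[OF sh[OF that]] by (simp add: partial_deriv_def)
  have fd: "f differentiable (at (x + s *\<^sub>R axis i 1))" if "0 \<le> s" "s \<le> h" for s
    using smooth_on_differentiable[OF f b[of s 0]] that h by simp
  have \<Phi>d: "\<Phi> differentiable (at (x + s *\<^sub>R axis i 1))" if "0 \<le> s" "s \<le> h" for s
    unfolding \<Phi>_def using that h
    by (intro differentiable_add differentiable_mult differentiable_const shd fd b) auto
  obtain s where s: "0 < s" "s < h"
    "\<Phi> (x + h *\<^sub>R axis i 1) - \<Phi> x = h * partial_deriv i \<Phi> (x + s *\<^sub>R axis i 1)"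
    using mvt_partial_deriv[OF h(1) \<Phi>d] by blast
  have p: "partial_deriv i \<Phi> (x + s *\<^sub>R axis i 1) =
     partial_deriv i f (x + s *\<^sub>R axis i 1 + h *\<^sub>R axis j 1) - partial_deriv i f (x + s *\<^sub>R axis i 1)"
  proof -
    let ?z = "x + s *\<^sub>R axis i 1"
    have f1: "f differentiable (at ?z)" and z: "?z + h *\<^sub>R axis j 1 \<in> ball x e"
      using fd[of s] b[of s h] s h by auto
    have m: "(\<lambda>y. (-1) * f y) differentiable (at ?z)"
      using f1 by (intro differentiable_mult differentiable_const)
    have "partial_deriv i (\<lambda>y. (-1) * f y) ?z = - partial_deriv i f ?z"
      using partial_deriv_mult[OF differentiable_const[of "-1"] f1, of i] by simp
    then show ?thesis
      unfolding \<Phi>_def partial_deriv_add[OF shd[OF z] m] shp[OF z] by simp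
  qed
  have d2: "partial_deriv i f differentiable (at (x + s *\<^sub>R axis i 1 + t *\<^sub>R axis j 1))"
    if "0 \<le> t" "t \<le> h" for t
    using smooth_on_differentiable[OF smooth_on_partial_deriv[OF f] b[of s t]] that s h by simp
  obtain t where t: "0 < t" "t < h"
    "partial_deriv i f (x + s *\<^sub>R axis i 1 + h *\<^sub>R axis j 1) - partial_deriv i f (x + s *\<^sub>R axis i 1)
     = h * partial_deriv j (partial_deriv i f) (x + s *\<^sub>R axis i 1 + t *\<^sub>R axis j 1)"
    using mvt_partial_deriv[OF h(1) d2] by blast
  show thesis
  proof (rule that)
    show "dist (x + s *\<^sub>R axis i 1 + t *\<^sub>R axis j 1) x < 2 * h"
      using n[of s t] s t by (simp add: dist_norm add.assoc)
    show "f (x + h *\<^sub>R axis i 1 + h *\<^sub>R axis j 1) - f (x + h *\<^sub>R axis i 1) - f (x + h *\<^sub>R axis j 1) + f x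
      = h * h * partial_deriv j (partial_deriv i f) (x + s *\<^sub>R axis i 1 + t *\<^sub>R axis j 1)"
      using s(3) p t(3) by (simp add: \<Phi>_def algebra_simps)
  qed
qed

text \<open>The two mixed derivatives take equal values at points \<open>y m\<close> and
  \<open>z m\<close> that both tend to \<open>x\<close>; being continuous, they agree at
  \<open>x\<close>.\<close>

lemma partial_deriv_commute:
  fixes f :: "real ^ 'n \<Rightarrow> real"
  assumes S: "open S" and f: "smooth_on S f" and x: "x \<in> S"
  shows "partial_deriv i (partial_deriv j f) x = partial_deriv j (partial_deriv i f) x"
proof -
  obtain e where e: "e > 0" "ball x e \<subseteq> S" using S x open_contains_ball by blast
  have fb: "smooth_on (ball x e) f" by (rule smooth_on_subset[OF f e(2)])
  let ?P = "partial_deriv i (partial_deriv j f)" and ?Q = "partial_deriv j (partial_deriv i f)"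
  have "continuous (at x) ?P" "continuous (at x) ?Q"
    using fb[THEN smooth_on_partial_deriv, THEN smooth_on_partial_deriv,
        THEN smooth_on_continuous_on] e(1)
    by (simp_all add: continuous_on_eq_continuous_at)
  then have lim: "?P \<midarrow>x\<rightarrow> ?P x" "?Q \<midarrow>x\<rightarrow> ?Q x" by (auto simp: isCont_def)
  \<comment> \<open>The factor 3 makes \<open>2 * h m < e\<close> hold from \<open>m = 0\<close>
    on.\<close>
  define h where "h m = e / (3 * real (Suc m))" for m
  have h: "0 < h m" "2 * h m < e" for m
  proof -
    show "0 < h m" using e by (simp add: h_def)
    have "2 * e < e * (3 * real (Suc m))" using e(1) by (simp add: algebra_simps add_pos_nonneg)
    then show "2 * h m < e" by (simp add: h_def field_simps)
  qed
  have h0: "(\<lambda>m. 2 * h m) \<longlonglongrightarrow> 0"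
    using LIMSEQ_Suc[OF lim_const_over_n[of "2 * e / 3"]] by (simp add: h_def)
  have "\<exists>y z. dist y x < 2 * h m \<and> dist z x < 2 * h m \<and> ?P y = ?Q z" for m
  proof -
    obtain y where y: "dist y x < 2 * h m"
      "f (x + h m *\<^sub>R axis j 1 + h m *\<^sub>R axis i 1) - f (x + h m *\<^sub>R axis j 1) - f (x + h m *\<^sub>R axis i 1) + f x
      = h m * h m * ?P y"
      using mixed_difference_quotient[OF fb h] by blast
    obtain z where z: "dist z x < 2 * h m"
      "f (x + h m *\<^sub>R axis i 1 + h m *\<^sub>R axis j 1) - f (x + h m *\<^sub>R axis i 1) - f (x + h m *\<^sub>R axis j 1) + f x
      = h m * h m * ?Q z"
      using mixed_difference_quotient[OF fb h] by blast
    have c: "x + h m *\<^sub>R axis j 1 + h m *\<^sub>R axis i 1 = x + h m *\<^sub>R axis i 1 + h m *\<^sub>R axis j 1"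
      by simp
    have "h m * h m * ?P y = h m * h m * ?Q z"
      using y(2) z(2) unfolding c by linarith
    then show ?thesis using y(1) z(1) h(1)[of m] by auto
  qed
  then obtain y z where yz: "\<And>m. dist (y m) x < 2 * h m" "\<And>m. dist (z m) x < 2 * h m"
    "\<And>m. ?P (y m) = ?Q (z m)" by metis
  have "y \<longlonglongrightarrow> x" "z \<longlonglongrightarrow> x"
    by (rule metric_tendsto_imp_tendsto[OF h0], use yz h in \<open>simp add: less_imp_le\<close>)+
  then have "(\<lambda>m. ?P (y m)) \<longlonglongrightarrow> ?P x" "(\<lambda>m. ?Q (z m)) \<longlonglongrightarrow> ?Q x"
    using \<open>continuous (at x) ?P\<close> \<open>continuous (at x) ?Q\<close> by (auto intro: isCont_tendsto_compose)
  then show ?thesis unfolding yz(3) by (rule LIMSEQ_unique)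
qed

section \<open>Calculus in charts\<close>

text \<open>The set is kept apart from the domain of the chart because changes of charts are carried
  out on overlaps.\<close>

definition smooth_in :: "('m, 'n::finite) chart \<Rightarrow> 'm set \<Rightarrow> ('m \<Rightarrow> real) \<Rightarrow> bool" where
  "smooth_in c U f \<longleftrightarrow> smooth_on (snd c ` U) (in_coords c f)"

lemma smooth_in_chart_iff: "smooth_in_chart c f \<longleftrightarrow> smooth_in c (fst c) f"
  by (simp add: smooth_in_chart_def smooth_in_def)

locale chart_domain =
  fixes c :: "('m::topological_space, 'n::finite) chart" and U :: "'m set"
  assumes chart: "is_chart c" and open_U: "open U" and U_sub: "U \<subseteq> fst c"
begin

lemma inj_coords: "inj_on (snd c) (fst c)"
  using chart by (auto simp: is_chart_def homeomorphism_def intro: inj_on_inverseI)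

lemma inv_coords [simp]: "p \<in> U \<Longrightarrow> inv_into (fst c) (snd c) (snd c p) = p"
  using inj_coords U_sub by (auto simp: inv_into_f_f)

lemma in_coords_at [simp]: "p \<in> U \<Longrightarrow> in_coords c f (snd c p) = f p"
  by (simp add: in_coords_def)

lemma open_coords: "open (snd c ` U)"
proof -
  have "openin (top_of_set (fst c)) U"
    using open_U U_sub by (simp add: open_subset)
  then have "openin (top_of_set (snd c ` fst c)) (snd c ` U)"
    using chart homeomorphism_imp_open_map unfolding is_chart_def by blast
  then show ?thesis using chart by (meson is_chart_def openin_open_eq)
qed

lemma smooth_cong: "(\<And>q. q \<in> U \<Longrightarrow> f q = h q) \<Longrightarrow> smooth_in c U f \<longleftrightarrow> smooth_in c U h"
  unfolding smooth_in_def by (rule smooth_on_cong[OF open_coords]) auto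

lemma coord_deriv_cong:
  "p \<in> U \<Longrightarrow> (\<And>q. q \<in> U \<Longrightarrow> f q = h q) \<Longrightarrow> coord_deriv c k f p = coord_deriv c k h p"
  unfolding coord_deriv_def by (rule partial_deriv_cong[OF open_coords]) auto

lemma smooth_differentiable:
  "smooth_in c U f \<Longrightarrow> p \<in> U \<Longrightarrow> in_coords c f differentiable (at (snd c p))"
  unfolding smooth_in_def by (rule smooth_on_differentiable) auto

lemma smooth_continuous_on: "smooth_in c U f \<Longrightarrow> continuous_on U f"
proof -
  assume f: "smooth_in c U f"
  have "continuous_on U (snd c)"
    using chart U_sub by (auto simp: is_chart_def homeomorphism_def intro: continuous_on_subset)
  moreover have "continuous_on (snd c ` U) (in_coords c f)"
    using f by (simp add: smooth_in_def smooth_on_continuous_on)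
  ultimately have "continuous_on U (in_coords c f \<circ> snd c)" by (rule continuous_on_compose)
  then show "continuous_on U f" by (simp add: o_def cong: continuous_on_cong)
qed

lemma smooth_const [simp]: "smooth_in c U (\<lambda>q. a)"
  by (simp add: smooth_in_def in_coords_def o_def)

lemma smooth_add [simp]:
  "smooth_in c U f \<Longrightarrow> smooth_in c U h \<Longrightarrow> smooth_in c U (\<lambda>q. f q + h q)"
  using smooth_on_add[OF open_coords] by (simp add: smooth_in_def in_coords_def o_def)

lemma smooth_mult [simp]:
  "smooth_in c U f \<Longrightarrow> smooth_in c U h \<Longrightarrow> smooth_in c U (\<lambda>q. f q * h q)"
  using smooth_on_mult[OF open_coords] by (simp add: smooth_in_def in_coords_def o_def)

lemma smooth_minus [simp]: "smooth_in c U f \<Longrightarrow> smooth_in c U (\<lambda>q. - f q)"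
  using smooth_mult[of "\<lambda>q. -1" f] by simp

lemma smooth_diff [simp]:
  "smooth_in c U f \<Longrightarrow> smooth_in c U h \<Longrightarrow> smooth_in c U (\<lambda>q. f q - h q)"
  using smooth_add[of f "\<lambda>q. - h q"] by simp

lemma smooth_sum [simp]:
  "(\<And>a. a \<in> I \<Longrightarrow> smooth_in c U (\<lambda>q. F q a)) \<Longrightarrow> smooth_in c U (\<lambda>q. \<Sum>a\<in>I. F q a)"
  by (induction I rule: infinite_finite_induct) auto

lemma smooth_prod [simp]:
  "(\<And>a. a \<in> I \<Longrightarrow> smooth_in c U (\<lambda>q. F q a)) \<Longrightarrow> smooth_in c U (\<lambda>q. \<Prod>a\<in>I. F q a)"
  by (induction I rule: infinite_finite_induct) auto

lemma smooth_inverse: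
  "smooth_in c U f \<Longrightarrow> (\<And>q. q \<in> U \<Longrightarrow> f q \<noteq> 0) \<Longrightarrow> smooth_in c U (\<lambda>q. inverse (f q))"
  using smooth_on_inverse[OF open_coords, of "in_coords c f"]
  by (force simp: smooth_in_def in_coords_def o_def)

lemma smooth_divide:
  "smooth_in c U h \<Longrightarrow> smooth_in c U f \<Longrightarrow> (\<And>q. q \<in> U \<Longrightarrow> f q \<noteq> 0) \<Longrightarrow> smooth_in c U (\<lambda>q. h q / f q)"
  by (simp add: divide_inverse smooth_inverse)

lemma smooth_divide_const [simp]: "smooth_in c U h \<Longrightarrow> smooth_in c U (\<lambda>q. h q / a)"
  by (simp add: divide_inverse)

lemma smooth_sqrt:
  "smooth_in c U f \<Longrightarrow> (\<And>q. q \<in> U \<Longrightarrow> f q > 0) \<Longrightarrow> smooth_in c U (\<lambda>q. sqrt (f q))"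
  using smooth_on_sqrt[OF open_coords, of "in_coords c f"]
  by (force simp: smooth_in_def in_coords_def o_def)

lemma smooth_det:
  "(\<And>i j. smooth_in c U (\<lambda>q. M q i j)) \<Longrightarrow> smooth_in c U (\<lambda>q. det ((\<chi> i j. M q i j) :: real ^ 'k ^ 'k))"
  unfolding det_def by (auto intro!: smooth_sum smooth_mult smooth_prod)

lemma smooth_coord_deriv [simp]:
  assumes "smooth_in c U f"
  shows "smooth_in c U (coord_deriv c k f)"
proof -
  have "smooth_on (snd c ` U) (partial_deriv k (in_coords c f))"
    using assms by (simp add: smooth_in_def smooth_on_partial_deriv)
  then show ?thesis
    unfolding smooth_in_def
    by (subst smooth_on_cong[OF open_coords]) (auto simp: coord_deriv_def)
qed

lemma coord_deriv_const [simp]: "coord_deriv c k (\<lambda>q. a) p = 0"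
  by (simp add: coord_deriv_def in_coords_def o_def)

lemma coord_deriv_add:
  "smooth_in c U f \<Longrightarrow> smooth_in c U h \<Longrightarrow> p \<in> U \<Longrightarrow>
   coord_deriv c k (\<lambda>q. f q + h q) p = coord_deriv c k f p + coord_deriv c k h p"
  using partial_deriv_add[OF smooth_differentiable smooth_differentiable, of f p h k]
  by (simp add: coord_deriv_def in_coords_def o_def)

lemma coord_deriv_mult:
  "smooth_in c U f \<Longrightarrow> smooth_in c U h \<Longrightarrow> p \<in> U \<Longrightarrow>
   coord_deriv c k (\<lambda>q. f q * h q) p = f p * coord_deriv c k h p + coord_deriv c k f p * h p"
  using partial_deriv_mult[OF smooth_differentiable smooth_differentiable, of f p h k]
  by (simp add: coord_deriv_def in_coords_def o_def)

lemma coord_deriv_cmult: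
  "smooth_in c U f \<Longrightarrow> p \<in> U \<Longrightarrow> coord_deriv c k (\<lambda>q. a * f q) p = a * coord_deriv c k f p"
  by (simp add: coord_deriv_mult)

lemma coord_deriv_minus:
  "smooth_in c U f \<Longrightarrow> p \<in> U \<Longrightarrow> coord_deriv c k (\<lambda>q. - f q) p = - coord_deriv c k f p"
  using coord_deriv_cmult[of f p k "-1"] by simp

lemma coord_deriv_diff:
  "smooth_in c U f \<Longrightarrow> smooth_in c U h \<Longrightarrow> p \<in> U \<Longrightarrow>
   coord_deriv c k (\<lambda>q. f q - h q) p = coord_deriv c k f p - coord_deriv c k h p"
  using coord_deriv_add[of f "\<lambda>q. - h q" p k] by (simp add: coord_deriv_minus)

lemma coord_deriv_divide_const:
  "smooth_in c U f \<Longrightarrow> p \<in> U \<Longrightarrow> coord_deriv c k (\<lambda>q. f q / a) p = coord_deriv c k f p / a"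
  using coord_deriv_cmult[of f p k "inverse a"] by (simp add: divide_inverse mult.commute)

lemma coord_deriv_sum:
  "(\<And>a. a \<in> I \<Longrightarrow> smooth_in c U (\<lambda>q. F q a)) \<Longrightarrow> p \<in> U \<Longrightarrow>
   coord_deriv c k (\<lambda>q. \<Sum>a\<in>I. F q a) p = (\<Sum>a\<in>I. coord_deriv c k (\<lambda>q. F q a) p)"
  by (induction I rule: infinite_finite_induct) (auto simp: coord_deriv_add)

lemmas coord_deriv_rules =
  coord_deriv_add coord_deriv_mult coord_deriv_cmult coord_deriv_minus coord_deriv_diff
  coord_deriv_divide_const coord_deriv_sum

lemma coord_deriv_commute:
  assumes f: "smooth_in c U f" and p: "p \<in> U"
  shows "coord_deriv c i (coord_deriv c j f) p = coord_deriv c j (coord_deriv c i f) p"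
proof -
  have *: "coord_deriv c i (coord_deriv c j f) p
      = partial_deriv i (partial_deriv j (in_coords c f)) (snd c p)" for i j
    unfolding coord_deriv_def[of c i]
    using p by (intro partial_deriv_cong[OF open_coords]) (auto simp: coord_deriv_def)
  show ?thesis
    unfolding * using f p open_coords by (intro partial_deriv_commute) (auto simp: smooth_in_def)
qed

end

section \<open>Coordinate changes between two charts\<close>

locale chart_overlap =
  old: chart_domain c U + new: chart_domain c' U
  for c c' :: "('m::topological_space, 'n::finite) chart" and U +
  assumes smooth_transition: "smooth_in c' U (\<lambda>q. snd c q $ a)"
begin

text \<open>Reading \<open>f\<close> in \<open>c'\<close> amounts to reading it in \<open>c\<close>
  after the transition map \<open>\<tau>\<close>, at least on the open image of \<open>U\<close>.
  The chain rule for \<open>\<tau>\<close>, whose derivative is assembled from its components,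
  yields both facts at once.\<close>

lemma
  assumes f: "smooth_in c U f" and p: "p \<in> U"
  shows coord_deriv_chain:
      "coord_deriv c' k f p = (\<Sum>a\<in>UNIV. jacobian c c' p a k * coord_deriv c a f p)"
    and differentiable_in_coords: "in_coords c' f differentiable (at (snd c' p))"
proof -
  define \<tau> where "\<tau> = snd c \<circ> inv_into (fst c') (snd c')"
  define L where "L v = (\<chi> a. \<Sum>b\<in>UNIV. v $ b * jacobian c c' p a b)" for v :: "real ^ 'n"
  have \<tau>p: "\<tau> (snd c' p) = snd c p" using p by (simp add: \<tau>_def)
  have comp: "((\<lambda>y. \<tau> y $ a) has_derivative (\<lambda>v. L v $ a)) (at (snd c' p))" for a
    using has_partial_derivs[OF new.smooth_differentiable[OF smooth_transition p], of a]
    by (simp add: L_def jacobian_def coord_deriv_def in_coords_def o_def \<tau>_def)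
  have "(\<tau> has_derivative L) (at (snd c' p))"
    using comp has_derivative_componentwise_within[of \<tau> L "snd c' p" UNIV]
    by (auto simp: Basis_vec_def inner_axis)
  moreover have "(in_coords c f has_derivative
      (\<lambda>v. \<Sum>a\<in>UNIV. v $ a * coord_deriv c a f p)) (at (\<tau> (snd c' p)))"
    using has_partial_derivs[OF old.smooth_differentiable[OF f p]] by (simp add: \<tau>p coord_deriv_def)
  ultimately have d: "(in_coords c f \<circ> \<tau> has_derivative
      (\<lambda>v. \<Sum>a\<in>UNIV. v $ a * coord_deriv c a f p) \<circ> L) (at (snd c' p))"
    by (rule diff_chain_at)
  have eq: "in_coords c f (\<tau> y) = in_coords c' f y" if "y \<in> snd c' ` U" for y
    using that by (auto simp: \<tau>_def)
  have "(in_coords c' f has_derivative (\<lambda>v. \<Sum>a\<in>UNIV. v $ a * coord_deriv c a f p) \<circ> L) (at (snd c' p))"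
    by (rule has_derivative_transform_within_open[OF d new.open_coords]) (use p eq in auto)
  then show "in_coords c' f differentiable (at (snd c' p))" by (auto simp: differentiable_def)
  have "coord_deriv c' k f p = partial_deriv k (in_coords c f \<circ> \<tau>) (snd c' p)"
    unfolding coord_deriv_def using p eq
    by (intro partial_deriv_cong[OF new.open_coords]) auto
  also have "\<dots> = (\<Sum>a\<in>UNIV. L (axis k 1) $ a * coord_deriv c a f p)"
    using partial_derivI[OF d] by simp
  also have "\<dots> = (\<Sum>a\<in>UNIV. jacobian c c' p a k * coord_deriv c a f p)"
    by (simp add: L_def axis_def if_distrib if_distribR cong: if_cong)
  finally show "coord_deriv c' k f p = (\<Sum>a\<in>UNIV. jacobian c c' p a k * coord_deriv c a f p)" .
qed

lemma smooth_jacobian [simp]: "smooth_in c' U (\<lambda>q. jacobian c c' q a k)"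
  unfolding jacobian_def using smooth_transition by simp

lemma jacobian_deriv_commute:
  "p \<in> U \<Longrightarrow> coord_deriv c' i (\<lambda>q. jacobian c c' q a j) p = coord_deriv c' j (\<lambda>q. jacobian c c' q a i) p"
  using new.coord_deriv_commute[OF smooth_transition, of p i j a]
  by (simp add: jacobian_def)

end

lemma coord_deriv_coordinate:
  assumes "is_chart c" "p \<in> fst c"
  shows "coord_deriv c k (\<lambda>q. snd c q $ a) p = kdelta a k"
proof -
  interpret chart_domain c "fst c" using assms by unfold_locales (auto simp: is_chart_def)
  have "coord_deriv c k (\<lambda>q. snd c q $ a) p = partial_deriv k (\<lambda>y. y $ a) (snd c p)"
    unfolding coord_deriv_def using assms
    by (intro partial_deriv_cong[OF open_coords]) auto
  also have "\<dots> = axis k 1 $ a"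
    by (rule partial_derivI) (rule bounded_linear.has_derivative[OF bounded_linear_vec_nth has_derivative_ident])
  finally show ?thesis by (auto simp: axis_def kdelta_def)
qed

lemma smooth_atlas_overlap:
  assumes "smooth_atlas \<A>" "c \<in> \<A>" "c' \<in> \<A>"
  shows "chart_overlap c c' (fst c \<inter> fst c')"
  using assms by unfold_locales (auto simp: smooth_atlas_def is_chart_def smooth_in_def inf_commute)

text \<open>This is the chain rule for the coordinate functions of \<open>c'\<close>, whose
  derivatives in \<open>c'\<close> itself are Kronecker deltas.\<close>

lemma jacobian_inverse:
  assumes "smooth_atlas \<A>" "c \<in> \<A>" "c' \<in> \<A>" "p \<in> fst c \<inter> fst c'"
  shows "(\<Sum>b\<in>UNIV. jacobian c' c p k b * jacobian c c' p b l) = kdelta k l"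
proof -
  interpret chart_overlap c c' "fst c \<inter> fst c'" using assms(1-3) by (rule smooth_atlas_overlap)
  have "smooth_in c (fst c \<inter> fst c') (\<lambda>q. snd c' q $ k)"
    using assms by (auto simp: smooth_atlas_def smooth_in_def inf_commute)
  from coord_deriv_chain[OF this assms(4), of l]
  show ?thesis using coord_deriv_coordinate[of c' p l k] assms
    by (simp add: smooth_atlas_def jacobian_def[of c' c] mult.commute)
qed

section \<open>The metric in a chart\<close>

lemma kdelta_sum [simp]:
  fixes f :: "'n::finite \<Rightarrow> real"
  shows "(\<Sum>a\<in>UNIV. kdelta i a * f a) = f i" "(\<Sum>a\<in>UNIV. kdelta a i * f a) = f i"
    "(\<Sum>a\<in>UNIV. f a * kdelta i a) = f i" "(\<Sum>a\<in>UNIV. f a * kdelta a i) = f i"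
  by (simp_all add: kdelta_def if_distrib if_distribR cong: if_cong)

lemma kdelta_commute: "kdelta i j = kdelta j i"
  by (simp add: kdelta_def)

lemma sum_swap_3:
  "(\<Sum>i\<in>A. \<Sum>j\<in>B. \<Sum>k\<in>C. f i j k) = (\<Sum>k\<in>C. \<Sum>i\<in>A. \<Sum>j\<in>B. f i j k)"
  by (simp add: sum.swap[of _ C])

lemma sum_swap_4:
  "(\<Sum>i\<in>A. \<Sum>j\<in>B. \<Sum>k\<in>C. \<Sum>l\<in>D. f i j k l) = (\<Sum>k\<in>C. \<Sum>l\<in>D. \<Sum>i\<in>A. \<Sum>j\<in>B. f i j k l)"
proof -
  have "(\<Sum>i\<in>A. \<Sum>j\<in>B. \<Sum>k\<in>C. \<Sum>l\<in>D. f i j k l) = (\<Sum>k\<in>C. \<Sum>i\<in>A. \<Sum>j\<in>B. \<Sum>l\<in>D. f i j k l)"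
    by (rule sum_swap_3)
  also have "\<dots> = (\<Sum>k\<in>C. \<Sum>l\<in>D. \<Sum>i\<in>A. \<Sum>j\<in>B. f i j k l)"
    by (intro sum.cong refl sum_swap_3)
  finally show ?thesis .
qed

lemma matrix_mult_inverse:
  fixes M :: "real ^ 'n ^ 'n"
  assumes "invertible M"
  shows "M ** matrix_inv M = mat 1" "matrix_inv M ** M = mat 1"
  using someI_ex[OF assms[unfolded invertible_def]] by (auto simp: matrix_inv_def)

text \<open>Column \<open>j\<close> of the inverse solves M x = e_j. In Cramer's form the entries
  are polynomials in the entries of \<open>M\<close> divided by the determinant, which is what makes
  the inverse metric smooth.\<close>

lemma matrix_inv_cramer:
  fixes M :: "real ^ 'n ^ 'n"
  assumes "invertible M"
  shows "matrix_inv M $ k $ j = det (\<chi> a b. if b = k then kdelta a j else M $ a $ b) * inverse (det M)"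
proof -
  have "M *v column j (matrix_inv M) = axis j 1"
    using matrix_mult_inverse(1)[OF assms]
    by (metis matrix_vector_mul_assoc matrix_vector_mul_lid matrix_vector_mult_basis)
  then have "column j (matrix_inv M) =
      (\<chi> k. det (\<chi> a b. if b = k then axis j 1 $ a else M $ a $ b) / det M)"
    using assms by (subst (asm) cramer) (auto simp: invertible_det_nz)
  then have "matrix_inv M $ k $ j = det (\<chi> a b. if b = k then axis j 1 $ a else M $ a $ b) / det M"
    by (simp add: column_def vec_eq_iff)
  moreover have "axis j 1 $ a = (kdelta a j :: real)" for a by (simp add: axis_def kdelta_def)
  ultimately show ?thesis by (simp add: divide_inverse cong: if_cong)
qed

locale metric_chart = chart_domain c U
  for c :: "('m::topological_space, 'n::finite) chart" and U +
  fixes g :: "('m, 'n) tensor2"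
  assumes smooth_g [simp]: "smooth_in c U (\<lambda>q. g c q i j)"
    and g_sym: "q \<in> U \<Longrightarrow> g c q i j = g c q j i"
    and g_pos: "q \<in> U \<Longrightarrow> v \<noteq> 0 \<Longrightarrow> (\<Sum>i\<in>UNIV. \<Sum>j\<in>UNIV. g c q i j * v $ i * v $ j) > 0"
begin

abbreviation "gi \<equiv> metric_inv g c"
abbreviation "\<Gamma> \<equiv> christoffel g c"

lemma invertible_metric:
  assumes "p \<in> U"
  shows "invertible (\<chi> a b. g c p a b)"
proof -
  have "v = 0" if "(\<chi> a b. g c p a b) *v v = 0" for v
  proof (rule ccontr)
    assume "v \<noteq> 0"
    have "(\<Sum>j\<in>UNIV. g c p i j * v $ j) = 0" for i
      using arg_cong[OF that, of "\<lambda>w. w $ i"] by (simp add: matrix_vector_mult_def)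
    then have "(\<Sum>i\<in>UNIV. v $ i * (\<Sum>j\<in>UNIV. g c p i j * v $ j)) = 0" by simp
    then have "(\<Sum>i\<in>UNIV. \<Sum>j\<in>UNIV. g c p i j * v $ i * v $ j) = 0"
      by (simp add: sum_distrib_left mult_ac)
    with g_pos[OF assms \<open>v \<noteq> 0\<close>] show False by simp
  qed
  then show ?thesis
    using matrix_left_invertible_ker invertible_left_inverse by blast
qed

lemma metric_inverse_left: "p \<in> U \<Longrightarrow> (\<Sum>a\<in>UNIV. gi p i a * g c p a j) = kdelta i j"
  using arg_cong[OF matrix_mult_inverse(2)[OF invertible_metric], of p "\<lambda>M. M $ i $ j"]
  by (simp add: matrix_matrix_mult_def metric_inv_def mat_def kdelta_def)

lemma metric_inverse_right: "p \<in> U \<Longrightarrow> (\<Sum>a\<in>UNIV. g c p i a * gi p a j) = kdelta i j"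
  using arg_cong[OF matrix_mult_inverse(1)[OF invertible_metric], of p "\<lambda>M. M $ i $ j"]
  by (simp add: matrix_matrix_mult_def metric_inv_def mat_def kdelta_def)

text \<open>The nested form of the sums is deliberate: once a contraction has been arranged in this
  way, the metric and its inverse cancel by rewriting.\<close>

lemma lower_raise: "p \<in> U \<Longrightarrow> (\<Sum>a\<in>UNIV. g c p i a * (\<Sum>b\<in>UNIV. gi p a b * x b)) = x i"
proof -
  assume p: "p \<in> U"
  have "(\<Sum>a\<in>UNIV. g c p i a * (\<Sum>b\<in>UNIV. gi p a b * x b))
      = (\<Sum>b\<in>UNIV. (\<Sum>a\<in>UNIV. g c p i a * gi p a b) * x b)"
    by (simp add: sum_distrib_left sum_distrib_right mult.assoc) (rule sum.swap)
  then show ?thesis using metric_inverse_right[OF p] by simp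
qed

lemma raise_lower: "p \<in> U \<Longrightarrow> (\<Sum>a\<in>UNIV. gi p i a * (\<Sum>b\<in>UNIV. g c p a b * x b)) = x i"
proof -
  assume p: "p \<in> U"
  have "(\<Sum>a\<in>UNIV. gi p i a * (\<Sum>b\<in>UNIV. g c p a b * x b))
      = (\<Sum>b\<in>UNIV. (\<Sum>a\<in>UNIV. gi p i a * g c p a b) * x b)"
    by (simp add: sum_distrib_left sum_distrib_right mult.assoc) (rule sum.swap)
  then show ?thesis using metric_inverse_left[OF p] by simp
qed

lemma gi_sym:
  assumes p: "p \<in> U"
  shows "gi p i j = gi p j i"
proof -
  have "(\<Sum>b\<in>UNIV. g c p a b * gi p j b) = kdelta j a" for a
    using metric_inverse_left[OF p, of j a] g_sym[OF p, of a] by (simp add: mult.commute)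
  then show ?thesis using raise_lower[OF p, of i "gi p j"] by simp
qed

lemma smooth_gi [simp]: "smooth_in c U (\<lambda>q. gi q i j)"
proof -
  have "smooth_in c U (\<lambda>q. det ((\<chi> a b. if b = i then kdelta a j else g c q a b) :: real ^ 'n ^ 'n)
      * inverse (det (\<chi> a b. g c q a b)))"
  proof (intro smooth_mult smooth_inverse smooth_det)
    show "smooth_in c U (\<lambda>q. if b = i then kdelta a j else g c q a b)" for a b
      by (cases "b = i") auto
    show "det (\<chi> a b. g c q a b) \<noteq> 0" if "q \<in> U" for q
      using invertible_metric[OF that] invertible_det_nz by blast
  qed auto
  then show ?thesis
    by (subst smooth_cong) (auto simp: metric_inv_def matrix_inv_cramer[OF invertible_metric] cong: if_cong)
qed

lemma smooth_christoffel [simp]: "smooth_in c U (\<lambda>q. \<Gamma> q m j k)"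
  unfolding christoffel_def by simp

lemma christoffel_sym: "p \<in> U \<Longrightarrow> \<Gamma> p m j k = \<Gamma> p m k j"
proof -
  assume p: "p \<in> U"
  have "coord_deriv c h (\<lambda>q. g c q j k) p = coord_deriv c h (\<lambda>q. g c q k j) p" for h j k
    using p g_sym by (intro coord_deriv_cong)
  then show ?thesis unfolding christoffel_def
    by (metis (no_types, lifting) add.commute)
qed

lemma lower_christoffel:
  assumes "p \<in> U"
  shows "(\<Sum>m\<in>UNIV. g c p h m * \<Gamma> p m j k) =
    (coord_deriv c j (\<lambda>q. g c q h k) p + coord_deriv c k (\<lambda>q. g c q h j) p
      - coord_deriv c h (\<lambda>q. g c q j k) p) / 2"
proof -
  have "(\<Sum>m\<in>UNIV. g c p h m * \<Gamma> p m j k) =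
    1/2 * (\<Sum>m\<in>UNIV. g c p h m * (\<Sum>b\<in>UNIV. gi p m b * 
    (coord_deriv c j (\<lambda>q. g c q b k) p + coord_deriv c k (\<lambda>q. g c q b j) p
      - coord_deriv c b (\<lambda>q. g c q j k) p)))"
    unfolding christoffel_def by (subst sum_distrib_left) (simp add: mult_ac)
  then show ?thesis unfolding lower_raise[OF assms] by simp
qed

lemma deriv_metric:
  assumes "p \<in> U"
  shows "coord_deriv c k (\<lambda>q. g c q i j) p =
    (\<Sum>a\<in>UNIV. g c p j a * \<Gamma> p a k i) + (\<Sum>a\<in>UNIV. g c p i a * \<Gamma> p a k j)"
proof -
  have s: "coord_deriv c h (\<lambda>q. g c q j k) p = coord_deriv c h (\<lambda>q. g c q k j) p" for h j k
    using assms g_sym by (intro coord_deriv_cong)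
  show ?thesis
    unfolding lower_christoffel[OF assms] using s[of k j i] s[of j k i] s[of i k j] by (simp add: field_simps)
qed

text \<open>Obtained by differentiating the relation between the metric and its inverse and solving
  for the derivative of the inverse.\<close>

lemma deriv_gi:
  assumes p: "p \<in> U"
  shows "coord_deriv c k (\<lambda>q. gi q i j) p =
    - (\<Sum>a\<in>UNIV. \<Sum>b\<in>UNIV. gi p i a * gi p j b * coord_deriv c k (\<lambda>q. g c q a b) p)"
proof -
  let ?d = "coord_deriv c k"
  have "?d (\<lambda>q. \<Sum>b\<in>UNIV. gi q i b * g c q b l) p = 0" for l
    using coord_deriv_cong[OF p metric_inverse_left] by simp
  then have "(\<Sum>b\<in>UNIV. ?d (\<lambda>q. gi q i b) p * g c p b l) = - (\<Sum>a\<in>UNIV. gi p i a * ?d (\<lambda>q. g c q a l) p)" for l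
    using p by (simp add: coord_deriv_rules sum.distrib add_eq_0_iff)
  then have "(\<Sum>b\<in>UNIV. g c p l b * ?d (\<lambda>q. gi q i b) p) = - (\<Sum>a\<in>UNIV. gi p i a * ?d (\<lambda>q. g c q a l) p)" for l
    by (simp add: g_sym[OF p, of l] mult.commute)
  then have "?d (\<lambda>q. gi q i j) p = (\<Sum>b\<in>UNIV. gi p j b * - (\<Sum>a\<in>UNIV. gi p i a * ?d (\<lambda>q. g c q a b) p))"
    using raise_lower[OF p, of j "\<lambda>b. ?d (\<lambda>q. gi q i b) p"] by simp
  also have "\<dots> = - (\<Sum>b\<in>UNIV. \<Sum>a\<in>UNIV. gi p i a * gi p j b * ?d (\<lambda>q. g c q a b) p)"
    by (simp add: sum_distrib_left sum_negf mult_ac)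
  finally show ?thesis by (subst sum.swap)
qed

lemma deriv_gi':
  assumes p: "p \<in> U"
  shows "coord_deriv c k (\<lambda>q. gi q i j) p =
    - (\<Sum>a\<in>UNIV. \<Gamma> p i k a * gi p a j) - (\<Sum>a\<in>UNIV. \<Gamma> p j k a * gi p i a)"
proof -
  have 1: "(\<Sum>a\<in>UNIV. \<Sum>b\<in>UNIV. gi p i a * gi p j b * (\<Sum>e\<in>UNIV. g c p b e * \<Gamma> p e k a))
      = (\<Sum>a\<in>UNIV. gi p i a * (\<Sum>b\<in>UNIV. gi p j b * (\<Sum>e\<in>UNIV. g c p b e * \<Gamma> p e k a)))"
    by (simp only: sum_distrib_left mult.assoc)
  have 2: "(\<Sum>a\<in>UNIV. \<Sum>b\<in>UNIV. gi p i a * gi p j b * (\<Sum>e\<in>UNIV. g c p a e * \<Gamma> p e k b))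
      = (\<Sum>b\<in>UNIV. gi p j b * (\<Sum>a\<in>UNIV. gi p i a * (\<Sum>e\<in>UNIV. g c p a e * \<Gamma> p e k b)))"
    by (subst sum.swap) (simp only: sum_distrib_left mult_ac)
  show ?thesis
    unfolding deriv_gi[OF p] deriv_metric[OF p]
      distrib_left sum.distrib 1 2 raise_lower[OF p] gi_sym[OF p, of _ j]
    by (simp only: mult.commute minus_add_distrib diff_conv_add_uminus add.commute)
qed

text \<open>Both sides are the derivative of ln sqrt(det g). By \<open>deriv_metric\<close> the
  double sum on the right splits into two copies of the left side.\<close>

lemma trace_christoffel:
  assumes p: "p \<in> U"
  shows "(\<Sum>m\<in>UNIV. \<Gamma> p m m l) =
    (\<Sum>i\<in>UNIV. \<Sum>j\<in>UNIV. gi p i j * coord_deriv c l (\<lambda>q. g c q i j) p) / 2"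
proof -
  have "(\<Sum>i\<in>UNIV. \<Sum>j\<in>UNIV. gi p i j * coord_deriv c l (\<lambda>q. g c q i j) p) =
     (\<Sum>i\<in>UNIV. \<Sum>j\<in>UNIV. gi p i j * (\<Sum>a\<in>UNIV. g c p j a * \<Gamma> p a l i)) +
     (\<Sum>j\<in>UNIV. \<Sum>i\<in>UNIV. gi p j i * (\<Sum>a\<in>UNIV. g c p i a * \<Gamma> p a l j))"
    unfolding deriv_metric[OF p] distrib_left sum.distrib
    apply (rule arg_cong2[where f = "(+)"])
    subgoal by (rule refl)
    subgoal by (subst sum.swap) (simp only: gi_sym[OF p])
    done
  also have "\<dots> = 2 * (\<Sum>m\<in>UNIV. \<Gamma> p m m l)"
    unfolding raise_lower[OF p] christoffel_sym[OF p, of _ l] by simp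
  finally show ?thesis by linarith
qed

end

section \<open>Bianchi identities and the divergence of the conformal tensor\<close>

lemma sum_swap_13:
  "(\<Sum>i\<in>A. \<Sum>j\<in>B. \<Sum>k\<in>C. f i j k) = (\<Sum>k\<in>C. \<Sum>j\<in>B. \<Sum>i\<in>A. f i j k)"
  by (subst sum_swap_3) (intro sum.cong refl sum.swap)

lemma kdelta_sum_2 [simp]:
  fixes f :: "'n::finite \<Rightarrow> 'b \<Rightarrow> real"
  shows "(\<Sum>m\<in>UNIV. \<Sum>a\<in>B. kdelta j m * f m a) = (\<Sum>a\<in>B. f j a)"
  by (simp flip: sum_distrib_left)

context metric_chart begin

text \<open>The contracted Christoffel symbols form the gradient of ln sqrt(det g), so their
  derivative is a Hessian. Here it shows as second derivatives of the metric, which commute, minus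
  the quadratic term \<open>S\<close>, which is symmetric because the two metric derivatives in it
  can be exchanged together with their index pairs.\<close>

lemma trace_christoffel_deriv_sym:
  assumes p: "p \<in> U"
  shows "coord_deriv c k (\<lambda>q. \<Sum>m\<in>UNIV. \<Gamma> q m m l) p = coord_deriv c l (\<lambda>q. \<Sum>m\<in>UNIV. \<Gamma> q m m k) p"
proof -
  define D where "D k i j = coord_deriv c k (\<lambda>q. g c q i j) p" for k i j
  define S where "S k l = (\<Sum>i\<in>UNIV. \<Sum>j\<in>UNIV. \<Sum>a\<in>UNIV. \<Sum>b\<in>UNIV. gi p i a * gi p j b * D k a b * D l i j)" for k l
  have S: "S k l = S l k" for k l
    unfolding S_def by (subst sum_swap_4) (simp only: gi_sym[OF p] mult_ac)
  have *: "coord_deriv c k (\<lambda>q. \<Sum>m\<in>UNIV. \<Gamma> q m m l) p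
      = ((\<Sum>i\<in>UNIV. \<Sum>j\<in>UNIV. gi p i j * coord_deriv c k (coord_deriv c l (\<lambda>q. g c q i j)) p) - S k l) / 2" for k l
  proof -
    have "coord_deriv c k (\<lambda>q. \<Sum>m\<in>UNIV. \<Gamma> q m m l) p
      = coord_deriv c k (\<lambda>q. (\<Sum>i\<in>UNIV. \<Sum>j\<in>UNIV. gi q i j * coord_deriv c l (\<lambda>q. g c q i j) q) / 2) p"
      by (rule coord_deriv_cong[OF p]) (rule trace_christoffel)
    also have "\<dots> = ((\<Sum>i\<in>UNIV. \<Sum>j\<in>UNIV. gi p i j * coord_deriv c k (coord_deriv c l (\<lambda>q. g c q i j)) p) +
        (\<Sum>i\<in>UNIV. \<Sum>j\<in>UNIV. coord_deriv c k (\<lambda>q. gi q i j) p * D l i j)) / 2"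
      using p by (simp add: coord_deriv_rules sum.distrib D_def)
    also have "(\<Sum>i\<in>UNIV. \<Sum>j\<in>UNIV. coord_deriv c k (\<lambda>q. gi q i j) p * D l i j) = - S k l"
      unfolding deriv_gi[OF p] D_def[symmetric] S_def by (simp add: sum_distrib_right sum_negf)
    finally show ?thesis by simp
  qed
  show ?thesis unfolding * S[of k l] coord_deriv_commute[OF smooth_g p, of k l] by (rule refl)
qed

lemma smooth_riemann [simp]: "smooth_in c U (\<lambda>q. riemann g c q j k l m)"
  unfolding riemann_def by simp

lemma smooth_ricci [simp]: "smooth_in c U (\<lambda>q. ricci g c q k l)"
  unfolding ricci_def by simp

lemma smooth_ricci_mixed [simp]: "smooth_in c U (\<lambda>q. ricci_mixed g c q j m)"
  unfolding ricci_mixed_def by simp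

lemma smooth_trace [simp]: "(\<And>k l. smooth_in c U (\<lambda>q. S c q k l)) \<Longrightarrow> smooth_in c U (\<lambda>q. trace_g g S c q)"
  unfolding trace_g_def by simp

lemma smooth_scalar_curvature [simp]: "smooth_in c U (\<lambda>q. scalar_curvature g c q)"
  unfolding scalar_curvature_def by simp

lemma riemann_antisym: "riemann g c p j k l m = - riemann g c p k j l m"
  by (simp add: riemann_def)

text \<open>In the expanded Ricci tensor all terms but one are symmetric after renaming summation
  indices; the remaining one, the derivative of the contracted Christoffel symbols, is settled by
  \<open>trace_christoffel_deriv_sym\<close>.\<close>

lemma ricci_sym:
  assumes p: "p \<in> U"
  shows "ricci g c p k l = ricci g c p l k"
proof -
  have *: "ricci g c p k l = (\<Sum>m\<in>UNIV. coord_deriv c m (\<lambda>q. \<Gamma> q m k l) p)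
    - coord_deriv c k (\<lambda>q. \<Sum>m\<in>UNIV. \<Gamma> q m m l) p
    - (\<Sum>m\<in>UNIV. \<Sum>a\<in>UNIV. \<Gamma> p a m l * \<Gamma> p m k a)
    + (\<Sum>m\<in>UNIV. \<Sum>a\<in>UNIV. \<Gamma> p a k l * \<Gamma> p m m a)" for k l
    using p by (simp add: ricci_def riemann_def sum.distrib sum_subtractf coord_deriv_rules)
  have d: "coord_deriv c m (\<lambda>q. \<Gamma> q m k l) p = coord_deriv c m (\<lambda>q. \<Gamma> q m l k) p" for m
    using p christoffel_sym by (intro coord_deriv_cong)
  have q: "(\<Sum>m\<in>UNIV. \<Sum>a\<in>UNIV. \<Gamma> p a m l * \<Gamma> p m k a) = (\<Sum>m\<in>UNIV. \<Sum>a\<in>UNIV. \<Gamma> p a m k * \<Gamma> p m l a)"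
    by (subst sum.swap) (simp only: christoffel_sym[OF p] mult.commute)
  show ?thesis
    unfolding * d trace_christoffel_deriv_sym[OF p, of k l] q christoffel_sym[OF p, of _ k l] by (rule refl)
qed

text \<open>A direct expansion in an arbitrary chart, grouped by the shape of the terms: second
  derivatives \<open>dd\<close>, Christoffel symbols times their derivatives \<open>X\<close> and
  \<open>Y\<close>, cubic terms \<open>P\<close>, and the corrections \<open>T\<close> for the two
  antisymmetric indices. In the cyclic sum \<open>X\<close>, \<open>Y\<close> and \<open>P\<close>
  cancel identically, \<open>dd\<close> because derivatives commute, and \<open>T\<close> because
  the connection is torsion free.\<close>

lemma second_bianchi:
  assumes p: "p \<in> U"
  shows "nabla_13 g (riemann g) c p i j k l m + nabla_13 g (riemann g) c p j k i l m
    + nabla_13 g (riemann g) c p k i j l m = 0"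
proof -
  define d where "d i m j k = coord_deriv c i (\<lambda>q. \<Gamma> q m j k) p" for i m j k
  define dd where "dd i h m j k = coord_deriv c i (coord_deriv c h (\<lambda>q. \<Gamma> q m j k)) p" for i h m j k
  define X where "X i k j = (\<Sum>a\<in>UNIV. \<Gamma> p a i l * d k m j a)" for i k j
  define Y where "Y i k j = (\<Sum>a\<in>UNIV. \<Gamma> p m i a * d k a j l)" for i k j
  define P where "P x y z = (\<Sum>a\<in>UNIV. \<Sum>b\<in>UNIV. \<Gamma> p m x b * \<Gamma> p b y a * \<Gamma> p a z l)" for x y z
  define T where "T i j k = (\<Sum>a\<in>UNIV. \<Gamma> p a i j * riemann g c p a k l m)" for i j k
  have R: "riemann g c p j k l m = d k m j l - d j m k l + (\<Sum>b\<in>UNIV. \<Gamma> p b j l * \<Gamma> p m k b)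
     - (\<Sum>b\<in>UNIV. \<Gamma> p b k l * \<Gamma> p m j b)" for j k l m
    by (simp add: riemann_def d_def)
  have dR: "coord_deriv c i (\<lambda>q. riemann g c q j k l m) p = dd i k m j l - dd i j m k l
     + (Y k i j + X j i k) - (Y j i k + X k i j)" for i j k
    using p by (simp add: riemann_def coord_deriv_rules dd_def X_def Y_def d_def sum.distrib mult.commute)
  have Q1: "(\<Sum>a\<in>UNIV. \<Gamma> p a i l * riemann g c p j k a m) = X i k j - X i j k + P k j i - P j k i" for i j k
    unfolding R X_def P_def
    by (simp add: sum.distrib sum_subtractf sum_distrib_left ring_distribs mult_ac)
  have Q2: "(\<Sum>a\<in>UNIV. \<Gamma> p m i a * riemann g c p j k l a) = Y i k j - Y i j k + P i k j - P i j k" for i j k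
    unfolding R Y_def P_def sum.swap[of "\<lambda>a b. \<Gamma> p m x b * \<Gamma> p b y a * \<Gamma> p a z l" UNIV UNIV for x y z]
    by (simp add: sum.distrib sum_subtractf sum_distrib_left ring_distribs mult_ac)
  have T2: "(\<Sum>a\<in>UNIV. \<Gamma> p a i k * riemann g c p j a l m) = - T i k j" for i j k
    unfolding T_def by (subst riemann_antisym) (simp add: sum_negf)
  have Ts: "T i j k = T j i k" for i j k
    unfolding T_def christoffel_sym[OF p, of _ i j] by (rule refl)
  have N: "nabla_13 g (riemann g) c p i j k l m =
    dd i k m j l - dd i j m k l + (Y k i j + X j i k) - (Y j i k + X k i j) - T i j k + T i k j
    - (X i k j - X i j k + P k j i - P j k i) + (Y i k j - Y i j k + P i k j - P i j k)" for i j k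
    unfolding nabla_13_def dR Q1 Q2 T2 T_def[symmetric] by simp
  have dds: "dd i h m j k = dd h i m j k" for i h m j k
    unfolding dd_def using p by (intro coord_deriv_commute) auto
  show ?thesis
    unfolding N using dds[of i k m j l] dds[of i j m k l] dds[of j k m i l]
      Ts[of i j k] Ts[of i k j] Ts[of j k i] by simp
qed

text \<open>Contraction commutes with the covariant derivative: the Christoffel terms of the two
  contracted indices cancel.\<close>

lemma nabla_riemann_trace:
  assumes p: "p \<in> U"
  shows "(\<Sum>m\<in>UNIV. nabla_13 g (riemann g) c p i m k l m) = - nabla_02 g (ricci g) c p i k l"
proof -
  have s: "(\<Sum>m\<in>UNIV. \<Sum>a\<in>UNIV. \<Gamma> p m i a * riemann g c p m k l a)
     = (\<Sum>m\<in>UNIV. \<Sum>a\<in>UNIV. \<Gamma> p a i m * riemann g c p a k l m)"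
    by (rule sum.swap)
  have t: "(\<Sum>m\<in>UNIV. \<Sum>a\<in>UNIV. \<Gamma> p a i k * F m a) = (\<Sum>a\<in>UNIV. \<Gamma> p a i k * (\<Sum>m\<in>UNIV. F m a))" for F k
    by (subst sum.swap) (simp add: sum_distrib_left)
  show ?thesis using p
    by (simp add: nabla_13_def nabla_02_def ricci_def sum.distrib sum_subtractf s t coord_deriv_rules sum_negf)
qed

lemma div_riemann:
  assumes p: "p \<in> U"
  shows "(\<Sum>m\<in>UNIV. nabla_13 g (riemann g) c p m j k l m) =
    nabla_02 g (ricci g) c p k j l - nabla_02 g (ricci g) c p j k l"
proof -
  have a: "nabla_13 g (riemann g) c p j k m l m' = - nabla_13 g (riemann g) c p j m k l m'" for j k m m'
  proof -
    have "coord_deriv c j (\<lambda>q. riemann g c q k m l m') p = - coord_deriv c j (\<lambda>q. riemann g c q m k l m') p"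
      using p by (subst riemann_antisym) (simp add: coord_deriv_rules)
    then show ?thesis
      unfolding nabla_13_def
      by (simp add: riemann_antisym[of p k m] riemann_antisym[of p _ m] riemann_antisym[of p k] sum_negf)
  qed
  have "(\<Sum>m\<in>UNIV. nabla_13 g (riemann g) c p m j k l m + nabla_13 g (riemann g) c p j k m l m
     + nabla_13 g (riemann g) c p k m j l m) = 0"
    using second_bianchi[OF p] by simp
  then show ?thesis
    using nabla_riemann_trace[OF p] by (simp add: sum.distrib sum_subtractf a[of j k])
qed


section \<open>Divergence of the conformal curvature tensor\<close>

lemma metric_parallel: "p \<in> U \<Longrightarrow> nabla_02 g g c p k i j = 0"
  unfolding nabla_02_def
  by (simp add: deriv_metric g_sym[of p _ j] mult.commute)

text \<open>The derivative of the inverse metric supplies exactly the Christoffel terms that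
  complete the derivative of \<open>S\<close> to a covariant one.\<close>

lemma deriv_trace:
  assumes p: "p \<in> U" and S: "\<And>k l. smooth_in c U (\<lambda>q. S c q k l)"
  shows "coord_deriv c k (\<lambda>q. trace_g g S c q) p =
    (\<Sum>i\<in>UNIV. \<Sum>j\<in>UNIV. gi p i j * nabla_02 g S c p k i j)"
proof -
  have 1: "(\<Sum>i\<in>UNIV. \<Sum>j\<in>UNIV. (\<Sum>a\<in>UNIV. \<Gamma> p i k a * gi p a j) * S c p i j)
     = (\<Sum>i\<in>UNIV. \<Sum>j\<in>UNIV. gi p i j * (\<Sum>a\<in>UNIV. \<Gamma> p a k i * S c p a j))"
    unfolding sum_distrib_left sum_distrib_right by (subst sum_swap_13) (simp only: mult_ac)
  have 2: "(\<Sum>i\<in>UNIV. \<Sum>j\<in>UNIV. (\<Sum>a\<in>UNIV. \<Gamma> p j k a * gi p i a) * S c p i j)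
     = (\<Sum>i\<in>UNIV. \<Sum>j\<in>UNIV. gi p i j * (\<Sum>a\<in>UNIV. \<Gamma> p a k j * S c p i a))"
    by (rule sum.cong[OF refl]) (simp add: sum_distrib_left sum_distrib_right mult_ac, rule sum.swap)
  have "coord_deriv c k (\<lambda>q. trace_g g S c q) p =
    (\<Sum>i\<in>UNIV. \<Sum>j\<in>UNIV. gi p i j * coord_deriv c k (\<lambda>q. S c q i j) p)
    - (\<Sum>i\<in>UNIV. \<Sum>j\<in>UNIV. (\<Sum>a\<in>UNIV. \<Gamma> p i k a * gi p a j) * S c p i j)
    - (\<Sum>i\<in>UNIV. \<Sum>j\<in>UNIV. (\<Sum>a\<in>UNIV. \<Gamma> p j k a * gi p i a) * S c p i j)"
    unfolding trace_g_def using p S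
    by (simp add: coord_deriv_rules deriv_gi' sum.distrib sum_subtractf left_diff_distrib sum_negf)
  then show ?thesis
    unfolding 1 2 nabla_02_def by (simp add: right_diff_distrib sum_subtractf)
qed

text \<open>In index notation this is \<nabla>_m N_j^m, the divergence of a mixed tensor.\<close>

definition div_mixed :: "('m, 'n) tensor2 \<Rightarrow> 'm \<Rightarrow> 'n \<Rightarrow> real" where
  "div_mixed N p j = (\<Sum>m\<in>UNIV. coord_deriv c m (\<lambda>q. N c q j m) p)
     - (\<Sum>m\<in>UNIV. \<Sum>a\<in>UNIV. \<Gamma> p a m j * N c p a m)
     + (\<Sum>m\<in>UNIV. \<Sum>a\<in>UNIV. \<Gamma> p m m a * N c p j a)"

text \<open>The part of the conformal tensor beyond the Riemann tensor is an expression of this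
  shape, antisymmetrized in \<open>j\<close> and \<open>k\<close>. Since the Kronecker delta and the
  metric are parallel, the divergence acts only on \<open>S\<close> and \<open>N\<close>.\<close>

lemma div_kulkarni_part:
  assumes p: "p \<in> U" and S: "\<And>k l. smooth_in c U (\<lambda>q. S c q k l)"
    and N: "\<And>k l. smooth_in c U (\<lambda>q. N c q k l)"
  shows "(\<Sum>m\<in>UNIV. nabla_13 g (\<lambda>c q j k l m. kdelta j m * S c q k l + N c q j m * g c q k l) c p m j k l m)
    = nabla_02 g S c p j k l + div_mixed N p j * g c p k l"
proof -
  have dg: "coord_deriv c m (\<lambda>q. g c q k l) p =
      (\<Sum>a\<in>UNIV. \<Gamma> p a m k * g c p a l) + (\<Sum>a\<in>UNIV. \<Gamma> p a m l * g c p k a)" for m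
    using metric_parallel[OF p, of m k l] by (simp add: nabla_02_def)
  show ?thesis
    using p S N
    by (simp add: nabla_13_def coord_deriv_rules nabla_02_def div_mixed_def dg
        sum.distrib sum_subtractf ring_distribs sum_distrib_left sum_distrib_right mult_ac)
qed


lemma div_mixed_raise:
  assumes p: "p \<in> U" and S: "\<And>k l. smooth_in c U (\<lambda>q. S c q k l)"
  shows "div_mixed (\<lambda>c q j m. \<Sum>a\<in>UNIV. S c q j a * metric_inv g c q a m) p j =
    (\<Sum>m\<in>UNIV. \<Sum>a\<in>UNIV. gi p a m * nabla_02 g S c p m j a)"
proof -
  have 1: "(\<Sum>m\<in>UNIV. \<Sum>a\<in>UNIV. S c p j a * (\<Sum>b\<in>UNIV. \<Gamma> p a m b * gi p b m))
    = (\<Sum>m\<in>UNIV. \<Sum>a\<in>UNIV. gi p a m * (\<Sum>b\<in>UNIV. \<Gamma> p b m a * S c p j b))"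
    unfolding sum_distrib_left
    by (rule sum.cong[OF refl], subst sum.swap) (simp only: mult_ac)
  have 2: "(\<Sum>m\<in>UNIV. \<Sum>a\<in>UNIV. S c p j a * (\<Sum>b\<in>UNIV. \<Gamma> p m m b * gi p a b))
    = (\<Sum>m\<in>UNIV. \<Sum>a\<in>UNIV. \<Gamma> p m m a * (\<Sum>b\<in>UNIV. S c p j b * gi p b a))"
    unfolding sum_distrib_left
    by (rule sum.cong[OF refl], subst sum.swap) (simp only: mult_ac)
  have 3: "(\<Sum>m\<in>UNIV. \<Sum>a\<in>UNIV. \<Gamma> p a m j * (\<Sum>b\<in>UNIV. S c p a b * gi p b m))
    = (\<Sum>m\<in>UNIV. \<Sum>a\<in>UNIV. gi p a m * (\<Sum>b\<in>UNIV. \<Gamma> p b m j * S c p b a))"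
    unfolding sum_distrib_left
    by (rule sum.cong[OF refl], subst sum.swap) (simp only: mult_ac)
  have "div_mixed (\<lambda>c q j m. \<Sum>a\<in>UNIV. S c q j a * metric_inv g c q a m) p j =
    (\<Sum>m\<in>UNIV. \<Sum>a\<in>UNIV. gi p a m * coord_deriv c m (\<lambda>q. S c q j a) p)
    - (\<Sum>m\<in>UNIV. \<Sum>a\<in>UNIV. S c p j a * (\<Sum>b\<in>UNIV. \<Gamma> p a m b * gi p b m))
    - (\<Sum>m\<in>UNIV. \<Sum>a\<in>UNIV. S c p j a * (\<Sum>b\<in>UNIV. \<Gamma> p m m b * gi p a b))
    - (\<Sum>m\<in>UNIV. \<Sum>a\<in>UNIV. \<Gamma> p a m j * (\<Sum>b\<in>UNIV. S c p a b * gi p b m))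
    + (\<Sum>m\<in>UNIV. \<Sum>a\<in>UNIV. \<Gamma> p m m a * (\<Sum>b\<in>UNIV. S c p j b * gi p b a))"
    unfolding div_mixed_def using p S
    by (simp add: coord_deriv_rules deriv_gi' sum.distrib sum_subtractf right_diff_distrib sum_negf mult.commute)
  then show ?thesis
    unfolding 1 2 3 nabla_02_def by (simp add: right_diff_distrib sum_subtractf)
qed

lemma div_mixed_cmult:
  assumes p: "p \<in> U" and N: "\<And>k l. smooth_in c U (\<lambda>q. N c q k l)"
  shows "div_mixed (\<lambda>c q j m. a * N c q j m) p j = a * div_mixed N p j"
  using assms by (simp add: div_mixed_def coord_deriv_rules sum_distrib_left ring_distribs mult_ac)

lemma nabla_13_antisymmetrized:
  assumes p: "p \<in> U" and R: "\<And>j k l m. smooth_in c U (\<lambda>q. R c q j k l m)"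
    and P: "\<And>j k l m. smooth_in c U (\<lambda>q. P c q j k l m)"
  shows "nabla_13 g (\<lambda>c q j k l m. R c q j k l m + (P c q j k l m - P c q k j l m)) c p i j k l m
    = nabla_13 g R c p i j k l m + (nabla_13 g P c p i j k l m - nabla_13 g P c p i k j l m)"
  using assms
  by (simp add: nabla_13_def coord_deriv_rules sum.distrib sum_subtractf ring_distribs)

lemma nabla_02_trace_adjusted:
  assumes p: "p \<in> U" and S: "\<And>k l. smooth_in c U (\<lambda>q. S c q k l)" and s: "smooth_in c U s"
  shows "nabla_02 g (\<lambda>c q k l. a * S c q k l + s q * g c q k l) c p i k l =
    a * nabla_02 g S c p i k l + coord_deriv c i s p * g c p k l"
proof -
  have "s p * nabla_02 g g c p i k l = 0" using metric_parallel[OF p] by simp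
  then show ?thesis
    using assms
    by (simp add: nabla_02_def coord_deriv_rules sum.distrib ring_distribs sum_distrib_left mult_ac)
qed

lemma contract_with_metric:
  assumes p: "p \<in> U"
  shows "(\<Sum>j\<in>UNIV. \<Sum>l\<in>UNIV. gi p j l * (x j * g c p k l)) = x k"
    "(\<Sum>j\<in>UNIV. \<Sum>l\<in>UNIV. gi p j l * (t * g c p j l)) = real CARD('n) * t"
proof -
  have "(\<Sum>j\<in>UNIV. \<Sum>l\<in>UNIV. gi p j l * (x j * g c p k l)) = (\<Sum>j\<in>UNIV. x j * (\<Sum>l\<in>UNIV. gi p j l * g c p l k))"
    by (simp add: sum_distrib_left mult_ac g_sym[OF p, of k])
  then show "(\<Sum>j\<in>UNIV. \<Sum>l\<in>UNIV. gi p j l * (x j * g c p k l)) = x k"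
    by (simp add: metric_inverse_left[OF p])
  have "(\<Sum>j\<in>UNIV. \<Sum>l\<in>UNIV. gi p j l * (t * g c p j l)) = (\<Sum>j\<in>UNIV. t * (\<Sum>l\<in>UNIV. gi p j l * g c p l j))"
    unfolding sum_distrib_left by (intro sum.cong refl) (simp add: g_sym[OF p, of _ j for j])
  then show "(\<Sum>j\<in>UNIV. \<Sum>l\<in>UNIV. gi p j l * (t * g c p j l)) = real CARD('n) * t"
    by (simp add: metric_inverse_left[OF p] kdelta_def)
qed

lemma div_conformal_curvature:
  assumes p: "p \<in> U"
  defines "n \<equiv> real CARD('n)"
  defines "r j \<equiv> coord_deriv c j (\<lambda>q. scalar_curvature g c q) p / ((n - 1) * (n - 2))"
    and "e j \<equiv> (\<Sum>m\<in>UNIV. \<Sum>a\<in>UNIV. gi p a m * nabla_02 g (ricci g) c p m j a) / (n - 2)"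
    and "W \<equiv> nabla_02 g (ricci g) c p"
  shows "(\<Sum>m\<in>UNIV. nabla_13 g (conformal_curvature g) c p m j k l m) =
    W k j l - W j k l + (W j k l - W k j l) / (n - 2)
    + e j * g c p k l - e k * g c p j l - r j * g c p k l + r k * g c p j l"
proof -
  \<comment> \<open>The scalar curvature term of the conformal tensor is put entirely into
    \<open>S\<close>, so that \<open>N\<close> stays a constant multiple of the mixed Ricci
    tensor.\<close>
  define s where "s q = - (scalar_curvature g c q / ((n - 1) * (n - 2)))" for q
  define S :: "('m, 'n) tensor2" where
    "S = (\<lambda>c' q k l. 1 / (n - 2) * ricci g c' q k l + s q * g c' q k l)"
  define N :: "('m, 'n) tensor2" where
    "N = (\<lambda>c q j m. 1 / (n - 2) * ricci_mixed g c q j m)"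
  define P :: "('m, 'n) tensor4" where
    "P = (\<lambda>c q j k l m. kdelta j m * S c q k l + N c q j m * g c q k l)"
  have sS [simp]: "smooth_in c U (\<lambda>q. S c q k l)" for k l
    unfolding S_def s_def by simp
  have sN [simp]: "smooth_in c U (\<lambda>q. N c q k l)" for k l
    unfolding N_def by simp
  have sP: "smooth_in c U (\<lambda>q. P c q j k l m)" for j k l m
    unfolding P_def by simp
  have C: "conformal_curvature g c q j k l m =
      riemann g c q j k l m + (P c q j k l m - P c q k j l m)" for q j k l m
    by (simp add: conformal_curvature_def P_def S_def N_def s_def n_def algebra_simps add_divide_distrib diff_divide_distrib)
  have "nabla_13 g (conformal_curvature g) c p i j k l m =
      nabla_13 g (\<lambda>c q j k l m. riemann g c q j k l m + (P c q j k l m - P c q k j l m)) c p i j k l m" for i j k l m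
    unfolding nabla_13_def C by (rule refl)
  then have D: "nabla_13 g (conformal_curvature g) c p i j k l m = nabla_13 g (riemann g) c p i j k l m +
     (nabla_13 g P c p i j k l m - nabla_13 g P c p i k j l m)" for i j k l m
    using nabla_13_antisymmetrized[of p "riemann g" P, OF p smooth_riemann sP] by simp
  have dP: "(\<Sum>m\<in>UNIV. nabla_13 g P c p m j k l m) = W j k l / (n - 2) - r j * g c p k l + e j * g c p k l" for j k
  proof -
    have "div_mixed N p j = e j" 
      unfolding N_def using div_mixed_cmult[of p "ricci_mixed g" "1 / (n - 2)" j, OF p smooth_ricci_mixed]
        div_mixed_raise[of p "ricci g" j, OF p smooth_ricci]
      by (simp add: e_def ricci_mixed_def [abs_def])
    moreover have "nabla_02 g S c p j k l = W j k l / (n - 2) - r j * g c p k l"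
      unfolding S_def using p
      by (subst nabla_02_trace_adjusted) (auto simp: s_def [abs_def] W_def r_def coord_deriv_rules)
    ultimately show ?thesis
      using div_kulkarni_part[of p S N, OF p sS sN, of j k l] unfolding P_def by simp
  qed
  show ?thesis
    unfolding D by (simp add: sum.distrib sum_subtractf dP div_riemann[OF p] W_def diff_divide_distrib)
qed

lemma codazzi_if_conformally_harmonic:
  assumes p: "p \<in> U" and n3: "CARD('n) > 3"
    and harm: "\<And>j k l. (\<Sum>m\<in>UNIV. nabla_13 g (conformal_curvature g) c p m j k l m) = 0"
  shows "nabla_02 g (ricci g) c p k j l - nabla_02 g (ricci g) c p j k l =
    (coord_deriv c k (\<lambda>q. scalar_curvature g c q) p * g c p j l
      - coord_deriv c j (\<lambda>q. scalar_curvature g c q) p * g c p k l) / (2 * (real CARD('n) - 1))"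
proof -
  define n where "n = real CARD('n)"
  define r where "r j = coord_deriv c j (\<lambda>q. scalar_curvature g c q) p" for j
  define e where "e j = (\<Sum>m\<in>UNIV. \<Sum>a\<in>UNIV. gi p a m * nabla_02 g (ricci g) c p m j a)" for j
  define W where "W = nabla_02 g (ricci g) c p"
  have n: "n > 3" using n3 by (simp add: n_def)
  have eq: "(n - 1) * (n - 3) * (W k j l - W j k l) + (n - 1) * (e j * g c p k l - e k * g c p j l)
    - (r j * g c p k l - r k * g c p j l) = 0" (is "?L j k l = 0") for j k l
  proof -
    \<comment> \<open>Naming the reciprocals lets the denominators be cleared by ring identities
      alone.\<close>
    define u v where "u = 1 / (n - 2)" and "v = 1 / (n - 1)"
    have uv: "(n - 2) * u = 1" "(n - 1) * v = 1" using n by (simp_all add: u_def v_def)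
    have "W k j l - W j k l + (W j k l - W k j l) * u
        + e j * u * g c p k l - e k * u * g c p j l
        - r j * (v * u) * g c p k l + r k * (v * u) * g c p j l = 0"
      using harm[of j k l] div_conformal_curvature[OF p, of j k l]
      unfolding n_def[symmetric] by (simp add: r_def e_def W_def u_def v_def)
    then have "0 = (n - 1) * (n - 2) * (W k j l - W j k l + (W j k l - W k j l) * u
        + e j * u * g c p k l - e k * u * g c p j l
        - r j * (v * u) * g c p k l + r k * (v * u) * g c p j l)"
      by simp
    also have "\<dots> = (n - 1) * ((n - 2) * (W k j l - W j k l)
          + ((n - 2) * u) * (W j k l - W k j l + e j * g c p k l - e k * g c p j l))
          - ((n - 1) * v) * ((n - 2) * u) * (r j * g c p k l - r k * g c p j l)"
      by (simp add: algebra_simps)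
    also have "\<dots> = ?L j k l" unfolding uv by (simp add: algebra_simps)
    finally show ?thesis by simp
  qed
  have t1: "(\<Sum>j\<in>UNIV. \<Sum>l\<in>UNIV. gi p j l * W k j l) = r k" for k
    unfolding r_def scalar_curvature_def W_def by (subst deriv_trace[OF p]) auto
  have t2: "(\<Sum>j\<in>UNIV. \<Sum>l\<in>UNIV. gi p j l * W j k l) = e k" for k
    unfolding e_def W_def by (intro sum.cong refl arg_cong2[where f = "(*)"] gi_sym p)
  \<comment> \<open>Tracing yields $\nabla_k R = 2 \nabla_m R_k{}^m$, so that the symmetries of the fully covariant
    Riemann tensor are not needed.\<close>
  have re: "r k = 2 * e k" for k
  proof -
    have "0 = (\<Sum>j\<in>UNIV. \<Sum>l\<in>UNIV. gi p j l * ?L j k l)" unfolding eq by simp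
    also have "\<dots> = (n - 1) * (n - 3) * (r k - e k) + (n - 1) * (e k - n * e k) - (r k - n * r k)"
    proof -
      have "(\<Sum>j\<in>UNIV. \<Sum>l\<in>UNIV. gi p j l * ?L j k l) =
        (n - 1) * (n - 3) * ((\<Sum>j\<in>UNIV. \<Sum>l\<in>UNIV. gi p j l * W k j l) - (\<Sum>j\<in>UNIV. \<Sum>l\<in>UNIV. gi p j l * W j k l))
        + (n - 1) * ((\<Sum>j\<in>UNIV. \<Sum>l\<in>UNIV. gi p j l * (e j * g c p k l)) - (\<Sum>j\<in>UNIV. \<Sum>l\<in>UNIV. gi p j l * (e k * g c p j l)))
        - ((\<Sum>j\<in>UNIV. \<Sum>l\<in>UNIV. gi p j l * (r j * g c p k l)) - (\<Sum>j\<in>UNIV. \<Sum>l\<in>UNIV. gi p j l * (r k * g c p j l)))"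
        unfolding sum_subtractf[symmetric] sum_distrib_left sum.distrib[symmetric]
        by (intro sum.cong refl) (simp add: algebra_simps)
      then show ?thesis unfolding t1 t2 contract_with_metric[OF p] n_def[symmetric] .
    qed
    also have "\<dots> = (n - 1) * (n - 2) * (r k - 2 * e k)" by (simp add: algebra_simps)
    finally show ?thesis using n by simp
  qed
  \<comment> \<open>With dR replaced by twice the divergence of the Ricci tensor the whole equation
    is divisible by n - 3; cancelling this factor is where the dimension has to exceed
    three.\<close>
  have "(n - 3) * (2 * (n - 1) * (W k j l - W j k l) - (r k * g c p j l - r j * g c p k l)) = 2 * ?L j k l"
    unfolding re by (simp add: algebra_simps)
  also have "\<dots> = 0" unfolding eq by simp
  finally have "2 * (n - 1) * (W k j l - W j k l) - (r k * g c p j l - r j * g c p k l) = 0"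
    using n by (simp only: mult_eq_0_iff) simp
  then have "W k j l - W j k l = (r k * g c p j l - r j * g c p k l) / (2 * (n - 1))"
    using n by (simp only: eq_iff_diff_eq_0[symmetric] eq_divide_eq) (simp add: mult.commute)
  then show ?thesis unfolding W_def r_def n_def .
qed

end

section \<open>Change of charts\<close>

lemma Ck_on_sum:
  assumes "open S" "\<And>a. a \<in> I \<Longrightarrow> Ck_on r S (\<lambda>x. F a x)"
  shows "Ck_on r S (\<lambda>x. \<Sum>a\<in>I. F a x)"
  using assms(2) by (induction I rule: infinite_finite_induct) (auto intro: Ck_on_add[OF assms(1)])

context chart_overlap begin

abbreviation "J \<equiv> jacobian c c'"

text \<open>The induction on the order treats all \<open>f\<close> at once: by the chain rule a
  derivative in \<open>c'\<close> is a sum of Jacobian entries, smooth in \<open>c'\<close>, times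
  derivatives in \<open>c\<close>, and these are again smooth in \<open>c\<close>, so the induction
  hypothesis applies to them.\<close>

lemma smooth_transfer:
  assumes "smooth_in c U f"
  shows "smooth_in c' U f"
proof -
  have "Ck_on r (snd c' ` U) (in_coords c' f)" if "smooth_in c U f" for r f
    using that
  proof (induction r arbitrary: f)
    case 0
    have "continuous_on (snd c' ` fst c') (inv_into (fst c') (snd c'))"
      using new.chart by (simp add: is_chart_def homeomorphism_def)
    then have "continuous_on (snd c' ` U) (inv_into (fst c') (snd c'))"
      by (rule continuous_on_subset) (rule image_mono[OF new.U_sub])
    moreover have "inv_into (fst c') (snd c') ` snd c' ` U = U"
      by (simp add: image_image cong: image_cong_simp)
    ultimately have "continuous_on (snd c' ` U) (in_coords c' f)"
      unfolding in_coords_def using old.smooth_continuous_on[OF 0]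
      by (intro continuous_on_compose) simp_all
    then show ?case by simp
  next
    case (Suc r)
    have "in_coords c' f differentiable (at (snd c' p))" if "p \<in> U" for p
      using differentiable_in_coords[OF Suc.prems that] .
    moreover have "Ck_on r (snd c' ` U) (partial_deriv k (in_coords c' f))" for k
    proof -
      have eq: "partial_deriv k (in_coords c' f) y =
          (\<Sum>a\<in>UNIV. in_coords c' (\<lambda>p. J p a k) y * in_coords c' (coord_deriv c a f) y)"
        if "y \<in> snd c' ` U" for y
      proof -
        obtain q where q: "q \<in> U" "y = snd c' q" using \<open>y \<in> snd c' ` U\<close> by blast
        show ?thesis
          using coord_deriv_chain[OF Suc.prems q(1), of k] q(1)
          unfolding q(2) coord_deriv_def[of c'] by simp
      qed
      have "Ck_on r (snd c' ` U) (\<lambda>y. \<Sum>a\<in>UNIV. in_coords c' (\<lambda>p. J p a k) y * in_coords c' (coord_deriv c a f) y)"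
      proof (intro Ck_on_sum Ck_on_mult new.open_coords)
        show "Ck_on r (snd c' ` U) (in_coords c' (\<lambda>p. J p a k))" for a
          using smooth_jacobian[of a k] unfolding smooth_in_def smooth_on_def by blast
        show "Ck_on r (snd c' ` U) (in_coords c' (coord_deriv c a f))" for a
          by (rule Suc.IH[OF old.smooth_coord_deriv[OF Suc.prems]])
      qed
      then show ?thesis by (subst Ck_on_cong[OF new.open_coords eq])
    qed
    ultimately show ?case by simp
  qed
  from this[OF assms] show ?thesis unfolding smooth_in_def[of c'] smooth_on_def by blast
qed

end

text \<open>A trilinear form evaluated at three vectors. The permuted metric derivatives in a
  Christoffel symbol are compared by permuting its arguments.\<close>

definition sum3 :: "('a \<Rightarrow> real) \<Rightarrow> ('a \<Rightarrow> real) \<Rightarrow> ('a \<Rightarrow> real) \<Rightarrow> ('a \<Rightarrow> 'a \<Rightarrow> 'a \<Rightarrow> real) \<Rightarrow> real" where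
  "sum3 x y z F = (\<Sum>a\<in>UNIV. \<Sum>b\<in>UNIV. \<Sum>d\<in>UNIV. x a * y b * z d * F a b d)"

lemma sum3_swap: "sum3 y x z F = sum3 x y z (\<lambda>a b d. F b a d)"
  unfolding sum3_def by (subst sum.swap) (simp only: mult_ac)

lemma sum3_rotate: "sum3 z x y F = sum3 x y z (\<lambda>a b d. F d a b)"
  unfolding sum3_def by (subst sum_swap_3[symmetric]) (simp only: mult_ac)

section \<open>Transformation laws of the connection and the curvature\<close>

locale metric_overlap = chart_overlap c c' U + old: metric_chart c U g + new: metric_chart c' U g
  for c c' :: "('m::topological_space, 'n::finite) chart" and U and g :: "('m, 'n) tensor2" +
  assumes metric_law: "p \<in> U \<Longrightarrow>
      g c' p k l = (\<Sum>a\<in>UNIV. \<Sum>b\<in>UNIV. jacobian c c' p a k * jacobian c c' p b l * g c p a b)"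
    and jacobian_inv: "p \<in> U \<Longrightarrow> (\<Sum>b\<in>UNIV. jacobian c' c p k b * jacobian c c' p b l) = kdelta k l"
    and jacobian_inv': "p \<in> U \<Longrightarrow> (\<Sum>b\<in>UNIV. jacobian c c' p k b * jacobian c' c p b l) = kdelta k l"
begin

abbreviation "K \<equiv> jacobian c' c"
abbreviation "d' \<equiv> coord_deriv c'"

lemma jacobian_transpose_inv:
  assumes p: "p \<in> U"
  shows "(\<Sum>h\<in>UNIV. K p h a * (\<Sum>e\<in>UNIV. J p e h * z e)) = z a"
proof -
  have "(\<Sum>h\<in>UNIV. K p h a * (\<Sum>e\<in>UNIV. J p e h * z e))
      = (\<Sum>e\<in>UNIV. (\<Sum>h\<in>UNIV. J p e h * K p h a) * z e)"
    unfolding sum_distrib_left sum_distrib_right by (subst sum.swap) (simp only: mult_ac)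
  then show ?thesis by (simp add: jacobian_inv'[OF p])
qed

lemma jacobian_cancel:
  assumes p: "p \<in> U" and eq: "\<And>h. (\<Sum>a\<in>UNIV. J p a h * x a) = (\<Sum>a\<in>UNIV. J p a h * y a)"
  shows "x a = y a"
  by (subst jacobian_transpose_inv[OF p, of a x, symmetric], subst eq)
    (rule jacobian_transpose_inv[OF p])

lemma jacobian_inv_apply:
  assumes p: "p \<in> U"
  shows "(\<Sum>m\<in>UNIV. J p e m * (\<Sum>a\<in>UNIV. K p m a * z a)) = z e"
proof -
  have "(\<Sum>m\<in>UNIV. J p e m * (\<Sum>a\<in>UNIV. K p m a * z a))
      = (\<Sum>a\<in>UNIV. (\<Sum>m\<in>UNIV. J p e m * K p m a) * z a)"
    unfolding sum_distrib_left sum_distrib_right by (subst sum.swap) (simp only: mult_ac)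
  then show ?thesis by (simp add: jacobian_inv'[OF p])
qed

lemma jacobian_apply_inv:
  assumes p: "p \<in> U"
  shows "(\<Sum>a\<in>UNIV. K p m a * (\<Sum>e\<in>UNIV. J p a e * z e)) = z m"
proof -
  have "(\<Sum>a\<in>UNIV. K p m a * (\<Sum>e\<in>UNIV. J p a e * z e))
      = (\<Sum>e\<in>UNIV. (\<Sum>a\<in>UNIV. K p m a * J p a e) * z e)"
    unfolding sum_distrib_left sum_distrib_right by (subst sum.swap) (simp only: mult_ac)
  then show ?thesis by (simp add: jacobian_inv[OF p])
qed

lemma deriv_metric_law:
  assumes p: "p \<in> U"
  shows "d' i (\<lambda>q. g c' q k l) p =
      (\<Sum>b\<in>UNIV. J p b l * (\<Sum>a\<in>UNIV. g c p b a * d' i (\<lambda>q. J q a k) p))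
    + (\<Sum>b\<in>UNIV. J p b k * (\<Sum>a\<in>UNIV. g c p b a * d' i (\<lambda>q. J q a l) p))
    + sum3 (\<lambda>a. J p a i) (\<lambda>a. J p a k) (\<lambda>a. J p a l) (\<lambda>d a b. coord_deriv c d (\<lambda>q. g c q a b) p)"
proof -
  have gs: "smooth_in c' U (\<lambda>q. g c q a b)" for a b
    by (rule smooth_transfer) simp
  have gd: "d' i (\<lambda>q. g c q a b) p = (\<Sum>d\<in>UNIV. J p d i * coord_deriv c d (\<lambda>q. g c q a b) p)" for a b
    using p by (intro coord_deriv_chain) auto
  have "d' i (\<lambda>q. g c' q k l) p = d' i (\<lambda>q. \<Sum>a\<in>UNIV. \<Sum>b\<in>UNIV. J q a k * J q b l * g c q a b) p"
    using p metric_law by (intro new.coord_deriv_cong)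
  also have "\<dots> = (\<Sum>a\<in>UNIV. \<Sum>b\<in>UNIV. J p a k * J p b l * (\<Sum>d\<in>UNIV. J p d i * coord_deriv c d (\<lambda>q. g c q a b) p))
     + (\<Sum>a\<in>UNIV. \<Sum>b\<in>UNIV. d' i (\<lambda>q. J q a k) p * J p b l * g c p a b)
     + (\<Sum>a\<in>UNIV. \<Sum>b\<in>UNIV. J p a k * d' i (\<lambda>q. J q b l) p * g c p a b)"
    using p gs by (simp add: new.coord_deriv_rules gd sum.distrib ring_distribs)
  also have "(\<Sum>a\<in>UNIV. \<Sum>b\<in>UNIV. J p a k * J p b l * (\<Sum>d\<in>UNIV. J p d i * coord_deriv c d (\<lambda>q. g c q a b) p))
     = sum3 (\<lambda>a. J p a i) (\<lambda>a. J p a k) (\<lambda>a. J p a l) (\<lambda>d a b. coord_deriv c d (\<lambda>q. g c q a b) p)"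
    unfolding sum3_def sum_distrib_left by (subst sum_swap_3) (simp only: mult_ac)
  also have "(\<Sum>a\<in>UNIV. \<Sum>b\<in>UNIV. J p a k * d' i (\<lambda>q. J q b l) p * g c p a b)
     = (\<Sum>b\<in>UNIV. J p b k * (\<Sum>a\<in>UNIV. g c p b a * d' i (\<lambda>q. J q a l) p))"
    unfolding sum_distrib_left by (simp only: mult_ac)
  also have "(\<Sum>a\<in>UNIV. \<Sum>b\<in>UNIV. d' i (\<lambda>q. J q a k) p * J p b l * g c p a b)
     = (\<Sum>b\<in>UNIV. J p b l * (\<Sum>a\<in>UNIV. g c p b a * d' i (\<lambda>q. J q a k) p))"
    unfolding sum_distrib_left by (subst sum.swap) (simp only: mult_ac old.g_sym[OF p])
  finally show ?thesis by simp
qed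

text \<open>The two sides are compared after lowering the free index and transporting with the
  Jacobian, where Christoffel symbols become combinations of metric derivatives. Second derivatives
  of the coordinates enter through \<open>A\<close>, symmetric in its first two arguments: of its
  six occurrences four cancel in pairs and two add up to the inhomogeneous term.\<close>

lemma christoffel_law:
  assumes p: "p \<in> U"
  shows "(\<Sum>m\<in>UNIV. J p a m * new.\<Gamma> p m j k) =
    d' j (\<lambda>q. J q a k) p + (\<Sum>b\<in>UNIV. \<Sum>d\<in>UNIV. J p b j * J p d k * old.\<Gamma> p a b d)"
proof -
  define V where "V a = d' j (\<lambda>q. J q a k) p + (\<Sum>b\<in>UNIV. \<Sum>d\<in>UNIV. J p b j * J p d k * old.\<Gamma> p a b d)" for a
  define X where "X a = (\<Sum>m\<in>UNIV. J p a m * new.\<Gamma> p m j k)" for a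
  define A where "A i k h = (\<Sum>b\<in>UNIV. J p b h * (\<Sum>a\<in>UNIV. g c p b a * d' i (\<lambda>q. J q a k) p))" for i k h
  define D where "D a b d = coord_deriv c a (\<lambda>q. g c q b d) p" for a b d
  have As: "A i k h = A k i h" for i k h
    unfolding A_def jacobian_deriv_commute[OF p, of i _ k] by (rule refl)
  have "(\<Sum>b\<in>UNIV. J p b h * (\<Sum>a\<in>UNIV. g c p b a * X a)) = (\<Sum>b\<in>UNIV. J p b h * (\<Sum>a\<in>UNIV. g c p b a * V a))" for h
  proof -
    let ?h = "\<lambda>a. J p a h" and ?j = "\<lambda>a. J p a j" and ?k = "\<lambda>a. J p a k"
    have "(\<Sum>b\<in>UNIV. J p b h * (\<Sum>a\<in>UNIV. g c p b a * X a)) = (\<Sum>m\<in>UNIV. g c' p h m * new.\<Gamma> p m j k)"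
      unfolding X_def metric_law[OF p] sum_distrib_left sum_distrib_right
      by (subst sum_swap_3) (simp only: mult_ac)
    also have "\<dots> = A j k h + (sum3 ?j ?h ?k D + sum3 ?k ?h ?j D - sum3 ?h ?j ?k D) / 2"
      unfolding new.lower_christoffel[OF p] deriv_metric_law[OF p] A_def[symmetric] D_def[symmetric]
      using As[of j h k] As[of k h j] As[of k j h] by simp
    also have "(sum3 ?j ?h ?k D + sum3 ?k ?h ?j D - sum3 ?h ?j ?k D) / 2
       = sum3 ?h ?j ?k (\<lambda>a b d. (D b a d + D d a b - D a b d) / 2)"
      unfolding sum3_swap[of ?j ?h ?k] sum3_rotate[of ?k ?h ?j]
      by (simp add: sum3_def sum.distrib sum_subtractf sum_divide_distrib ring_distribs add_divide_distrib diff_divide_distrib)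
    also have "\<dots> = sum3 ?h ?j ?k (\<lambda>a b d. \<Sum>e\<in>UNIV. g c p a e * old.\<Gamma> p e b d)"
      unfolding old.lower_christoffel[OF p] D_def by (rule refl)
    also have "\<dots> = (\<Sum>a\<in>UNIV. J p a h * (\<Sum>e\<in>UNIV. g c p a e * (\<Sum>b\<in>UNIV. \<Sum>d\<in>UNIV. J p b j * J p d k * old.\<Gamma> p e b d)))"
      unfolding sum3_def sum_distrib_left
      by (rule sum.cong[OF refl], subst sum_swap_3) (simp only: mult_ac)
    finally show ?thesis
      unfolding V_def A_def by (simp add: sum.distrib ring_distribs)
  qed
  then have "(\<Sum>a\<in>UNIV. g c p b a * X a) = (\<Sum>a\<in>UNIV. g c p b a * V a)" for b
    by (rule jacobian_cancel[OF p])
  then have "X a = V a"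
    using old.raise_lower[OF p, of a X] old.raise_lower[OF p, of a V] by simp
  then show ?thesis unfolding X_def V_def .
qed

text \<open>The partial derivative and the Christoffel symbols produce the same second derivatives
  of the coordinates, which cancel in the difference.\<close>

lemma nabla_01_law:
  assumes p: "p \<in> U" and T: "\<And>k. smooth_in c U (\<lambda>q. T c q k)"
    and law: "\<And>q k. q \<in> U \<Longrightarrow> T c' q k = (\<Sum>a\<in>UNIV. J q a k * T c q a)"
  shows "nabla_01 g T c' p k l = (\<Sum>a\<in>UNIV. \<Sum>b\<in>UNIV. J p a k * J p b l * nabla_01 g T c p a b)"
proof -
  have Ts: "smooth_in c' U (\<lambda>q. T c q a)" for a
    by (rule smooth_transfer) (rule T)
  have Td: "d' k (\<lambda>q. T c q b) p = (\<Sum>a\<in>UNIV. J p a k * coord_deriv c a (\<lambda>q. T c q b) p)" for b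
    using p T by (intro coord_deriv_chain)
  have "d' k (\<lambda>q. T c' q l) p = d' k (\<lambda>q. \<Sum>b\<in>UNIV. J q b l * T c q b) p"
    using p law by (intro new.coord_deriv_cong)
  also have "\<dots> = (\<Sum>b\<in>UNIV. J p b l * (\<Sum>a\<in>UNIV. J p a k * coord_deriv c a (\<lambda>q. T c q b) p))
      + (\<Sum>b\<in>UNIV. d' k (\<lambda>q. J q b l) p * T c p b)"
    using p Ts by (simp add: new.coord_deriv_rules Td sum.distrib)
  also have "(\<Sum>b\<in>UNIV. J p b l * (\<Sum>a\<in>UNIV. J p a k * coord_deriv c a (\<lambda>q. T c q b) p))
     = (\<Sum>a\<in>UNIV. \<Sum>b\<in>UNIV. J p a k * J p b l * coord_deriv c a (\<lambda>q. T c q b) p)"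
    unfolding sum_distrib_left by (subst sum.swap) (simp only: mult_ac)
  finally have 1: "d' k (\<lambda>q. T c' q l) p = \<dots>  + (\<Sum>b\<in>UNIV. d' k (\<lambda>q. J q b l) p * T c p b)" .
  have "(\<Sum>m\<in>UNIV. new.\<Gamma> p m k l * T c' p m) = (\<Sum>b\<in>UNIV. (\<Sum>m\<in>UNIV. J p b m * new.\<Gamma> p m k l) * T c p b)"
    unfolding law[OF p] sum_distrib_left sum_distrib_right by (subst sum.swap) (simp only: mult_ac)
  also have "\<dots> = (\<Sum>b\<in>UNIV. d' k (\<lambda>q. J q b l) p * T c p b)
     + (\<Sum>b\<in>UNIV. (\<Sum>e\<in>UNIV. \<Sum>f\<in>UNIV. J p e k * J p f l * old.\<Gamma> p b e f) * T c p b)"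
    unfolding christoffel_law[OF p] by (simp add: ring_distribs sum.distrib)
  also have "(\<Sum>b\<in>UNIV. (\<Sum>e\<in>UNIV. \<Sum>f\<in>UNIV. J p e k * J p f l * old.\<Gamma> p b e f) * T c p b)
     = (\<Sum>e\<in>UNIV. \<Sum>f\<in>UNIV. J p e k * J p f l * (\<Sum>b\<in>UNIV. old.\<Gamma> p b e f * T c p b))"
    unfolding sum_distrib_left sum_distrib_right by (subst sum_swap_3[symmetric]) (simp only: mult_ac)
  finally show ?thesis
    unfolding nabla_01_def 1 by (simp add: right_diff_distrib sum_subtractf)
qed

lemma pull_back_02:
  assumes p: "p \<in> U"
    and law: "\<And>k l. S' k l = (\<Sum>a\<in>UNIV. \<Sum>b\<in>UNIV. J p a k * J p b l * S a b)"
  shows "(\<Sum>k\<in>UNIV. \<Sum>l\<in>UNIV. K p k a * K p l b * S' k l) = S a b"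
proof -
  have "(\<Sum>k\<in>UNIV. \<Sum>l\<in>UNIV. K p k a * K p l b * S' k l)
    = (\<Sum>l\<in>UNIV. K p l b * (\<Sum>k\<in>UNIV. K p k a * (\<Sum>e\<in>UNIV. J p e k * (\<Sum>f\<in>UNIV. J p f l * S e f))))"
    unfolding law sum_distrib_left by (subst sum.swap) (simp only: mult_ac)
  also have "\<dots> = S a b" unfolding jacobian_transpose_inv[OF p] by (rule refl)
  finally show ?thesis .
qed

lemma metric_inv_law:
  assumes p: "p \<in> U"
  shows "new.gi p k l = (\<Sum>a\<in>UNIV. \<Sum>b\<in>UNIV. K p k a * K p l b * old.gi p a b)"
proof -
  define X where "X m = (\<Sum>a\<in>UNIV. K p m a * (\<Sum>b\<in>UNIV. old.gi p a b * K p l b))" for m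
  have "(\<Sum>m\<in>UNIV. g c' p h m * X m) = kdelta h l" for h
  proof -
    have "(\<Sum>m\<in>UNIV. g c' p h m * X m)
       = (\<Sum>a\<in>UNIV. J p a h * (\<Sum>b\<in>UNIV. g c p a b * (\<Sum>m\<in>UNIV. J p b m * X m)))"
      unfolding metric_law[OF p] sum_distrib_left sum_distrib_right
      by (subst sum_swap_3[symmetric]) (simp only: mult_ac)
    also have "\<dots> = (\<Sum>a\<in>UNIV. J p a h * K p l a)"
      unfolding X_def jacobian_inv_apply[OF p] old.lower_raise[OF p] by (rule refl)
    also have "\<dots> = kdelta h l"
      using jacobian_inv[OF p, of l h] by (simp add: mult.commute kdelta_commute)
    finally show ?thesis .
  qed
  then have "new.gi p k l = X k"
    using new.raise_lower[OF p, of k X] by simp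
  then show ?thesis unfolding X_def sum_distrib_left by (simp only: mult_ac)
qed

lemma trace_law:
  assumes p: "p \<in> U"
    and law: "\<And>k l. S c' p k l = (\<Sum>a\<in>UNIV. \<Sum>b\<in>UNIV. J p a k * J p b l * S c p a b)"
  shows "trace_g g S c' p = trace_g g S c p"
proof -
  have "trace_g g S c' p = (\<Sum>a\<in>UNIV. \<Sum>b\<in>UNIV. old.gi p a b * (\<Sum>k\<in>UNIV. \<Sum>l\<in>UNIV. K p k a * K p l b * S c' p k l))"
    unfolding trace_g_def metric_inv_law[OF p] sum_distrib_left sum_distrib_right
    by (subst sum_swap_4) (simp only: mult_ac)
  then show ?thesis unfolding pull_back_02[OF p law] trace_g_def .
qed

text \<open>By the law of the Christoffel symbols the Jacobian is a gauge transformation between the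
  connection in the new chart and the pull-back \<open>G\<close> of the connection in the old one. Hence
  it intertwines their curvatures.\<close>

lemma riemann_law:
  assumes p: "p \<in> U"
  shows "(\<Sum>m\<in>UNIV. J p a m * riemann g c' p j i k m)
    = (\<Sum>b\<in>UNIV. \<Sum>e\<in>UNIV. \<Sum>f\<in>UNIV. J p b j * J p e i * J p f k * riemann g c p b e f a)"
proof -
  define G where "G j a f q = (\<Sum>b\<in>UNIV. J q b j * old.\<Gamma> q a b f)" for j a f q
  have \<Gamma>s: "smooth_in c' U (\<lambda>q. old.\<Gamma> q a b f)" for a b f
    by (rule smooth_transfer) simp
  have Gs: "smooth_in c' U (\<lambda>q. G j a f q)" for j a f
    unfolding G_def using \<Gamma>s by simp
  have gauge: "(\<Sum>m\<in>UNIV. J q a m * new.\<Gamma> q m j k) = d' j (\<lambda>q. J q a k) q + (\<Sum>f\<in>UNIV. G j a f q * J q f k)"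
    if "q \<in> U" for q a j k
    unfolding christoffel_law[OF that] G_def sum_distrib_right by (subst (2) sum.swap) (simp only: mult_ac)
  define dJ where "dJ i a k = d' i (\<lambda>q. J q a k) p" for i a k
  define ddJ where "ddJ i j a k = d' i (d' j (\<lambda>q. J q a k)) p" for i j a k
  define dG where "dG i j a f = d' i (G j a f) p" for i j a f
  \<comment> \<open>One half of the curvature, before antisymmetrizing in \<open>i\<close> and
    \<open>j\<close>, read off from the differentiated gauge equation. \<open>ddJ\<close> is
    symmetric and the two sums with \<open>dJ\<close> are exchanged by swapping \<open>i\<close> and
    \<open>j\<close>, so only the last sum survives in the difference.\<close>
  have half: "(\<Sum>m\<in>UNIV. J p a m * (d' i (\<lambda>q. new.\<Gamma> q m j k) p + (\<Sum>n\<in>UNIV. new.\<Gamma> p m i n * new.\<Gamma> p n j k)))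
    = ddJ i j a k + (\<Sum>f\<in>UNIV. G j a f p * dJ i f k) + (\<Sum>f\<in>UNIV. G i a f p * dJ j f k)
      + (\<Sum>f\<in>UNIV. (dG i j a f + (\<Sum>e\<in>UNIV. G i a e p * G j e f p)) * J p f k)" for i j
  proof -
    have "d' i (\<lambda>q. \<Sum>m\<in>UNIV. J q a m * new.\<Gamma> q m j k) p
        = d' i (\<lambda>q. d' j (\<lambda>q. J q a k) q + (\<Sum>f\<in>UNIV. G j a f q * J q f k)) p"
      using p gauge by (intro new.coord_deriv_cong)
    then have eq: "(\<Sum>m\<in>UNIV. J p a m * d' i (\<lambda>q. new.\<Gamma> q m j k) p) + (\<Sum>m\<in>UNIV. dJ i a m * new.\<Gamma> p m j k)
        = ddJ i j a k + (\<Sum>f\<in>UNIV. G j a f p * dJ i f k) + (\<Sum>f\<in>UNIV. dG i j a f * J p f k)"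
      using p Gs by (simp add: new.coord_deriv_rules sum.distrib dJ_def ddJ_def dG_def)
    have "dJ i a m = (\<Sum>n\<in>UNIV. J p a n * new.\<Gamma> p n i m) - (\<Sum>f\<in>UNIV. G i a f p * J p f m)" for m
      using gauge[OF p, of a i m] by (simp add: dJ_def)
    then have "(\<Sum>m\<in>UNIV. dJ i a m * new.\<Gamma> p m j k)
      = (\<Sum>m\<in>UNIV. (\<Sum>n\<in>UNIV. J p a n * new.\<Gamma> p n i m) * new.\<Gamma> p m j k)
       - (\<Sum>m\<in>UNIV. (\<Sum>f\<in>UNIV. G i a f p * J p f m) * new.\<Gamma> p m j k)"
      by (simp add: left_diff_distrib sum_subtractf)
    also have "(\<Sum>m\<in>UNIV. (\<Sum>n\<in>UNIV. J p a n * new.\<Gamma> p n i m) * new.\<Gamma> p m j k)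
       = (\<Sum>m\<in>UNIV. J p a m * (\<Sum>n\<in>UNIV. new.\<Gamma> p m i n * new.\<Gamma> p n j k))"
      unfolding sum_distrib_left sum_distrib_right by (subst sum.swap) (simp only: mult_ac)
    also have "(\<Sum>m\<in>UNIV. (\<Sum>f\<in>UNIV. G i a f p * J p f m) * new.\<Gamma> p m j k)
       = (\<Sum>f\<in>UNIV. G i a f p * (\<Sum>m\<in>UNIV. J p f m * new.\<Gamma> p m j k))"
      unfolding sum_distrib_left sum_distrib_right by (subst sum.swap) (simp only: mult_ac)
    also have "\<dots> = (\<Sum>f\<in>UNIV. G i a f p * dJ j f k) + (\<Sum>f\<in>UNIV. G i a f p * (\<Sum>e\<in>UNIV. G j f e p * J p e k))"
      unfolding gauge[OF p] dJ_def by (simp add: distrib_left sum.distrib)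
    also have "(\<Sum>f\<in>UNIV. G i a f p * (\<Sum>e\<in>UNIV. G j f e p * J p e k))
       = (\<Sum>f\<in>UNIV. (\<Sum>e\<in>UNIV. G i a e p * G j e f p) * J p f k)"
      unfolding sum_distrib_left sum_distrib_right by (subst sum.swap) (simp only: mult_ac)
    finally show ?thesis using eq by (simp add: ring_distribs sum.distrib)
  qed
  have ddJs: "ddJ i j a k = ddJ j i a k"
    unfolding ddJ_def using p by (intro new.coord_deriv_commute) auto
  have R': "riemann g c' p j i k m =
      (d' i (\<lambda>q. new.\<Gamma> q m j k) p + (\<Sum>n\<in>UNIV. new.\<Gamma> p m i n * new.\<Gamma> p n j k))
      - (d' j (\<lambda>q. new.\<Gamma> q m i k) p + (\<Sum>n\<in>UNIV. new.\<Gamma> p m j n * new.\<Gamma> p n i k))" for m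
    by (simp add: riemann_def mult.commute)
  have dG: "dG i j a f = (\<Sum>b\<in>UNIV. \<Sum>e\<in>UNIV. J p b j * J p e i * coord_deriv c e (\<lambda>q. old.\<Gamma> q a b f) p)
      + (\<Sum>b\<in>UNIV. dJ i b j * old.\<Gamma> p a b f)" for i j f
  proof -
    have "d' i (\<lambda>q. old.\<Gamma> q a b f) p = (\<Sum>e\<in>UNIV. J p e i * coord_deriv c e (\<lambda>q. old.\<Gamma> q a b f) p)" for b
      using p by (intro coord_deriv_chain) auto
    then show ?thesis
      unfolding dG_def G_def using p \<Gamma>s
      by (simp add: new.coord_deriv_rules sum.distrib dJ_def sum_distrib_left mult_ac)
  qed
  have dJs: "dJ i b j = dJ j b i" for b
    unfolding dJ_def by (rule jacobian_deriv_commute[OF p])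
  have GG: "(\<Sum>e\<in>UNIV. G i a e p * G j e f p)
     = (\<Sum>b\<in>UNIV. \<Sum>e\<in>UNIV. J p b j * J p e i * (\<Sum>h\<in>UNIV. old.\<Gamma> p a e h * old.\<Gamma> p h b f))" for i j f
    unfolding G_def sum_distrib_left sum_distrib_right
    by (subst sum_swap_13, subst sum.swap) (simp only: mult_ac)
  have sw: "(\<Sum>b\<in>UNIV. \<Sum>e\<in>UNIV. J p b i * J p e j * F b e) = (\<Sum>b\<in>UNIV. \<Sum>e\<in>UNIV. J p b j * J p e i * F e b)" for F
    by (subst sum.swap) (simp only: mult_ac)
  have curv: "(dG i j a f + (\<Sum>e\<in>UNIV. G i a e p * G j e f p)) - (dG j i a f + (\<Sum>e\<in>UNIV. G j a e p * G i e f p))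
     = (\<Sum>b\<in>UNIV. \<Sum>e\<in>UNIV. J p b j * J p e i * riemann g c p b e f a)" for f
    unfolding dG GG dJs[symmetric] sw
    by (simp add: riemann_def sum.distrib sum_subtractf ring_distribs mult_ac)
  have "(\<Sum>m\<in>UNIV. J p a m * riemann g c' p j i k m)
     = (\<Sum>f\<in>UNIV. ((dG i j a f + (\<Sum>e\<in>UNIV. G i a e p * G j e f p)) - (dG j i a f + (\<Sum>e\<in>UNIV. G j a e p * G i e f p))) * J p f k)"
    unfolding R' right_diff_distrib sum_subtractf half ddJs left_diff_distrib by simp
  also have "\<dots> = (\<Sum>b\<in>UNIV. \<Sum>e\<in>UNIV. \<Sum>f\<in>UNIV. J p b j * J p e i * J p f k * riemann g c p b e f a)"
    unfolding curv sum_distrib_right by (subst sum_swap_3[symmetric]) (simp only: mult_ac)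
  finally show ?thesis .
qed

text \<open>In the trace the Jacobian of the contracted lower index meets the inverse Jacobian of
  the upper one and cancels.\<close>

lemma ricci_law:
  assumes p: "p \<in> U"
  shows "ricci g c' p k l = (\<Sum>a\<in>UNIV. \<Sum>b\<in>UNIV. J p a k * J p b l * ricci g c p a b)"
proof -
  have "(\<Sum>m\<in>UNIV. riemann g c' p m k l m)
     = (\<Sum>m\<in>UNIV. \<Sum>a\<in>UNIV. K p m a * (\<Sum>n\<in>UNIV. J p a n * riemann g c' p m k l n))"
    unfolding jacobian_apply_inv[OF p] by (rule refl)
  also have "\<dots> = (\<Sum>a\<in>UNIV. \<Sum>m\<in>UNIV. K p m a * (\<Sum>b\<in>UNIV. J p b m *
      (\<Sum>e\<in>UNIV. \<Sum>f\<in>UNIV. J p e k * J p f l * riemann g c p b e f a)))"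
    unfolding riemann_law[OF p] sum_distrib_left by (subst sum.swap) (simp only: mult_ac)
  also have "\<dots> = (\<Sum>a\<in>UNIV. \<Sum>e\<in>UNIV. \<Sum>f\<in>UNIV. J p e k * J p f l * riemann g c p a e f a)"
    unfolding jacobian_transpose_inv[OF p] by (rule refl)
  also have "\<dots> = (\<Sum>e\<in>UNIV. \<Sum>f\<in>UNIV. J p e k * J p f l * (\<Sum>a\<in>UNIV. riemann g c p a e f a))"
    unfolding sum_distrib_left by (rule sum_swap_3[symmetric])
  finally show ?thesis by (simp add: ricci_def sum_negf)
qed

end

section \<open>Pointwise algebra\<close>

context metric_chart begin

text \<open>The pointwise algebra uses bare components at one point, so that contracting an equation
  means applying the linear operators \<open>dot\<close> and \<open>contract\<close> to both of its
  sides.\<close>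

definition raise :: "'m \<Rightarrow> ('n \<Rightarrow> real) \<Rightarrow> 'n \<Rightarrow> real" where
  "raise p x l = (\<Sum>m\<in>UNIV. gi p l m * x m)"

definition dot :: "'m \<Rightarrow> ('n \<Rightarrow> real) \<Rightarrow> ('n \<Rightarrow> real) \<Rightarrow> real" where
  "dot p x y = (\<Sum>l\<in>UNIV. raise p x l * y l)"

definition contract :: "'m \<Rightarrow> ('n \<Rightarrow> 'n \<Rightarrow> real) \<Rightarrow> real" where
  "contract p F = (\<Sum>j\<in>UNIV. \<Sum>l\<in>UNIV. gi p j l * F j l)"

lemma dot_linear:
  "dot p x (\<lambda>l. F l + G l) = dot p x F + dot p x G"
  "dot p x (\<lambda>l. F l - G l) = dot p x F - dot p x G"
  "dot p x (\<lambda>l. a * F l) = a * dot p x F"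
  "dot p x (\<lambda>l. F l * a) = dot p x F * a"
  by (simp_all add: dot_def sum.distrib sum_subtractf sum_distrib_left sum_distrib_right ring_distribs mult_ac)

lemma contract_linear:
  "contract p (\<lambda>j l. F j l + G j l) = contract p F + contract p G"
  "contract p (\<lambda>j l. F j l - G j l) = contract p F - contract p G"
  "contract p (\<lambda>j l. a * F j l) = a * contract p F"
  "contract p (\<lambda>j l. F j l * a) = contract p F * a"
  by (simp_all add: contract_def sum.distrib sum_subtractf sum_distrib_left sum_distrib_right ring_distribs mult_ac)

context
  fixes p assumes p: "p \<in> U"
begin

lemma contract_product: "contract p (\<lambda>j l. x j * y l) = dot p x y" "contract p (\<lambda>j l. y l * x j) = dot p x y"
proof -
  show *: "contract p (\<lambda>j l. x j * y l) = dot p x y"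
    unfolding contract_def dot_def raise_def sum_distrib_right
    by (subst sum.swap, intro sum.cong refl) (simp add: gi_sym[OF p, of _ l for l] mult_ac)
  then show "contract p (\<lambda>j l. y l * x j) = dot p x y" by (simp only: mult.commute)
qed

lemma contract_swap: "contract p (\<lambda>j l. F l j) = contract p F"
  unfolding contract_def by (subst sum.swap) (intro sum.cong refl arg_cong2[where f = "(*)"] gi_sym p)

lemma dot_commute: "dot p x y = dot p y x"
  using contract_swap[of "\<lambda>j l. x j * y l"] contract_product[of x y] contract_product[of y x] by simp

lemma contract_metric:
  "contract p (\<lambda>j l. g c p j l) = real CARD('n)"
  "contract p (\<lambda>j l. x j * g c p k l) = x k"
  "contract p (\<lambda>j l. x j * g c p l k) = x k"
  "contract p (\<lambda>j l. x l * g c p j k) = x k"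
proof -
  show "contract p (\<lambda>j l. g c p j l) = real CARD('n)"
    using contract_with_metric(2)[OF p, of 1] by (simp add: contract_def)
  show *: "contract p (\<lambda>j l. x j * g c p k l) = x k"
    using contract_with_metric(1)[OF p, of x k] by (simp add: contract_def)
  then show **: "contract p (\<lambda>j l. x j * g c p l k) = x k"
    by (simp only: g_sym[OF p, of _ k])
  then show "contract p (\<lambda>j l. x l * g c p j k) = x k"
    using contract_swap[of "\<lambda>j l. x j * g c p l k"] by simp
qed

lemma dot_metric: "dot p x (g c p k) = x k" "dot p x (\<lambda>l. g c p l k) = x k"
proof -
  show *: "dot p x (g c p k) = x k"
    using lower_raise[OF p, of k x] by (simp add: dot_def raise_def mult.commute)
  show "dot p x (\<lambda>l. g c p l k) = x k" using * by (simp only: g_sym[OF p, of _ k])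
qed

text \<open>The value is the metric evaluated on the raised vector, which is nonzero because
  lowering it gives back \<open>x\<close>.\<close>

lemma dot_pos:
  assumes "x k \<noteq> 0"
  shows "dot p x x > 0"
proof -
  define v where "v = (\<chi> l. raise p x l)"
  have low: "(\<Sum>j\<in>UNIV. g c p i j * v $ j) = x i" for i
    unfolding v_def raise_def using lower_raise[OF p, of i x] by simp
  have "v \<noteq> 0" using low[of k] assms by auto
  from g_pos[OF p this] have "0 < (\<Sum>i\<in>UNIV. v $ i * (\<Sum>j\<in>UNIV. g c p i j * v $ j))"
    by (simp add: sum_distrib_left mult_ac)
  then show ?thesis unfolding low by (simp add: v_def dot_def)
qed

text \<open>Contracting \<open>l\<close> with \<open>w\<close> annihilates the left side by the
  eigenvector equation, whence \<psi> = \<tau> w for some \<tau>. Contracting \<open>k\<close> with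
  \<open>w\<close> then expresses \<open>Z\<close> through the metric and \<open>w\<close>, and the
  full trace identifies \<tau> with the explicit scalar \<sigma>.\<close>

lemma quasi_einstein_form:
  assumes n: "CARD('n) > 1"
    and w: "w k0 \<noteq> 0"
    and sym: "\<And>k l. Z k l = Z l k"
    and eig: "\<And>k. dot p w (\<lambda>l. Z k l) = \<zeta> * w k"
    and eq: "\<And>k j l. w k * Z j l - w j * Z k l = \<psi> k * g c p j l - \<psi> j * g c p k l"
  defines "\<sigma> \<equiv> (contract p Z - \<zeta>) / (real CARD('n) - 1)"
  shows "Z j l = \<sigma> * g c p j l + (\<zeta> - \<sigma>) * (w j * w l / dot p w w)"
proof -
  define N where "N = dot p w w"
  have N: "N > 0" unfolding N_def using w by (rule dot_pos)
  have eig': "dot p w (\<lambda>k. Z k l) = \<zeta> * w l" for l using eig[of l] by (simp only: sym[of _ l])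
  have pr: "\<psi> k * w j = \<psi> j * w k" for k j
  proof -
    have "dot p w (\<lambda>l. w k * Z j l - w j * Z k l) = dot p w (\<lambda>l. \<psi> k * g c p j l - \<psi> j * g c p k l)"
      by (simp only: eq)
    then show ?thesis by (simp add: dot_linear eig dot_metric)
  qed
  define \<tau> where "\<tau> = dot p w \<psi> / N"
  have \<tau>: "\<psi> k = \<tau> * w k" for k
  proof -
    have "dot p w (\<lambda>j. \<psi> k * w j) = dot p w (\<lambda>j. \<psi> j * w k)" by (simp only: pr[of k])
    then have "\<psi> k * N = dot p w \<psi> * w k" by (simp add: dot_linear N_def)
    then show ?thesis using N by (simp add: \<tau>_def field_simps)
  qed
  have form: "Z j l = \<tau> * g c p j l + (\<zeta> - \<tau>) * (w j * w l / N)" for j l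
  proof -
    have "dot p w (\<lambda>k. w k * Z j l - w j * Z k l) = dot p w (\<lambda>k. \<tau> * w k * g c p j l - \<tau> * w j * g c p k l)"
      by (simp only: eq \<tau>)
    then have "N * Z j l - w j * (\<zeta> * w l) = \<tau> * N * g c p j l - \<tau> * w j * w l"
      by (simp add: dot_linear dot_metric eig' N_def)
    then show ?thesis using N by (simp add: field_simps)
  qed
  have "contract p Z = contract p (\<lambda>j l. \<tau> * g c p j l + (\<zeta> - \<tau>) * (1 / N) * (w j * w l))"
    by (intro arg_cong[where f = "contract p"] ext) (simp add: form)
  also have "\<dots> = \<tau> * real CARD('n) + (\<zeta> - \<tau>)"
    using N by (simp only: contract_linear contract_metric contract_product N_def[symmetric]) simp
  finally have "\<tau> = \<sigma>" using n by (simp add: \<sigma>_def field_simps)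
  then show ?thesis using form[of j l] unfolding N_def by (simp only:)
qed

text \<open>To be read with \<open>s\<close> = d\<sigma>, \<open>l\<close> = d\<nu>,
  \<open>N\<close> = \<nabla>T and \<open>w\<close> the length of \<omega>. The equation is
  evaluated on \<open>T\<close> in one and two slots and traced over two pairs of slots. The parts
  of \<open>A\<close> and \<open>B\<close> orthogonal to \<open>T\<close> coincide, and two of the
  resulting relations are compatible only if this common part is zero.\<close>

lemma weakly_symmetric_algebra:
  fixes T A B s l :: "'n \<Rightarrow> real" and N :: "'n \<Rightarrow> 'n \<Rightarrow> real" and \<sigma> \<nu> w :: real
  assumes n: "CARD('n) > 2" and \<sigma>: "\<sigma> \<noteq> 0"
    and unit: "dot p T T = 1" and N: "\<And>k. dot p T (N k) = 0"
    and AB: "\<And>k. A k = B k + w * T k"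
    and eq: "\<And>k i j. s k * g c p i j + l k * (T i * T j) + \<nu> * (N k i * T j + T i * N k j) =
      A k * (\<sigma> * g c p i j + \<nu> * (T i * T j)) + B i * (\<sigma> * g c p k j + \<nu> * (T k * T j))
      + B j * (\<sigma> * g c p k i + \<nu> * (T k * T i))"
  defines "a \<equiv> dot p T A" and "b \<equiv> dot p T B"
  shows "s k = a * \<sigma> * T k" and "s k + l k = (a + 2 * b) * (\<sigma> + \<nu>) * T k"
    and "\<nu> * N k j = b * \<sigma> * (g c p k j - T k * T j)"
proof -
  define n where "n = real CARD('n)"
  define \<zeta> where "\<zeta> = \<sigma> + \<nu>"
  have n2: "n > 2" using n by (simp add: n_def)
  have comm: "dot p B T = b" "dot p A T = a" "dot p (N k) T = 0" "dot p l T = dot p T l"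
    "dot p (\<lambda>k. N k j) T = dot p T (\<lambda>k. N k j)" for k j
    using N[of k] by (simp_all only: a_def b_def dot_commute[of _ T])
  have c1: "s k * T i + l k * T i + \<nu> * N k i = A k * \<zeta> * T i + B i * \<zeta> * T k + b * (\<sigma> * g c p k i + \<nu> * (T k * T i))" for k i
  proof -
    have "dot p T (\<lambda>j. s k * g c p i j + l k * (T i * T j) + \<nu> * (N k i * T j + T i * N k j))
      = dot p T (\<lambda>j. A k * (\<sigma> * g c p i j + \<nu> * (T i * T j)) + B i * (\<sigma> * g c p k j + \<nu> * (T k * T j))
      + B j * (\<sigma> * g c p k i + \<nu> * (T k * T i)))"
      by (simp only: eq)
    then show ?thesis
      by (simp add: dot_linear dot_metric unit N b_def \<zeta>_def algebra_simps)
  qed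
  have c2: "s k + l k = A k * \<zeta> + 2 * b * \<zeta> * T k" for k
  proof -
    have "dot p T (\<lambda>i. s k * T i + l k * T i + \<nu> * N k i)
      = dot p T (\<lambda>i. A k * \<zeta> * T i + B i * \<zeta> * T k + b * (\<sigma> * g c p k i + \<nu> * (T k * T i)))"
      by (simp only: c1)
    then show ?thesis
      by (simp add: dot_linear dot_metric unit N b_def[symmetric] \<zeta>_def algebra_simps)
  qed
  have c3: "(A k * \<zeta> + 2 * b * \<zeta> * T k) * T i + \<nu> * N k i
      = A k * \<zeta> * T i + B i * \<zeta> * T k + b * (\<sigma> * g c p k i + \<nu> * (T k * T i))" for k i
    unfolding c2[symmetric] c1[symmetric] by (simp only: distrib_right)
  have cN: "\<nu> * dot p T (\<lambda>k. N k i) = \<zeta> * (B i - b * T i)" for i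
  proof -
    have "dot p T (\<lambda>k. (A k * \<zeta> + 2 * b * \<zeta> * T k) * T i + \<nu> * N k i)
      = dot p T (\<lambda>k. A k * \<zeta> * T i + B i * \<zeta> * T k + b * (\<sigma> * g c p k i + \<nu> * (T k * T i)))"
      by (simp only: c3)
    then show ?thesis
      by (simp add: dot_linear dot_metric unit a_def[symmetric] b_def[symmetric] \<zeta>_def algebra_simps)
  qed
  have t1: "n * s k + l k = A k * (n * \<sigma> + \<nu>) + 2 * (\<sigma> * B k + \<nu> * b * T k)" for k
  proof -
    have "contract p (\<lambda>i j. s k * g c p i j + l k * (T i * T j) + \<nu> * (N k i * T j + T i * N k j))
      = contract p (\<lambda>i j. A k * (\<sigma> * g c p i j + \<nu> * (T i * T j)) + \<sigma> * (B i * g c p k j) + \<nu> * T k * (B i * T j)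
      + \<sigma> * (B j * g c p i k) + \<nu> * T k * (T i * B j))"
      unfolding eq g_sym[OF p, of _ k] by (simp add: algebra_simps)
    then show ?thesis
      unfolding contract_linear contract_metric contract_product unit N comm b_def[symmetric] n_def[symmetric]
      by (simp add: algebra_simps)
  qed
  have t2: "s j + dot p T l * T j + \<nu> * contract p N * T j + \<zeta> * (B j - b * T j)
     = \<sigma> * A j + \<nu> * a * T j + \<sigma> * B j + \<nu> * b * T j + (n * \<sigma> + \<nu>) * B j" for j
  proof -
    have "contract p (\<lambda>k i. s k * g c p i j + T j * (l k * T i) + \<nu> * T j * N k i + \<nu> * (N k j * T i))
      = contract p (\<lambda>k i. \<sigma> * (A k * g c p i j) + \<nu> * T j * (A k * T i) + \<sigma> * (B i * g c p k j) + \<nu> * T j * (T k * B i)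
      + B j * (\<sigma> * g c p k i + \<nu> * (T k * T i)))"
    proof (intro arg_cong[where f = "contract p"] ext)
      fix k i
      show "s k * g c p i j + T j * (l k * T i) + \<nu> * T j * N k i + \<nu> * (N k j * T i) =
        \<sigma> * (A k * g c p i j) + \<nu> * T j * (A k * T i) + \<sigma> * (B i * g c p k j) + \<nu> * T j * (T k * B i)
        + B j * (\<sigma> * g c p k i + \<nu> * (T k * T i))"
        using eq[of k i j] by (simp add: algebra_simps)
    qed
    then have "s j + T j * dot p T l + \<nu> * T j * contract p N + \<nu> * dot p T (\<lambda>k. N k j)
      = \<sigma> * A j + \<nu> * T j * a + \<sigma> * B j + \<nu> * T j * b + B j * (\<sigma> * n + \<nu>)"
      by (simp add: contract_linear contract_metric contract_product unit comm
          a_def[symmetric] b_def[symmetric] n_def[symmetric])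
    then show ?thesis unfolding cN by (simp add: algebra_simps)
  qed
  \<comment> \<open>Subtracting \<open>c2\<close> from the trace \<open>t1\<close> eliminates the
    unknown \<open>l\<close>.\<close>
  have s1: "(n - 1) * s k = (n - 1) * \<sigma> * A k + 2 * \<sigma> * (B k - b * T k)" for k
    using t1[of k] c2[of k] by (simp add: \<zeta>_def algebra_simps)
  have ab: "a = b + w"
  proof -
    have "A = (\<lambda>k. B k + w * T k)" using AB by (rule ext)
    then have "dot p T A = dot p T (\<lambda>k. B k + w * T k)" by (rule arg_cong)
    then show ?thesis by (simp add: a_def b_def dot_linear unit)
  qed
  have st: "dot p T s = \<sigma> * a"
  proof -
    have "dot p T (\<lambda>k. (n - 1) * s k) = dot p T (\<lambda>k. (n - 1) * \<sigma> * A k + 2 * \<sigma> * (B k - b * T k))"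
      by (simp only: s1)
    then have "(n - 1) * dot p T s = (n - 1) * (\<sigma> * a)"
      by (simp add: dot_linear unit a_def b_def)
    then show ?thesis using n2 by simp
  qed
  \<comment> \<open>The component of \<open>t2\<close> along \<open>T\<close>. Subtracting it from
    \<open>t2\<close> will remove the unknown divergence \<open>contract p N\<close> together with
    \<open>dot p T l\<close>.\<close>
  have t3: "dot p T s + dot p T l + \<nu> * contract p N = \<sigma> * a + \<nu> * a + \<sigma> * b + \<nu> * b + (n * \<sigma> + \<nu>) * b"
  proof -
    have "dot p T (\<lambda>j. s j + dot p T l * T j + \<nu> * contract p N * T j + \<zeta> * (B j - b * T j))
     = dot p T (\<lambda>j. \<sigma> * A j + \<nu> * a * T j + \<sigma> * B j + \<nu> * b * T j + (n * \<sigma> + \<nu>) * B j)"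
      by (simp only: t2)
    then show ?thesis by (simp add: dot_linear unit a_def[symmetric] b_def[symmetric])
  qed
  have B: "B k = b * T k" for k
  proof -
    \<comment> \<open>\<open>e\<close> is the common orthogonal part of \<open>A\<close> and
      \<open>B\<close>. From \<open>t2\<close> and \<open>s1\<close> the orthogonal part of
      \<open>s\<close> equals (n + 1) \<sigma> e, while n - 1 times it equals the same, so e = 0 as
      n > 2 and \<sigma> is nonzero.\<close>
    define e where "e = B k - b * T k"
    have Ae: "A k = a * T k + e" using AB[of k] ab by (simp add: e_def algebra_simps)
    have "s k - dot p T s * T k + \<zeta> * e = \<sigma> * (A k - a * T k) + (\<sigma> + n * \<sigma> + \<nu>) * e"
      using t2[of k] arg_cong[OF t3, of "\<lambda>x. x * T k"] by (simp add: e_def algebra_simps)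
    then have "s k - \<sigma> * a * T k = (n + 1) * \<sigma> * e"
      unfolding st by (simp add: Ae \<zeta>_def algebra_simps)
    moreover have "(n - 1) * (s k - \<sigma> * a * T k) = (n + 1) * \<sigma> * e"
      using s1[of k] by (simp add: Ae e_def[symmetric] algebra_simps)
    ultimately have "(n - 2) * ((n + 1) * \<sigma> * e) = 0" by (simp add: algebra_simps)
    then have "e = 0" using n2 \<sigma> by simp
    then show ?thesis by (simp add: e_def)
  qed
  have A: "A k = a * T k" for k using AB[of k] by (simp add: B ab algebra_simps)
  have "(n - 1) * s k = (n - 1) * (a * \<sigma> * T k)" using s1[of k] by (simp add: A B algebra_simps)
  then show sk: "s k = a * \<sigma> * T k" using n2 by simp
  show sl: "s k + l k = (a + 2 * b) * (\<sigma> + \<nu>) * T k"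
    using c2[of k] by (simp add: A \<zeta>_def algebra_simps)
  show "\<nu> * N k j = b * \<sigma> * (g c p k j - T k * T j)"
    using c3[of k j] by (simp add: A B \<zeta>_def algebra_simps)
qed

end
end

section \<open>Weakly Z symmetric manifolds in a chart\<close>

context metric_chart begin

lemma smooth_nabla_01 [simp]:
  "(\<And>k. smooth_in c U (\<lambda>q. X c q k)) \<Longrightarrow> smooth_in c U (\<lambda>q. nabla_01 g X c q k l)"
  unfolding nabla_01_def by simp

lemma inner_g_eq_dot: "p \<in> U \<Longrightarrow> inner_g g X Y c p = dot p (X c p) (Y c p)"
  using contract_product(1)[of p "X c p" "Y c p"] by (simp add: inner_g_def contract_def mult.assoc)

lemma raise_index_eq: "raise_index g X c p = raise p (X c p)"
  by (simp add: raise_index_def raise_def fun_eq_iff)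

lemma trace_g_eq_contract: "trace_g g S c p = contract p (S c p)"
  by (simp add: trace_g_def contract_def)

lemma smooth_inner_g [simp]:
  "(\<And>k. smooth_in c U (\<lambda>q. X c q k)) \<Longrightarrow> (\<And>k. smooth_in c U (\<lambda>q. Y c q k)) \<Longrightarrow>
    smooth_in c U (\<lambda>q. inner_g g X Y c q)"
  unfolding inner_g_def by simp

lemma nabla_02_cong:
  assumes "p \<in> U" "\<And>q k l. q \<in> U \<Longrightarrow> S c q k l = S' c q k l"
  shows "nabla_02 g S c p k i j = nabla_02 g S' c p k i j"
  unfolding nabla_02_def using assms by (simp add: coord_deriv_cong[of p "\<lambda>q. S c q i j" "\<lambda>q. S' c q i j"])

lemma nabla_02_product:
  assumes p: "p \<in> U" and X: "\<And>k. smooth_in c U (\<lambda>q. X c q k)" and Y: "\<And>k. smooth_in c U (\<lambda>q. Y c q k)"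
  shows "nabla_02 g (\<lambda>c q i j. X c q i * Y c q j) c p k i j =
    nabla_01 g X c p k i * Y c p j + X c p i * nabla_01 g Y c p k j"
  using assms
  by (simp add: nabla_02_def nabla_01_def coord_deriv_rules ring_distribs sum_distrib_left sum_distrib_right mult_ac)

lemma nabla_02_add_scaled:
  assumes p: "p \<in> U" and S: "\<And>k l. smooth_in c U (\<lambda>q. S c q k l)" and s: "smooth_in c U s"
    and S': "\<And>k l. smooth_in c U (\<lambda>q. S' c q k l)" and s': "smooth_in c U s'"
  shows "nabla_02 g (\<lambda>c q i j. s q * S c q i j + s' q * S' c q i j) c p k i j =
    coord_deriv c k s p * S c p i j + s p * nabla_02 g S c p k i j
    + coord_deriv c k s' p * S' c p i j + s' p * nabla_02 g S' c p k i j"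
  using assms
  by (simp add: nabla_02_def coord_deriv_rules sum.distrib ring_distribs sum_distrib_left mult_ac)

text \<open>The constant squared length is the trace of the product of \<open>T\<close> with itself;
  \<open>deriv_trace\<close> turns its derivative into twice the asserted contraction.\<close>

lemma nabla_unit_orthogonal:
  assumes p: "p \<in> U" and T: "\<And>k. smooth_in c U (\<lambda>q. T c q k)"
    and unit: "\<And>q. q \<in> U \<Longrightarrow> inner_g g T T c q = 1"
  shows "dot p (T c p) (nabla_01 g T c p k) = 0"
proof -
  let ?S = "\<lambda>c q i j. T c q i * T c q j"
  have "0 = coord_deriv c k (\<lambda>q. inner_g g T T c q) p"
    using coord_deriv_cong[where k = k, OF p unit] by simp
  also have "\<dots> = coord_deriv c k (\<lambda>q. trace_g g ?S c q) p"
    by (simp add: inner_g_def trace_g_def mult.assoc)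
  also have "\<dots> = contract p (\<lambda>i j. nabla_02 g ?S c p k i j)"
    using p T by (subst deriv_trace) (auto simp: contract_def)
  also have "\<dots> = contract p (\<lambda>i j. nabla_01 g T c p k i * T c p j + T c p i * nabla_01 g T c p k j)"
    using p T by (subst nabla_02_product) auto
  also have "\<dots> = dot p (nabla_01 g T c p k) (T c p) + dot p (T c p) (nabla_01 g T c p k)"
    unfolding contract_linear contract_product[OF p] ..
  finally show ?thesis using dot_commute[OF p, of "nabla_01 g T c p k"] by simp
qed

text \<open>Second derivatives commute, so \<open>u\<close> being a function of the potential of the closed
  form \<open>T\<close> forces its derivative \<open>v\<close> to be one as well.\<close>

lemma deriv_proportional:
  assumes p: "p \<in> U" and T: "\<And>k. smooth_in c U (\<lambda>q. T q k)"
    and closed: "\<And>i j. coord_deriv c i (\<lambda>q. T q j) p = coord_deriv c j (\<lambda>q. T q i) p"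
    and u: "smooth_in c U u" and v: "smooth_in c U v"
    and du: "\<And>q k. q \<in> U \<Longrightarrow> coord_deriv c k u q = v q * T q k"
  shows "coord_deriv c i v p * T p j = coord_deriv c j v p * T p i"
proof -
  have "coord_deriv c i (coord_deriv c j u) p = v p * coord_deriv c i (\<lambda>q. T q j) p + coord_deriv c i v p * T p j" for i j
    using coord_deriv_cong[where k = i, OF p du] p T v by (simp add: coord_deriv_mult)
  then show ?thesis
    using coord_deriv_commute[OF u p, of i j] closed[of i j] by simp
qed

end

definition unit_covector :: "('m, 'n::finite) tensor2 \<Rightarrow> ('m, 'n) tensor1 \<Rightarrow> ('m, 'n) tensor1" where
  "unit_covector g \<omega> = (\<lambda>c p k. \<omega> c p k / sqrt (inner_g g \<omega> \<omega> c p))"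

locale wzs_chart = metric_chart c U g
  for c :: "('m::topological_space, 'n::finite) chart" and U and g +
  fixes \<phi> \<zeta> :: "'m \<Rightarrow> real" and A B D \<omega> :: "('m, 'n) tensor1"
  assumes dim: "CARD('n) > 3"
    and smooth_data [simp]: "smooth_in c U \<phi>" "smooth_in c U (\<lambda>q. A c q k)" "smooth_in c U (\<lambda>q. B c q k)"
    and harmonic: "p \<in> U \<Longrightarrow> (\<Sum>m\<in>UNIV. nabla_13 g (conformal_curvature g) c p m j k l m) = 0"
    and wzs: "p \<in> U \<Longrightarrow> nabla_02 g (Z_tensor g \<phi>) c p k j l =
          A c p k * Z_tensor g \<phi> c p j l + B c p j * Z_tensor g \<phi> c p k l
          + D c p l * Z_tensor g \<phi> c p k j"
    and \<omega>: "\<omega> = (\<lambda>c p k. A c p k - B c p k)"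
    and eigen: "p \<in> U \<Longrightarrow> (\<Sum>l\<in>UNIV. Z_tensor g \<phi> c p k l * raise_index g \<omega> c p l) = \<zeta> p * \<omega> c p k"
    and \<omega>_nz: "p \<in> U \<Longrightarrow> \<exists>k. \<omega> c p k \<noteq> 0"
begin

abbreviation "Z \<equiv> Z_tensor g \<phi> c"

text \<open>By \<open>Z_form\<close> this is the eigenvalue on the orthogonal complement of
  \<omega>: the trace is \<zeta> plus n - 1 times it. Accordingly \<nu> is the gap between the two
  eigenvalues.\<close>

definition \<sigma> :: "'m \<Rightarrow> real" where "\<sigma> p = (Z_scalar g \<phi> c p - \<zeta> p) / (real CARD('n) - 1)"
definition \<nu> :: "'m \<Rightarrow> real" where "\<nu> p = \<zeta> p - \<sigma> p"
abbreviation "T \<equiv> unit_covector g \<omega>"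

lemma \<nu>_eq: "\<nu> p = (real CARD('n) * \<zeta> p - Z_scalar g \<phi> c p) / (real CARD('n) - 1)"
  using dim by (simp add: \<nu>_def \<sigma>_def field_simps)

lemma Z_sym: "p \<in> U \<Longrightarrow> Z p k l = Z p l k"
  by (simp add: Z_tensor_def ricci_sym[of p k l] g_sym[of p k l])

lemma smooth_Z [simp]: "smooth_in c U (\<lambda>q. Z q k l)"
  by (simp add: Z_tensor_def)

lemma smooth_\<omega> [simp]: "smooth_in c U (\<lambda>q. \<omega> c q k)"
  by (simp add: \<omega>)

lemma norm_\<omega>: "p \<in> U \<Longrightarrow> inner_g g \<omega> \<omega> c p > 0"
  using \<omega>_nz dot_pos by (metis inner_g_eq_dot)

lemma eigen_dot: "p \<in> U \<Longrightarrow> dot p (\<omega> c p) (\<lambda>l. Z p k l) = \<zeta> p * \<omega> c p k"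
  using eigen[of p k] by (simp add: dot_def raise_index_eq mult.commute)

lemma smooth_T [simp]: "smooth_in c U (\<lambda>q. T c q k)"
  unfolding unit_covector_def using norm_\<omega>
  by (intro smooth_divide smooth_sqrt) (auto dest: norm_\<omega>)

lemma \<omega>_eq: "p \<in> U \<Longrightarrow> \<omega> c p k = sqrt (inner_g g \<omega> \<omega> c p) * T c p k"
  using norm_\<omega>[of p] by (simp add: unit_covector_def)

lemma unit_T: "p \<in> U \<Longrightarrow> inner_g g T T c p = 1"
proof -
  assume p: "p \<in> U"
  define N where "N = inner_g g \<omega> \<omega> c p"
  have N: "N > 0" unfolding N_def by (rule norm_\<omega>[OF p])
  have "T c p = (\<lambda>k. \<omega> c p k * (1 / sqrt N))" by (simp add: unit_covector_def N_def fun_eq_iff)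
  then have "inner_g g T T c p = (\<Sum>k\<in>UNIV. \<Sum>l\<in>UNIV. gi p k l * \<omega> c p k * \<omega> c p l * (1 / sqrt N * (1 / sqrt N)))"
    by (simp add: inner_g_def)
  also have "\<dots> = N * (1 / sqrt N * (1 / sqrt N))"
    unfolding N_def inner_g_def sum_distrib_right ..
  also have "\<dots> = 1" using N by (simp add: field_simps)
  finally show ?thesis .
qed

lemma dot_T: "p \<in> U \<Longrightarrow> dot p (T c p) (T c p) = 1"
  using unit_T inner_g_eq_dot by metis

lemma codazzi_Z:
  assumes p: "p \<in> U"
  shows "\<exists>\<psi>. \<forall>k j l. \<omega> c p k * Z p j l - \<omega> c p j * Z p k l = \<psi> k * g c p j l - \<psi> j * g c p k l"
proof -
  \<comment> \<open>The covector \<psi> will be \<open>r\<close> plus d\<phi>, the second summand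
    coming from the term \<phi> g of the Z tensor.\<close>
  define r where "r k = coord_deriv c k (\<lambda>q. scalar_curvature g c q) p / (2 * (real CARD('n) - 1))" for k
  have "Z_tensor g \<phi> = (\<lambda>c q k l. 1 * ricci g c q k l + \<phi> q * g c q k l)"
    by (simp add: Z_tensor_def fun_eq_iff)
  then have dZ: "nabla_02 g (Z_tensor g \<phi>) c p k j l = nabla_02 g (ricci g) c p k j l + coord_deriv c k \<phi> p * g c p j l" for k j l
    using nabla_02_trace_adjusted[of p "ricci g" \<phi> 1 k j l] p by simp
  have "\<omega> c p k * Z p j l - \<omega> c p j * Z p k l =
      (r k + coord_deriv c k \<phi> p) * g c p j l - (r j + coord_deriv c j \<phi> p) * g c p k l" for k j l
  proof -
    have "nabla_02 g (Z_tensor g \<phi>) c p k j l - nabla_02 g (Z_tensor g \<phi>) c p j k l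
        = \<omega> c p k * Z p j l - \<omega> c p j * Z p k l"
      unfolding wzs[OF p] Z_sym[OF p, of k j] \<omega> by (simp add: algebra_simps)
    moreover have "nabla_02 g (ricci g) c p k j l - nabla_02 g (ricci g) c p j k l = r k * g c p j l - r j * g c p k l"
      unfolding codazzi_if_conformally_harmonic[OF p dim harmonic[OF p]] r_def
      by (simp add: diff_divide_distrib)
    ultimately show ?thesis unfolding dZ by (simp add: algebra_simps)
  qed
  then show ?thesis by (intro exI[of _ "\<lambda>k. r k + coord_deriv c k \<phi> p"]) simp
qed

lemma Z_form:
  assumes p: "p \<in> U"
  shows "Z p k l = \<sigma> p * g c p k l + \<nu> p * (T c p k * T c p l)"
proof -
  obtain \<psi> where \<psi>: "\<And>k j l. \<omega> c p k * Z p j l - \<omega> c p j * Z p k l = \<psi> k * g c p j l - \<psi> j * g c p k l"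
    using codazzi_Z[OF p] by blast
  obtain k0 where k0: "\<omega> c p k0 \<noteq> 0" using \<omega>_nz[OF p] by blast
  have n: "CARD('n) > 1" using dim by simp
  have N: "dot p (\<omega> c p) (\<omega> c p) > 0" using norm_\<omega>[OF p] inner_g_eq_dot[OF p] by simp
  have "\<omega> c p k * \<omega> c p l / dot p (\<omega> c p) (\<omega> c p) = T c p k * T c p l"
    using N by (simp add: unit_covector_def inner_g_eq_dot[OF p])
  then show ?thesis
    using quasi_einstein_form[of p "\<omega> c p" k0 "Z p" "\<zeta> p" \<psi> k l, OF p n k0 Z_sym[OF p] eigen_dot[OF p] \<psi>]
    by (simp add: \<nu>_def \<sigma>_def Z_scalar_def trace_g_eq_contract)
qed

lemma smooth_Z_scalar [simp]: "smooth_in c U (\<lambda>q. Z_scalar g \<phi> c q)"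
  unfolding Z_scalar_def by simp

text \<open>The eigenvalue is given merely as a function. Its smoothness comes from the Rayleigh
  quotient Z(\<omega>, \<omega>) / |\<omega>|^2.\<close>

lemma smooth_\<zeta> [simp]: "smooth_in c U \<zeta>"
proof -
  have "smooth_in c U (\<lambda>q. dot q (\<omega> c q) (\<lambda>k. dot q (\<omega> c q) (\<lambda>l. Z q k l)) / inner_g g \<omega> \<omega> c q)"
    by (rule smooth_divide) (auto simp: dot_def raise_def dest: norm_\<omega>)
  moreover have "dot q (\<omega> c q) (\<lambda>k. dot q (\<omega> c q) (\<lambda>l. Z q k l)) / inner_g g \<omega> \<omega> c q = \<zeta> q" if q: "q \<in> U" for q
    using norm_\<omega>[OF q] by (simp add: eigen_dot[OF q] dot_linear inner_g_eq_dot[OF q])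
  ultimately show ?thesis by (subst (asm) smooth_cong) auto
qed

lemma smooth_\<sigma> [simp]: "smooth_in c U \<sigma>" and smooth_\<nu> [simp]: "smooth_in c U \<nu>"
  unfolding \<sigma>_def [abs_def] \<nu>_def [abs_def] by simp_all

lemma nabla_Z:
  assumes p: "p \<in> U"
  shows "nabla_02 g (Z_tensor g \<phi>) c p k i j =
    coord_deriv c k \<sigma> p * g c p i j + coord_deriv c k \<nu> p * (T c p i * T c p j)
    + \<nu> p * (nabla_01 g T c p k i * T c p j + T c p i * nabla_01 g T c p k j)"
proof -
  have "nabla_02 g (Z_tensor g \<phi>) c p k i j
      = nabla_02 g (\<lambda>c q i j. \<sigma> q * g c q i j + \<nu> q * (T c q i * T c q j)) c p k i j"
    using p Z_form by (rule nabla_02_cong)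
  also have "\<dots> = coord_deriv c k \<sigma> p * g c p i j + \<sigma> p * nabla_02 g g c p k i j
      + coord_deriv c k \<nu> p * (T c p i * T c p j) + \<nu> p * nabla_02 g (\<lambda>c q i j. T c q i * T c q j) c p k i j"
    using p by (subst nabla_02_add_scaled) auto
  finally show ?thesis
    using metric_parallel[OF p] p by (simp add: nabla_02_product)
qed

end

lemma exists_other_index:
  fixes j :: "'n::finite"
  assumes "CARD('n) > 1"
  obtains h where "h \<noteq> j"
proof -
  have "UNIV \<noteq> {j}" using assms by (metis card.empty card_insert_disjoint empty_iff finite.emptyI less_not_refl One_nat_def)
  then show thesis using that by blast
qed

section \<open>Consequences of a non singular Z tensor\<close>

locale nonsingular_wzs_chart = wzs_chart c U g \<phi> \<zeta> A B D \<omega>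
  for c :: "('m::topological_space, 'n::finite) chart" and U g \<phi> \<zeta> A B D \<omega> +
  fixes W :: "'m \<Rightarrow> 'n \<Rightarrow> 'n \<Rightarrow> real"
  assumes W: "p \<in> U \<Longrightarrow> (\<Sum>k\<in>UNIV. W p k h * Z p k l) = kdelta h l"
begin

text \<open>Symmetry of \<nabla>Z in its last two indices gives (B_j - D_j) Z_kl = (B_l - D_l) Z_kj.
  After multiplication by the inverse, the choice of \<open>l\<close> = \<open>h\<close> different
  from \<open>j\<close> isolates the left factor.\<close>

lemma B_eq_D:
  assumes p: "p \<in> U"
  shows "D c p j = B c p j"
proof -
  have "nabla_02 g (Z_tensor g \<phi>) c p k j l = nabla_02 g (Z_tensor g \<phi>) c p k l j" for k j l
    unfolding nabla_Z[OF p] by (simp add: g_sym[OF p, of j l])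
  then have "(B c p j - D c p j) * Z p k l = (B c p l - D c p l) * Z p k j" for k l
    using wzs[OF p, of k j l] wzs[OF p, of k l j] Z_sym[OF p, of j l] by (simp add: algebra_simps)
  then have *: "(\<Sum>k\<in>UNIV. (B c p j - D c p j) * (W p k h * Z p k l))
      = (\<Sum>k\<in>UNIV. (B c p l - D c p l) * (W p k h * Z p k j))" for h l
    by (intro sum.cong refl) (metis mult.left_commute)
  obtain h where h: "h \<noteq> j" using exists_other_index[of j] dim by auto
  show ?thesis
    using *[of h h] h unfolding sum_distrib_left[symmetric] W[OF p] by (simp add: kdelta_def)
qed

text \<open>For \<sigma> = 0 the Z tensor has rank at most one, so its product with \<open>W\<close>
  cannot be the identity in dimension above one.\<close>

lemma \<sigma>_nz: "p \<in> U \<Longrightarrow> \<sigma> p \<noteq> 0"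
proof
  assume p: "p \<in> U" and 0: "\<sigma> p = 0"
  define v where "v h = (\<Sum>k\<in>UNIV. W p k h * (\<nu> p * T c p k))" for h
  have v: "v h * T c p l = kdelta h l" for h l
    using W[OF p, of h l] unfolding Z_form[OF p] 0 v_def sum_distrib_right
    by (simp only: mult_zero_left add_0_left mult_ac)
  obtain j h :: 'n where h: "h \<noteq> j" using exists_other_index dim by (metis less_trans one_less_numeral_iff semiring_norm(77))
  \<comment> \<open>In a rank one matrix the product of two diagonal entries equals that of the
    opposite off-diagonal entries; for the identity these are 1 and 0.\<close>
  have "1 = (v h * T c p h) * (v j * T c p j)" by (simp add: v kdelta_def)
  also have "\<dots> = (v h * T c p j) * (v j * T c p h)" by simp
  also have "\<dots> = 0" using h by (simp add: v kdelta_def)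
  finally show False by simp
qed

text \<open>For \<zeta> = 0 the unit covector lies in the kernel of Z, and applying the inverse
  would make it zero.\<close>

lemma \<zeta>_nz: "p \<in> U \<Longrightarrow> \<zeta> p \<noteq> 0"
proof
  assume p: "p \<in> U" and 0: "\<zeta> p = 0"
  have Zt: "dot p (T c p) (\<lambda>l. Z p k l) = 0" for k
    unfolding Z_form[OF p] using 0 by (simp add: dot_linear dot_metric[OF p] dot_T[OF p] \<nu>_def algebra_simps)
  have "raise p (T c p) h = 0" for h
  proof -
    have "raise p (T c p) h = dot p (T c p) (\<lambda>l. kdelta h l)"
      by (simp add: dot_def)
    also have "\<dots> = (\<Sum>k\<in>UNIV. W p k h * dot p (T c p) (\<lambda>l. Z p k l))"
      unfolding W[OF p, symmetric] dot_def sum_distrib_left by (subst sum.swap) (simp only: mult_ac)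
    finally show ?thesis unfolding Zt by simp
  qed
  then show False using dot_T[OF p] by (simp add: dot_def)
qed

definition a :: "'m \<Rightarrow> real" where "a p = dot p (T c p) (A c p)"
definition b :: "'m \<Rightarrow> real" where "b p = dot p (T c p) (B c p)"

lemma smooth_ab [simp]: "smooth_in c U a" "smooth_in c U b"
  unfolding a_def [abs_def] b_def [abs_def] dot_def raise_def by simp_all

lemma
  assumes p: "p \<in> U"
  shows d\<sigma>: "coord_deriv c k \<sigma> p = a p * \<sigma> p * T c p k"
    and d\<zeta>: "coord_deriv c k \<zeta> p = (a p + 2 * b p) * \<zeta> p * T c p k"
    and nabla_T: "\<nu> p * nabla_01 g T c p k j = b p * \<sigma> p * (g c p k j - T c p k * T c p j)"
proof -
  have n: "CARD('n) > 2" using dim by simp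
  have AB: "A c p k = B c p k + sqrt (inner_g g \<omega> \<omega> c p) * T c p k" for k
    using \<omega>_eq[OF p, of k] by (simp add: \<omega>)
  have eq: "coord_deriv c k \<sigma> p * g c p i j + coord_deriv c k \<nu> p * (T c p i * T c p j)
    + \<nu> p * (nabla_01 g T c p k i * T c p j + T c p i * nabla_01 g T c p k j)
    = A c p k * (\<sigma> p * g c p i j + \<nu> p * (T c p i * T c p j)) + B c p i * (\<sigma> p * g c p k j + \<nu> p * (T c p k * T c p j))
      + B c p j * (\<sigma> p * g c p k i + \<nu> p * (T c p k * T c p i))" for k i j
    using wzs[OF p, of k i j] unfolding nabla_Z[OF p] Z_form[OF p] B_eq_D[OF p] .
  note alg = weakly_symmetric_algebra[OF p n \<sigma>_nz[OF p] dot_T[OF p]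
      nabla_unit_orthogonal[OF p smooth_T unit_T] AB eq, folded a_def b_def]
  show "coord_deriv c k \<sigma> p = a p * \<sigma> p * T c p k" by (rule alg(1))
  show "\<nu> p * nabla_01 g T c p k j = b p * \<sigma> p * (g c p k j - T c p k * T c p j)" by (rule alg(3))
  have "\<zeta> = (\<lambda>q. \<sigma> q + \<nu> q)" by (simp add: \<nu>_def fun_eq_iff)
  then have "coord_deriv c k \<zeta> p = coord_deriv c k \<sigma> p + coord_deriv c k \<nu> p"
    using coord_deriv_add[OF smooth_\<sigma> smooth_\<nu> p, of k] by simp
  then show "coord_deriv c k \<zeta> p = (a p + 2 * b p) * \<zeta> p * T c p k"
    using alg(2)[of k] by (simp add: \<nu>_def)
qed

end

section \<open>Weakly Z symmetric manifolds\<close>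

lemma riemannian_manifold_chart:
  assumes "riemannian_manifold \<A> g" "c \<in> \<A>"
  shows "metric_chart c (fst c) g"
  using assms
  by unfold_locales
    (auto simp: riemannian_manifold_def smooth_atlas_def is_chart_def tensor_field_02_def smooth_in_chart_iff)

lemma riemannian_manifold_overlap:
  assumes M: "riemannian_manifold \<A> g" and c: "c \<in> \<A>" "c' \<in> \<A>"
  shows "metric_overlap c c' (fst c \<inter> fst c') g"
proof -
  have at: "smooth_atlas \<A>" using M by (simp add: riemannian_manifold_def)
  interpret chart_overlap c c' "fst c \<inter> fst c'" using at c by (rule smooth_atlas_overlap)
  interpret old: metric_chart c "fst c" g by (rule riemannian_manifold_chart[OF M c(1)])
  interpret new: metric_chart c' "fst c'" g by (rule riemannian_manifold_chart[OF M c(2)])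
  have sub: "smooth_in e V f" if "smooth_in e (fst e) f" "V \<subseteq> fst e" for e :: "('a, 'b) chart" and V f
    using that smooth_on_subset[OF _ image_mono] unfolding smooth_in_def by blast
  show ?thesis
  proof unfold_locales
    show "smooth_in c (fst c \<inter> fst c') (\<lambda>q. g c q i j)" for i j by (rule sub) auto
    show "smooth_in c' (fst c \<inter> fst c') (\<lambda>q. g c' q i j)" for i j by (rule sub) auto
    show "g c' p k l = (\<Sum>a\<in>UNIV. \<Sum>b\<in>UNIV. jacobian c c' p a k * jacobian c c' p b l * g c p a b)"
      if "p \<in> fst c \<inter> fst c'" for p k l
      using M c that by (simp add: riemannian_manifold_def tensor_field_02_def)
    show "(\<Sum>b\<in>UNIV. jacobian c' c p k b * jacobian c c' p b l) = kdelta k l"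
      if "p \<in> fst c \<inter> fst c'" for p k l using jacobian_inverse[OF at c that] .
    show "(\<Sum>b\<in>UNIV. jacobian c c' p k b * jacobian c' c p b l) = kdelta k l"
      if "p \<in> fst c \<inter> fst c'" for p k l using jacobian_inverse[OF at c(2,1)] that by (simp add: inf_commute)
  qed (use old.g_sym old.g_pos new.g_sym new.g_pos in auto)
qed

text \<open>Outside the manifold the value depends on the choice operator and is irrelevant.\<close>

definition glue :: "('m, 'n) chart set \<Rightarrow> (('m, 'n) chart \<Rightarrow> 'm \<Rightarrow> real) \<Rightarrow> 'm \<Rightarrow> real" where
  "glue \<A> F p = F (SOME c. c \<in> \<A> \<and> p \<in> fst c) p"

lemma glue_eq:
  assumes "\<And>c c' p. c \<in> \<A> \<Longrightarrow> c' \<in> \<A> \<Longrightarrow> p \<in> fst c \<inter> fst c' \<Longrightarrow> F c' p = F c p"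
    and "c \<in> \<A>" "p \<in> fst c"
  shows "glue \<A> F p = F c p"
proof -
  have "(SOME c. c \<in> \<A> \<and> p \<in> fst c) \<in> \<A> \<and> p \<in> fst (SOME c. c \<in> \<A> \<and> p \<in> fst c)"
    by (rule someI[of _ c]) (use assms in auto)
  then show ?thesis unfolding glue_def using assms by blast
qed

lemma scalar_field_glue:
  assumes "smooth_atlas \<A>"
    and inv: "\<And>c c' p. c \<in> \<A> \<Longrightarrow> c' \<in> \<A> \<Longrightarrow> p \<in> fst c \<inter> fst c' \<Longrightarrow> F c' p = F c p"
    and smooth: "\<And>c. c \<in> \<A> \<Longrightarrow> smooth_in c (fst c) (F c)"
  shows "scalar_field \<A> (glue \<A> F)"
  unfolding scalar_field_def smooth_in_chart_iff
proof
  fix c assume c: "c \<in> \<A>"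
  interpret chart_domain c "fst c"
    using assms(1) c by unfold_locales (auto simp: smooth_atlas_def is_chart_def)
  show "smooth_in c (fst c) (glue \<A> F)"
    using smooth[OF c] by (subst smooth_cong[OF glue_eq[OF inv c]])
qed

locale wzs_manifold =
  fixes \<A> :: "('m::{t2_space, second_countable_topology}, 'n::finite) chart set"
    and g :: "('m, 'n) tensor2" and \<phi> \<zeta> :: "'m \<Rightarrow> real" and A B D \<omega> :: "('m, 'n) tensor1"
  assumes M: "riemannian_manifold \<A> g"
    and dim: "CARD('n) > 3"
    and harmonic: "conformally_harmonic \<A> g"
    and wzs: "weakly_Z_symmetric_with \<A> g \<phi> A B D"
    and \<omega>: "\<omega> = (\<lambda>c p k. A c p k - B c p k)"
    and eigen: "eigenvector \<A> g (Z_tensor g \<phi>) \<omega> \<zeta>"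
begin

abbreviation "\<tau> \<equiv> unit_covector g \<omega>"
text \<open>The chart is an argument because the eigenvalue is defined through a Z scalar computed
  in that chart; agreement of the charts is shown in \<open>base_eigenvalue_law\<close>.\<close>

abbreviation "base_eigenvalue c \<equiv> wzs_chart.\<sigma> c g \<phi> \<zeta>"
abbreviation "eigenvalue_gap c \<equiv> wzs_chart.\<nu> c g \<phi> \<zeta>"

lemma atlas: "smooth_atlas \<A>"
  using M by (simp add: riemannian_manifold_def)

lemma wzs_chart: "c \<in> \<A> \<Longrightarrow> wzs_chart c (fst c) g \<phi> \<zeta> A B D \<omega>"
proof -
  assume c: "c \<in> \<A>"
  interpret metric_chart c "fst c" g by (rule riemannian_manifold_chart[OF M c])
  show ?thesis
  proof unfold_locales
    show "smooth_in c (fst c) \<phi>" "smooth_in c (fst c) (\<lambda>q. A c q k)" "smooth_in c (fst c) (\<lambda>q. B c q k)" for k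
      using wzs c by (simp_all add: weakly_Z_symmetric_with_def scalar_field_def covector_field_def smooth_in_chart_iff)
  qed (use c dim harmonic wzs \<omega> eigen in
      \<open>auto simp: conformally_harmonic_def weakly_Z_symmetric_with_def eigenvector_def nowhere_zero_def\<close>)
qed

lemma overlap: "c \<in> \<A> \<Longrightarrow> c' \<in> \<A> \<Longrightarrow> metric_overlap c c' (fst c \<inter> fst c') g"
  by (rule riemannian_manifold_overlap[OF M])

lemma \<omega>_law:
  assumes "c \<in> \<A>" "c' \<in> \<A>" "p \<in> fst c \<inter> fst c'"
  shows "\<omega> c' p k = (\<Sum>a\<in>UNIV. jacobian c c' p a k * \<omega> c p a)"
  using wzs assms
  by (simp add: \<omega> weakly_Z_symmetric_with_def covector_field_def right_diff_distrib sum_subtractf)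

lemma norm_\<omega>_law:
  assumes "c \<in> \<A>" "c' \<in> \<A>" "p \<in> fst c \<inter> fst c'"
  shows "inner_g g \<omega> \<omega> c' p = inner_g g \<omega> \<omega> c p"
proof -
  interpret metric_overlap c c' "fst c \<inter> fst c'" g using assms(1,2) by (rule overlap)
  have "trace_g g (\<lambda>c p k l. \<omega> c p k * \<omega> c p l) c' p = trace_g g (\<lambda>c p k l. \<omega> c p k * \<omega> c p l) c p"
    by (rule trace_law[OF assms(3)])
      (simp add: \<omega>_law[OF assms] sum_product mult_ac)
  then show ?thesis by (simp add: trace_g_def inner_g_def mult.assoc)
qed

lemma T_law:
  assumes "c \<in> \<A>" "c' \<in> \<A>" "p \<in> fst c \<inter> fst c'"
  shows "\<tau> c' p k = (\<Sum>a\<in>UNIV. jacobian c c' p a k * \<tau> c p a)"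
  unfolding unit_covector_def norm_\<omega>_law[OF assms] \<omega>_law[OF assms] by (simp add: sum_divide_distrib)

lemma smooth_T: "c \<in> \<A> \<Longrightarrow> smooth_in c (fst c) (\<lambda>q. \<tau> c q k)"
  by (rule wzs_chart.smooth_T[OF wzs_chart])

lemma covector_T: "covector_field \<A> \<tau>"
  unfolding covector_field_def smooth_in_chart_iff using smooth_T T_law by blast

text \<open>Here the transformation law of the curvature enters; chart independence of both
  \<open>base_eigenvalue\<close> and \<open>eigenvalue_gap\<close> goes back to it.\<close>

lemma Z_scalar_law:
  assumes "c \<in> \<A>" "c' \<in> \<A>" "p \<in> fst c \<inter> fst c'"
  shows "Z_scalar g \<phi> c' p = Z_scalar g \<phi> c p"
proof -
  interpret metric_overlap c c' "fst c \<inter> fst c'" g using assms(1,2) by (rule overlap)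
  show ?thesis unfolding Z_scalar_def
    by (rule trace_law[OF assms(3)])
      (simp add: Z_tensor_def ricci_law[OF assms(3)] metric_law[OF assms(3)] ring_distribs sum.distrib
        sum_distrib_left mult_ac)
qed

lemma base_eigenvalue_law: "c \<in> \<A> \<Longrightarrow> c' \<in> \<A> \<Longrightarrow> p \<in> fst c \<inter> fst c' \<Longrightarrow> base_eigenvalue c' p = base_eigenvalue c p"
  using wzs_chart.\<sigma>_def[OF wzs_chart] Z_scalar_law by metis

lemma eigenvalue_gap_law: "c \<in> \<A> \<Longrightarrow> c' \<in> \<A> \<Longrightarrow> p \<in> fst c \<inter> fst c' \<Longrightarrow> eigenvalue_gap c' p = eigenvalue_gap c p"
  using wzs_chart.\<nu>_def[OF wzs_chart] base_eigenvalue_law by metis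

lemma quasi_einstein: "quasi_einstein \<A> g"
  unfolding quasi_einstein_def
proof (intro exI conjI ballI allI)
  \<comment> \<open>The Ricci tensor is Z - \<phi> g, so the coefficient of the metric is shifted by
    \<phi>. Gluing turns the chartwise coefficients into functions of the point.\<close>
  let ?F = "\<lambda>c p. base_eigenvalue c p - \<phi> p"
  have F: "?F c' p = ?F c p" if "c \<in> \<A>" "c' \<in> \<A>" "p \<in> fst c \<inter> fst c'" for c c' p
    using base_eigenvalue_law[OF that] by simp
  show "scalar_field \<A> (glue \<A> ?F)"
  proof (rule scalar_field_glue[OF atlas F])
    fix c assume "c \<in> \<A>"
    then interpret wzs_chart c "fst c" g \<phi> \<zeta> A B D \<omega> by (rule wzs_chart)
    show "smooth_in c (fst c) (?F c)" by simp
  qed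
  show "scalar_field \<A> (glue \<A> eigenvalue_gap)"
    by (rule scalar_field_glue[OF atlas eigenvalue_gap_law wzs_chart.smooth_\<nu>[OF wzs_chart]])
  show "covector_field \<A> \<tau>" by (rule covector_T)
  fix c p assume c: "c \<in> \<A>" and p: "p \<in> fst c"
  interpret wzs_chart c "fst c" g \<phi> \<zeta> A B D \<omega> using c by (rule wzs_chart)
  show "inner_g g T \<tau> c p = 1" using p by (rule unit_T)
  show "ricci g c p k l = glue \<A> ?F p * g c p k l + glue \<A> eigenvalue_gap p * \<tau> c p k * \<tau> c p l" for k l
  proof -
    have \<alpha>: "glue \<A> ?F p = base_eigenvalue c p - \<phi> p"
      using glue_eq[of \<A> ?F, OF F c p] .
    have \<beta>: "glue \<A> eigenvalue_gap p = eigenvalue_gap c p"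
      using glue_eq[of \<A> eigenvalue_gap, OF eigenvalue_gap_law c p] .
    show ?thesis
      unfolding \<alpha> \<beta> using Z_form[OF p, of k l] by (simp add: Z_tensor_def algebra_simps)
  qed
qed

end

locale nonsingular_wzs_manifold = wzs_manifold \<A> g \<phi> \<zeta> A B D \<omega>
  for \<A> :: "('m::{t2_space, second_countable_topology}, 'n::finite) chart set"
    and g \<phi> \<zeta> A B D \<omega> +
  assumes nonsingular: "nonsingular \<A> (Z_tensor g \<phi>)"
begin

lemma nonsingular_chart:
  "\<exists>W. \<forall>c\<in>\<A>. nonsingular_wzs_chart c (fst c) g \<phi> \<zeta> A B D \<omega> (W c)"
proof -
  obtain W where "\<forall>c\<in>\<A>. \<forall>p\<in>fst c. \<forall>h l. (\<Sum>k\<in>UNIV. W c p k h * Z_tensor g \<phi> c p k l) = kdelta h l"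
    using nonsingular unfolding nonsingular_def by blast
  then have "\<forall>c\<in>\<A>. nonsingular_wzs_chart c (fst c) g \<phi> \<zeta> A B D \<omega> (W c)"
    using wzs_chart by (auto simp: nonsingular_wzs_chart_def nonsingular_wzs_chart_axioms_def)
  then show ?thesis by blast
qed

text \<open>Both d\<zeta> and d\<sigma> are multiples of the unit covector, and so is
  \<omega>.\<close>

lemma deriv_eigenvalue_gap:
  assumes c: "c \<in> \<A>" and p: "p \<in> fst c"
  shows "\<omega> c p j * coord_deriv c k (eigenvalue_gap c) p - \<omega> c p k * coord_deriv c j (eigenvalue_gap c) p = 0"
proof -
  obtain W where "nonsingular_wzs_chart c (fst c) g \<phi> \<zeta> A B D \<omega> W" using nonsingular_chart c by blast
  then interpret nonsingular_wzs_chart c "fst c" g \<phi> \<zeta> A B D \<omega> W .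
  have "coord_deriv c k (eigenvalue_gap c) p = ((a p + 2 * b p) * \<zeta> p - a p * base_eigenvalue c p) * \<tau> c p k" for k
    unfolding \<nu>_def [abs_def] coord_deriv_diff[OF smooth_\<zeta> smooth_\<sigma> p] d\<sigma>[OF p] d\<zeta>[OF p]
    by (simp add: algebra_simps)
  then show ?thesis using \<omega>_eq[OF p] by simp
qed

end

section \<open>The concircular covector\<close>

locale nondegenerate_wzs_manifold = nonsingular_wzs_manifold \<A> g \<phi> \<zeta> A B D \<omega>
  for \<A> :: "('m::{t2_space, second_countable_topology}, 'n::finite) chart set"
    and g \<phi> \<zeta> A B D \<omega> +
  assumes nondegenerate: "nowhere_locally_degenerate \<A> g \<phi> \<zeta>"
begin

text \<open>By nondegeneracy the zeros of the gap contain no nonempty open set, whereas a continuous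
  \<open>G\<close> that is nonzero at \<open>p\<close> is nonzero on a whole neighbourhood.\<close>

lemma vanishing_by_density:
  assumes c: "c \<in> \<A>" and G: "smooth_in c (fst c) G"
    and 0: "\<And>q. q \<in> fst c \<Longrightarrow> eigenvalue_gap c q * G q = 0" and p: "p \<in> fst c"
  shows "G p = 0"
proof (rule ccontr)
  assume nz: "G p \<noteq> 0"
  interpret wzs_chart c "fst c" g \<phi> \<zeta> A B D \<omega> using c by (rule wzs_chart)
  let ?V = "fst c \<inter> G -` (- {0})"
  have "open ?V"
    using smooth_continuous_on[OF G] open_U by (intro continuous_open_preimage) auto
  moreover have "?V \<noteq> {}" "?V \<subseteq> points \<A>" using nz p c by (auto simp: points_def)
  ultimately obtain c' q where q: "c' \<in> \<A>" "q \<in> fst c'" "q \<in> ?V"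
    "real CARD('n) * \<zeta> q - Z_scalar g \<phi> c' q \<noteq> 0"
    using nondegenerate unfolding nowhere_locally_degenerate_def by blast
  \<comment> \<open>Nondegeneracy provides its own chart \<open>c'\<close> around \<open>q\<close>;
    the Z scalar has to be carried back to \<open>c\<close>.\<close>
  then have "real CARD('n) * \<zeta> q - Z_scalar g \<phi> c q \<noteq> 0"
    using Z_scalar_law[OF c q(1), of q] by auto
  then have "eigenvalue_gap c q \<noteq> 0" using \<nu>_eq[of q] dim by simp
  then show False using 0[of q] q(3) by simp
qed

text \<open>The value is forced: tracing \<nabla>_k T_j = f (T_k T_j - g_kj) for a unit covector
  gives f (1 - n).\<close>

definition f :: "('m, 'n) chart \<Rightarrow> 'm \<Rightarrow> real" where
  "f c p = - trace_g g (nabla_01 g \<tau>) c p / (real CARD('n) - 1)"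

lemma f_law:
  assumes "c \<in> \<A>" "c' \<in> \<A>" "p \<in> fst c \<inter> fst c'"
  shows "f c' p = f c p"
proof -
  interpret metric_overlap c c' "fst c \<inter> fst c'" g using assms(1,2) by (rule overlap)
  have s: "smooth_in c (fst c \<inter> fst c') (\<lambda>q. \<tau> c q k)" for k
    using smooth_T[OF assms(1), of k] smooth_on_subset[OF _ image_mono] unfolding smooth_in_def by blast
  have "trace_g g (nabla_01 g \<tau>) c' p = trace_g g (nabla_01 g \<tau>) c p"
    by (rule trace_law[OF assms(3)]) (rule nabla_01_law[OF assms(3) s T_law[OF assms(1,2)]])
  then show ?thesis by (simp add: f_def)
qed

lemma smooth_f:
  assumes c: "c \<in> \<A>"
  shows "smooth_in c (fst c) (f c)"
proof -
  interpret wzs_chart c "fst c" g \<phi> \<zeta> A B D \<omega> using c by (rule wzs_chart)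
  show ?thesis unfolding f_def [abs_def] by simp
qed

lemma
  assumes c: "c \<in> \<A>" and p: "p \<in> fst c"
  shows nabla_T: "nabla_01 g \<tau> c p j l = f c p * (\<tau> c p j * \<tau> c p l - g c p j l)"
    and closed_T: "coord_deriv c i (\<lambda>q. \<tau> c q j) p = coord_deriv c j (\<lambda>q. \<tau> c q i) p"
    and f_proportional: "coord_deriv c i (f c) p * \<tau> c p j = coord_deriv c j (f c) p * \<tau> c p i"
proof -
  obtain W where "nonsingular_wzs_chart c (fst c) g \<phi> \<zeta> A B D \<omega> W" using nonsingular_chart c by blast
  then interpret nonsingular_wzs_chart c "fst c" g \<phi> \<zeta> A B D \<omega> W .
  note smooth_f[OF c, simp]
  \<comment> \<open>The trace of \<open>nabla_T\<close> in the chart; it relates \<open>f\<close> to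
    the pointwise algebra without dividing by the gap.\<close>
  have f\<nu>: "f c q * eigenvalue_gap c q = - (b q * base_eigenvalue c q)" if q: "q \<in> fst c" for q
  proof -
    have "eigenvalue_gap c q * trace_g g (nabla_01 g \<tau>) c q = contract q (\<lambda>k j. eigenvalue_gap c q * nabla_01 g \<tau> c q k j)"
      by (simp add: trace_g_eq_contract contract_linear)
    also have "\<dots> = b q * base_eigenvalue c q * (real CARD('n) - 1)"
      unfolding nabla_T[OF q] contract_linear contract_metric[OF q] contract_product[OF q] dot_T[OF q] ..
    finally show ?thesis using dim by (simp add: f_def field_simps)
  qed
  have form: "nabla_01 g \<tau> c q j l = f c q * (\<tau> c q j * \<tau> c q l - g c q j l)" if q: "q \<in> fst c" for q j l
  proof -
    have "nabla_01 g \<tau> c q j l - f c q * (\<tau> c q j * \<tau> c q l - g c q j l) = 0"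
    proof (rule vanishing_by_density[OF c _ _ q])
      show "smooth_in c (fst c) (\<lambda>q. nabla_01 g \<tau> c q j l - f c q * (\<tau> c q j * \<tau> c q l - g c q j l))"
        by simp
      fix q assume q: "q \<in> fst c"
      have "eigenvalue_gap c q * (f c q * (\<tau> c q j * \<tau> c q l - g c q j l)) = b q * base_eigenvalue c q * (g c q j l - \<tau> c q j * \<tau> c q l)"
        using arg_cong[OF f\<nu>[OF q], of "\<lambda>x. x * (\<tau> c q j * \<tau> c q l - g c q j l)"] by (simp add: algebra_simps)
      then show "eigenvalue_gap c q * (nabla_01 g \<tau> c q j l - f c q * (\<tau> c q j * \<tau> c q l - g c q j l)) = 0"
        using nabla_T[OF q, of j l] by (simp add: right_diff_distrib)
    qed
    then show ?thesis by simp
  qed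
  show "nabla_01 g \<tau> c p j l = f c p * (\<tau> c p j * \<tau> c p l - g c p j l)" using p by (rule form)
  have closed: "coord_deriv c i (\<lambda>q. \<tau> c q j) q = coord_deriv c j (\<lambda>q. \<tau> c q i) q" if q: "q \<in> fst c" for q i j
  proof -
    have "nabla_01 g \<tau> c q i j = nabla_01 g \<tau> c q j i"
      unfolding form[OF q] by (simp add: g_sym[OF q, of i] mult.commute)
    then show ?thesis by (simp add: nabla_01_def christoffel_sym[OF q, of _ i j])
  qed
  show "coord_deriv c i (\<lambda>q. \<tau> c q j) p = coord_deriv c j (\<lambda>q. \<tau> c q i) p" using p by (rule closed)
  \<comment> \<open>\<open>wd u\<close> is the (i, j) component of du wedge T; for a unit covector
    T, all of these vanish exactly when du is a multiple of T. As a derivation in \<open>u\<close>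
    it obeys the Leibniz rule \<open>wd_mult\<close>.\<close>
  define wd where "wd u q = coord_deriv c i u q * \<tau> c q j - coord_deriv c j u q * \<tau> c q i" for u q
  have wd_mult: "wd (\<lambda>q. u q * v q) q = u q * wd v q + wd u q * v q"
    if "smooth_in c (fst c) u" "smooth_in c (fst c) v" "q \<in> fst c" for u v q
    using that by (simp add: wd_def coord_deriv_mult algebra_simps)
  have wd_b: "wd b q = 0" and wd_\<sigma>: "wd (base_eigenvalue c) q = 0" and wd_\<nu>: "wd (eigenvalue_gap c) q = 0" if q: "q \<in> fst c" for q
  proof -
    \<comment> \<open>If du = v T, then \<open>z\<close> expresses that du wedge T = 0 and
      \<open>z'\<close>, resting on d(du) = 0 and closedness of T, that dv wedge T = 0. Applied to v
      = a \<sigma> and v = (a + 2 b) \<zeta>, the Leibniz rule strips off the nonvanishing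
      eigenvalues.\<close>
    have z: "wd u q = 0" if "smooth_in c (fst c) u" "smooth_in c (fst c) v"
      "\<And>q k. q \<in> fst c \<Longrightarrow> coord_deriv c k u q = v q * \<tau> c q k" for u v
      using that q by (simp add: wd_def)
    have z': "wd v q = 0" if "smooth_in c (fst c) u" "smooth_in c (fst c) v"
      "\<And>q k. q \<in> fst c \<Longrightarrow> coord_deriv c k u q = v q * \<tau> c q k" for u v
      unfolding wd_def using deriv_proportional[OF q smooth_T closed[OF q] that, of i j] by simp
    show s: "wd (base_eigenvalue c) q = 0" by (rule z[of _ "\<lambda>q. a q * base_eigenvalue c q"]) (auto simp: d\<sigma>)
    have x: "wd \<zeta> q = 0" by (rule z[of _ "\<lambda>q. (a q + 2 * b q) * \<zeta> q"]) (auto simp: d\<zeta>)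
    have "wd (\<lambda>q. a q * base_eigenvalue c q) q = 0" by (rule z'[of "base_eigenvalue c"]) (auto simp: d\<sigma>)
    then have "wd a q = 0" using wd_mult[of a "base_eigenvalue c" q] s q \<sigma>_nz[OF q] by simp
    have "wd (\<lambda>q. (a q + 2 * b q) * \<zeta> q) q = 0" by (rule z'[of \<zeta>]) (auto simp: d\<zeta>)
    then have "wd (\<lambda>q. a q + 2 * b q) q = 0"
      using wd_mult[of "\<lambda>q. a q + 2 * b q" \<zeta> q] x q \<zeta>_nz[OF q] by simp
    moreover have "wd (\<lambda>q. a q + 2 * b q) q = wd a q + 2 * wd b q"
      using q by (simp add: wd_def coord_deriv_rules algebra_simps)
    ultimately show "wd b q = 0" using \<open>wd a q = 0\<close> by simp
    have "wd (eigenvalue_gap c) q = wd \<zeta> q - wd (base_eigenvalue c) q"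
      unfolding \<nu>_def [abs_def] using q by (simp add: wd_def coord_deriv_rules algebra_simps)
    then show "wd (eigenvalue_gap c) q = 0" using s x by simp
  qed
  \<comment> \<open>Since both b \<sigma> and the gap have derivatives parallel to T, the relation
    \<open>f\<nu>\<close> shows that the gap times \<open>wd (f c)\<close> vanishes, and density
    removes the gap.\<close>
  have "wd (f c) p = 0"
  proof (rule vanishing_by_density[OF c _ _ p])
    show "smooth_in c (fst c) (wd (f c))" unfolding wd_def [abs_def] by simp
    fix q assume q: "q \<in> fst c"
    have "wd (\<lambda>q. f c q * eigenvalue_gap c q) q = wd (\<lambda>q. - (b q * base_eigenvalue c q)) q"
      unfolding wd_def using coord_deriv_cong[OF q f\<nu>] by simp
    also have "\<dots> = - wd (\<lambda>q. b q * base_eigenvalue c q) q"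
      using q by (simp add: wd_def coord_deriv_minus)
    also have "\<dots> = 0"
      using q wd_mult[of b "base_eigenvalue c" q] wd_b[OF q] wd_\<sigma>[OF q] by simp
    finally show "eigenvalue_gap c q * wd (f c) q = 0"
      using q wd_mult[of "f c" "eigenvalue_gap c" q] wd_\<nu>[OF q] by auto
  qed
  then show "coord_deriv c i (f c) p * \<tau> c p j = coord_deriv c j (f c) p * \<tau> c p i"
    by (simp add: wd_def)
qed

lemma proper_concircular_T: "proper_concircular \<A> g \<tau>"
proof -
  define F where "F = glue \<A> f"
  have F: "F p = f c p" if "c \<in> \<A>" "p \<in> fst c" for c p
    unfolding F_def using f_law that by (rule glue_eq)
  have sF: "scalar_field \<A> F"
    unfolding F_def
    by (rule scalar_field_glue[OF atlas f_law smooth_f])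
  \<comment> \<open>The identity for \<nabla>T is the concircular equation with \<mu> = f T and
    \<rho> = - f.\<close>
  define \<mu> :: "('m, 'n) tensor1" where "\<mu> = (\<lambda>c p k. F p * \<tau> c p k)"
  show ?thesis
    unfolding proper_concircular_def
  proof (intro conjI exI)
    show "covector_field \<A> \<tau>" by (rule covector_T)
    show "nowhere_zero \<A> \<tau>"
      unfolding nowhere_zero_def
    proof (intro ballI)
      fix c p assume c: "c \<in> \<A>" and p: "p \<in> fst c"
      interpret wzs_chart c "fst c" g \<phi> \<zeta> A B D \<omega> using c by (rule wzs_chart)
      show "\<exists>k. \<tau> c p k \<noteq> 0"
      proof (rule ccontr)
        assume "\<not> ?thesis"
        then have "dot p (\<tau> c p) (\<tau> c p) = 0" by (simp add: dot_def)
        then show False using dot_T[OF p] by simp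
      qed
    qed
    show "covector_field \<A> \<mu>"
      unfolding covector_field_def smooth_in_chart_iff
    proof (intro conjI ballI allI)
      fix c k assume c: "c \<in> \<A>"
      interpret wzs_chart c "fst c" g \<phi> \<zeta> A B D \<omega> using c by (rule wzs_chart)
      have "smooth_in c (fst c) F" using sF c by (simp add: scalar_field_def smooth_in_chart_iff)
      then show "smooth_in c (fst c) (\<lambda>p. \<mu> c p k)" unfolding \<mu>_def by simp
    next
      fix c c' p k assume "c \<in> \<A>" "c' \<in> \<A>" "p \<in> fst c \<inter> fst c'"
      then show "\<mu> c' p k = (\<Sum>a\<in>UNIV. jacobian c c' p a k * \<mu> c p a)"
        by (simp add: \<mu>_def T_law sum_distrib_left mult_ac)
    qed
    show "scalar_field \<A> (\<lambda>p. - F p)"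
      unfolding scalar_field_def smooth_in_chart_iff
    proof
      fix c assume c: "c \<in> \<A>"
      interpret wzs_chart c "fst c" g \<phi> \<zeta> A B D \<omega> using c by (rule wzs_chart)
      show "smooth_in c (fst c) (\<lambda>p. - F p)"
        using sF c by (simp add: scalar_field_def smooth_in_chart_iff)
    qed
    \<comment> \<open>d(f T) = df wedge T + f dT, and both summands vanish. Symmetry of the
      Christoffel symbols transfers this to the covariant form of closedness.\<close>
    show "closed_form \<A> g \<mu>"
      unfolding closed_form_def
    proof (intro ballI allI)
      fix c p i j assume c: "c \<in> \<A>" and p: "p \<in> fst c"
      interpret wzs_chart c "fst c" g \<phi> \<zeta> A B D \<omega> using c by (rule wzs_chart)
      have "coord_deriv c i (\<lambda>q. \<mu> c q j) p = coord_deriv c i (\<lambda>q. f c q * \<tau> c q j) p" for i j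
        using p F[OF c] by (intro coord_deriv_cong) (simp_all add: \<mu>_def)
      then have "coord_deriv c i (\<lambda>q. \<mu> c q j) p = f c p * coord_deriv c i (\<lambda>q. \<tau> c q j) p + coord_deriv c i (f c) p * \<tau> c p j" for i j
        using p smooth_f[OF c] by (simp add: coord_deriv_mult)
      then have "coord_deriv c i (\<lambda>q. \<mu> c q j) p = coord_deriv c j (\<lambda>q. \<mu> c q i) p"
        using closed_T[OF c p, of i j] f_proportional[OF c p, of i j] by simp
      then show "nabla_01 g \<mu> c p i j = nabla_01 g \<mu> c p j i"
        by (simp add: nabla_01_def christoffel_sym[OF p, of _ i j])
    qed
    show "\<forall>c\<in>\<A>. \<forall>p\<in>fst c. \<forall>j l. nabla_01 g \<tau> c p j l = \<mu> c p j * \<tau> c p l + - F p * g c p j l"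
      using nabla_T F by (simp add: \<mu>_def algebra_simps)
  qed
qed

end

theorem theorem5p2:
  fixes \<A> :: "('m::{t2_space, second_countable_topology}, 'n::finite) chart set"
    and g :: "('m, 'n) tensor2"
    and \<phi> \<zeta> :: "'m \<Rightarrow> real"
    and A B D \<omega> :: "('m, 'n) tensor1"
  assumes "riemannian_manifold \<A> g"
    and "CARD('n) > 3"
    and "conformally_harmonic \<A> g"
    and "weakly_Z_symmetric_with \<A> g \<phi> A B D"
    and "\<omega> = (\<lambda>c p k. A c p k - B c p k)"
    and "eigenvector \<A> g (Z_tensor g \<phi>) \<omega> \<zeta>"
  shows "quasi_einstein \<A> g \<and>
    (nonsingular \<A> (Z_tensor g \<phi>) \<and>
     (\<forall>c\<in>\<A>. \<forall>p\<in>fst c. \<forall>j k.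
        \<omega> c p j * coord_deriv c k \<phi> p - \<omega> c p k * coord_deriv c j \<phi> p = 0)
     \<longrightarrow>
     (\<forall>c\<in>\<A>. \<forall>p\<in>fst c. \<forall>j k.
        \<omega> c p j * coord_deriv c k
          (\<lambda>q. (real CARD('n) * \<zeta> q - Z_scalar g \<phi> c q) / (real CARD('n) - 1)) p
        - \<omega> c p k * coord_deriv c j
          (\<lambda>q. (real CARD('n) * \<zeta> q - Z_scalar g \<phi> c q) / (real CARD('n) - 1)) p = 0) \<and>
     (nowhere_locally_degenerate \<A> g \<phi> \<zeta> \<longrightarrow> (\<exists>X. proper_concircular \<A> g X)))"
proof -
  interpret wzs_manifold \<A> g \<phi> \<zeta> A B D \<omega>
    using assms by unfold_locales
  \<comment> \<open>The quantity differentiated in the theorem is the difference \<zeta> - \<sigma>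
    of the two eigenvalues.\<close>
  have gap: "eigenvalue_gap c = (\<lambda>q. (real CARD('n) * \<zeta> q - Z_scalar g \<phi> c q) / (real CARD('n) - 1))"
    if "c \<in> \<A>" for c
    using wzs_chart.\<nu>_eq[OF wzs_chart[OF that]] by (rule ext)
  show ?thesis
  proof (intro conjI impI ballI allI)
    show "quasi_einstein \<A> g" by (rule quasi_einstein)
  next
    fix c p j k
    assume h: "nonsingular \<A> (Z_tensor g \<phi>) \<and>
     (\<forall>c\<in>\<A>. \<forall>p\<in>fst c. \<forall>j k.
        \<omega> c p j * coord_deriv c k \<phi> p - \<omega> c p k * coord_deriv c j \<phi> p = 0)"
      and c: "c \<in> \<A>" and p: "p \<in> fst c"
    interpret nonsingular_wzs_manifold \<A> g \<phi> \<zeta> A B D \<omega>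
      using h by unfold_locales simp
    show "\<omega> c p j * coord_deriv c k
          (\<lambda>q. (real CARD('n) * \<zeta> q - Z_scalar g \<phi> c q) / (real CARD('n) - 1)) p
        - \<omega> c p k * coord_deriv c j
          (\<lambda>q. (real CARD('n) * \<zeta> q - Z_scalar g \<phi> c q) / (real CARD('n) - 1)) p = 0"
      using deriv_eigenvalue_gap[OF c p, of j k] unfolding gap[OF c] .
  next
    assume h: "nonsingular \<A> (Z_tensor g \<phi>) \<and>
     (\<forall>c\<in>\<A>. \<forall>p\<in>fst c. \<forall>j k.
        \<omega> c p j * coord_deriv c k \<phi> p - \<omega> c p k * coord_deriv c j \<phi> p = 0)"
      and nd: "nowhere_locally_degenerate \<A> g \<phi> \<zeta>"
    interpret nondegenerate_wzs_manifold \<A> g \<phi> \<zeta> A B D \<omega>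
      using h nd by unfold_locales simp_all
    show "\<exists>X. proper_concircular \<A> g X" using proper_concircular_T by blast
  qed
qed

end
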